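(* Let $K\ge2$, and let $\mathcal G$ be the genealogical graph of the coloring process without seeds on the $(K+1)$-regular infinite tree $\mathcal T$. Write its decomposition into connected components as $\mathcal G=\bigsqcup_{i\in I}\mathcal C_i$. Fix $M\ge1$ and distinct vertices $\tilde s_1,\dots,\tilde s_M\in\mathcal T$ chosen as seeds, and let $\tilde{\mathcal G}$ be the genealogical graph with these seeds, coupled with $\mathcal G$ by using the same arrival times $(\tau_v)_{v\in\mathcal T}$, except that now $\tau_{\tilde s_j}=0$ for all $1\le j\le M$, and the same tie-breaking indexings. Then, almost surely, the decomposition of $\tilde{\mathcal G}$ into connected components satisfies $$\tilde{\mathcal G}=\bigsqcup_{i\in I}\tilde{\mathcal C}_i\ \sqcup\ \bigsqcup_{j=1}^M\tilde{\mathcal U}_j,$$ where 1. For each $i\in I$, $\tilde{\mathcal C}_i$ is an infinite oriented subtree of $\mathcal C_i$. In particular $\operatorname{dir}\tilde{\mathcal C}_i=\operatorname{dir}\mathcal C_i$. 2. For each $j\in\{1,\dots,M\}$, $\tilde{\mathcal U}_j$ is an oriented tree rooted at $\tilde s_j$. Moreover: (a) For $v\in\tilde{\mathcal U}_j$, $v\ne\tilde s_j$, the set $\tilde D(v)$ of descendants of $v$ in $\tilde{\mathcal U}_j$ is finite with $\mathbb E[\sharp\tilde D(v)\mid\tau_v]<\infty$. (b) The component $\tilde{\mathcal U}_j$ is infinite if and only if $\tilde s_j$ has infinite degree (in $\tilde{\mathcal U}_j$). Furthermore, $\mathbb P(\tilde s_j\text{ has infinite degree in }\tilde{\mathcal U}_j)$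 equals $1$ if the set $\{v\in\mathcal T: d(v,\tilde s_j)=\min_{i\le M}d(v,\tilde s_i)\}$ is infinite, and equals $0$ otherwise.
   Context: Tree notation. $K\ge2$ is a fixed integer; $\mathcal T$ is the infinite tree in which every vertex has $K+1$ neighbors, with a fixed root $o$; $d$ is the graph distance. $\partial\mathcal T$ is the set of infinite rays (infinite non-backtracking paths starting from $o$). $\mathcal T_v$ is the set of vertices $w$ such that the geodesic from $o$ to $w$ passes through $v$. Arrival times and indexings. For each $w\in\mathcal T$, a uniform increasing indexing centered at $w$ is a random enumeration $(z_j^w)_{j\ge1}$ of all vertices of $\mathcal T$ without repetition, such that $j<i$ implies $d(w,z_j^w)\le d(w,z_i^w)$, and such that for each $r$ the induced order on the vertices at distance $r$ from $w$ is uniform among all orderings and independent of the orders induced at the other distances. Let $(\tau_v)_{v\in\mathcal T}$ be i.i.d. with an atomless distribution on $(0,\infty)$, and let the indexings $((z_j^w)_{j\ge1})_{w\in\mathcal T}$ be independent of each other and of the arrival times. Genealogical graphs. Without seeds: the parent $p(v)$ of $v$ is the first vertex $z_j^v$ in the indexing centered at $v$ such that $\tau_{z_j^v}<\tau_v$; $\mathcal G$ is the oriented graph on $\mathcal T$ with edges $(v,p(v))$. With seeds: the arrival times of the seeds are replaced by $0$; seeds have no parent, and each non-seed vertex $v$ has a parent $\tilde p(v)$ defined by the same rule (same indexings) with the modified arrival times; $\tilde{\mathcal G}$ is the oriented graph on $\mathcal T$ with edges $(v,\tilde p(v))$, $v$ not a seed. The ancestral path of $v$ is the (finite or infinite) sequence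 obtained by iterating the parent map starting from $v$, and the descendants of $v$ are the vertices whose ancestral path contains $v$. Direction. A component $\mathcal C$ whose vertices have infinite ancestral paths has direction $\operatorname{dir}\mathcal C=(w_i)_{i\ge1}\in\partial\mathcal T$ if for every vertex $v$ of $\mathcal C$ and every $i$, all but finitely many vertices of the ancestral path of $v$ belong to $\mathcal T_{w_i}$; almost surely every connected component of $\mathcal G$ has a direction. *)

theory Defs
  imports "HOL-Probability.Probability" "Graph_Theory.Digraph_Component"
begin

type_synonym 'v graph = "('v, 'v \<times> 'v) pre_digraph"

text \<open>
  A symmetric digraph represents an undirected graph. There, going back and forth along an edge
  is a \<open>cycle\<close>, so \<open>forest\<close> and \<open>tree\<close> from Graph_Theory do not apply and the length is bounded
  from below. Loops and, in oriented graphs, pairs of opposite arcs are excluded separately.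
\<close>
definition no_undirected_cycle :: "'v graph \<Rightarrow> bool" where
  "no_undirected_cycle G \<longleftrightarrow>
     \<not> (\<exists>p. pre_digraph.cycle (with_proj (mk_symmetric G)) p \<and> 3 \<le> length p)"

text \<open>The vertex set of the tree is the whole type.\<close>
definition regular_tree :: "nat \<Rightarrow> 'v pair_pre_digraph \<Rightarrow> bool" where
  "regular_tree k T \<longleftrightarrow>
     pair_bidirected_digraph T \<and> pverts T = UNIV \<and>
     Digraph_Component.connected (with_proj T) \<and> no_undirected_cycle (with_proj T) \<and>
     (\<forall>v. finite (out_arcs (with_proj T) v) \<and> out_degree (with_proj T) v = k)"

definition gdist :: "'v pair_pre_digraph \<Rightarrow> 'v \<Rightarrow> 'v \<Rightarrow> nat" where
  "gdist T u v = (LEAST n. \<exists>p. pre_digraph.awalk (with_proj T) u p v \<and> length p = n)"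

definition sphere_at :: "'v pair_pre_digraph \<Rightarrow> 'v \<Rightarrow> nat \<Rightarrow> 'v set" where
  "sphere_at T w r = {v. gdist T w v = r}"

definition oriented_tree :: "'v graph \<Rightarrow> bool" where
  "oriented_tree H \<longleftrightarrow>
     (\<forall>(u, v) \<in> arcs H. (v, u) \<notin> arcs H) \<and>
     Digraph_Component.connected H \<and> no_undirected_cycle H"

text \<open>Arcs point from child to parent, that is, towards the root.\<close>
definition oriented_tree_rooted_at :: "'v graph \<Rightarrow> 'v \<Rightarrow> bool" where
  "oriented_tree_rooted_at H r \<longleftrightarrow>
     oriented_tree H \<and> r \<in> verts H \<and> (\<forall>v \<in> verts H. v \<rightarrow>\<^sup>*\<^bsub>H\<^esub> r)"

definition components :: "'v graph \<Rightarrow> 'v graph set" where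
  "components G = {C. pre_digraph.max_subgraph G Digraph_Component.connected C}"

definition component_of :: "'v graph \<Rightarrow> 'v \<Rightarrow> 'v graph" where
  "component_of G v = (THE C. C \<in> components G \<and> v \<in> verts C)"

definition infinite_degree :: "'v graph \<Rightarrow> 'v \<Rightarrow> bool" where
  "infinite_degree H v \<longleftrightarrow> infinite (in_arcs H v \<union> out_arcs H v)"

text \<open>Rays are indexed from 0, with the root as first vertex.\<close>
definition rays :: "'v pair_pre_digraph \<Rightarrow> 'v \<Rightarrow> (nat \<Rightarrow> 'v) set" where
  "rays T rt = {\<xi>. \<xi> 0 = rt \<and> (\<forall>i. (\<xi> i, \<xi> (Suc i)) \<in> parcs T) \<and> (\<forall>i. \<xi> (Suc (Suc i)) \<noteq> \<xi> i)}"

definition subtree_at :: "'v pair_pre_digraph \<Rightarrow> 'v \<Rightarrow> 'v \<Rightarrow> 'v set" where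
  "subtree_at T rt v =
     {w. \<exists>p. pre_digraph.awalk (with_proj T) rt p w \<and> length p = gdist T rt w \<and>
             v \<in> set (pre_digraph.awalk_verts (with_proj T) rt p)}"

text \<open>
  \<open>t\<close> gives the arrival times and \<open>\<zeta> v\<close> is the indexing centered at \<open>v\<close>, counted from 0.
  The value \<open>None\<close> arises when no vertex arrives before \<open>v\<close>; without seeds this has probability 0.
\<close>
definition parent :: "('v \<Rightarrow> real) \<Rightarrow> ('v \<Rightarrow> nat \<Rightarrow> 'v) \<Rightarrow> 'v \<Rightarrow> 'v option" where
  "parent t \<zeta> v =
     (if \<exists>j. t (\<zeta> v j) < t v then Some (\<zeta> v (LEAST j. t (\<zeta> v j) < t v)) else None)"

definition seeded_parent ::
    "'v set \<Rightarrow> ('v \<Rightarrow> real) \<Rightarrow> ('v \<Rightarrow> nat \<Rightarrow> 'v) \<Rightarrow> 'v \<Rightarrow> 'v option" where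
  "seeded_parent S t \<zeta> v =
     (if v \<in> S then None else parent (\<lambda>u. if u \<in> S then 0 else t u) \<zeta> v)"

definition genealogical_graph :: "('v \<Rightarrow> 'v option) \<Rightarrow> 'v graph" where
  "genealogical_graph par = with_proj \<lparr>pverts = UNIV, parcs = {(v, w). par v = Some w}\<rparr>"

primrec ancestor :: "('v \<Rightarrow> 'v option) \<Rightarrow> nat \<Rightarrow> 'v \<Rightarrow> 'v option" where
  "ancestor par 0 v = Some v"
| "ancestor par (Suc n) v = Option.bind (ancestor par n v) par"

definition ancestral_path :: "('v \<Rightarrow> 'v option) \<Rightarrow> 'v \<Rightarrow> 'v set" where
  "ancestral_path par v = {w. \<exists>n. ancestor par n v = Some w}"

definition descendants :: "('v \<Rightarrow> 'v option) \<Rightarrow> 'v \<Rightarrow> 'v set" where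
  "descendants par v = {w. v \<in> ancestral_path par w}"

definition has_direction ::
    "'v pair_pre_digraph \<Rightarrow> 'v \<Rightarrow> ('v \<Rightarrow> 'v option) \<Rightarrow> 'v graph \<Rightarrow> (nat \<Rightarrow> 'v) \<Rightarrow> bool" where
  "has_direction T rt par C \<xi> \<longleftrightarrow>
     \<xi> \<in> rays T rt \<and>
     (\<forall>v \<in> verts C. (\<forall>n. ancestor par n v \<noteq> None) \<and>
        (\<forall>i. finite (ancestral_path par v - subtree_at T rt (\<xi> i))))"

definition induced_order :: "'v set \<Rightarrow> (nat \<Rightarrow> 'v) \<Rightarrow> 'v rel" where
  "induced_order S f = {(x, y). x \<in> S \<and> y \<in> S \<and> (\<exists>i j. i \<le> j \<and> f i = x \<and> f j = y)}"

definition uniform_increasing_indexing ::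
    "'a measure \<Rightarrow> 'v pair_pre_digraph \<Rightarrow> 'v \<Rightarrow> ('a \<Rightarrow> nat \<Rightarrow> 'v) \<Rightarrow> bool" where
  "uniform_increasing_indexing P T w Z \<longleftrightarrow>
     Z \<in> measurable P (PiM UNIV (\<lambda>_. count_space UNIV)) \<and>
     (\<forall>\<omega> \<in> space P. bij (Z \<omega>) \<and> (\<forall>i j. j < i \<longrightarrow> gdist T w (Z \<omega> j) \<le> gdist T w (Z \<omega> i))) \<and>
     (\<forall>r R. linear_order_on (sphere_at T w r) R \<longrightarrow>
        measure P {\<omega> \<in> space P. induced_order (sphere_at T w r) (Z \<omega>) = R}
          = 1 / real (card {R'. linear_order_on (sphere_at T w r) R'})) \<and>
     prob_space.indep_vars P (\<lambda>_. count_space UNIV)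
       (\<lambda>r \<omega>. induced_order (sphere_at T w r) (Z \<omega>)) (UNIV :: nat set)"

definition atomless_on_positive_reals :: "real measure \<Rightarrow> bool" where
  "atomless_on_positive_reals \<nu> \<longleftrightarrow>
     prob_space \<nu> \<and> sets \<nu> = sets borel \<and> emeasure \<nu> {0<..} = 1 \<and> (\<forall>x. emeasure \<nu> {x} = 0)"

text \<open>
  Arrival times and indexings have different types, so their joint independence is expressed
  through the \<open>\<sigma>\<close>-algebras they generate.
\<close>
definition coloring_randomness ::
    "'a measure \<Rightarrow> 'v pair_pre_digraph \<Rightarrow> real measure \<Rightarrow>
     ('v \<Rightarrow> 'a \<Rightarrow> real) \<Rightarrow> ('v \<Rightarrow> 'a \<Rightarrow> nat \<Rightarrow> 'v) \<Rightarrow> bool" where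
  "coloring_randomness P T \<nu> \<tau> z \<longleftrightarrow>
     prob_space P \<and> atomless_on_positive_reals \<nu> \<and>
     (\<forall>v. \<tau> v \<in> borel_measurable P \<and> distr P borel (\<tau> v) = \<nu>) \<and>
     (\<forall>w. uniform_increasing_indexing P T w (z w)) \<and>
     prob_space.indep_sets P
       (case_sum (\<lambda>v. sets (vimage_algebra (space P) (\<tau> v) borel))
                 (\<lambda>w. sets (vimage_algebra (space P) (z w) (PiM UNIV (\<lambda>_. count_space UNIV)))))
       UNIV"

text \<open>\<open>nn_cond_exp\<close> is 0 for a non-measurable integrand, so finiteness is only meaningful together with
  measurability of the cardinality of \<open>D\<close>.\<close>
definition cond_exp_card :: "'a measure \<Rightarrow> ('a \<Rightarrow> real) \<Rightarrow> ('a \<Rightarrow> 'v set) \<Rightarrow> 'a \<Rightarrow> ennreal" where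
  "cond_exp_card P X D =
     nn_cond_exp P (vimage_algebra (space P) X borel) (\<lambda>\<omega>. emeasure (count_space UNIV) (D \<omega>))"

end

theory Submission
  imports Defs
begin

text \<open>
  Let F be the distribution function of the arrival times. As F is continuous, the marks X v = F
  (\<tau> v) are independent and uniform on [0, 1], and an earlier arrival has a smaller or equal
  mark.

  Seeds reroute: the parent of v with seeds is either the old parent of v or a seed. So an
  ancestral path with seeds follows the old one and stops if it is rerouted. Suppose that along
  each old ancestral path only finitely many vertices are rerouted. Then every old component
  contains vertices whose whole path is kept; these form one component with seeds, with the same
  ends of paths, and all other vertices belong to the component of some seed (locale rerouting,
  bij_betw_components). A vertex w can be rerouted only if some seed is at most as far from w as
  the parent of w. Hence the task is to show that, for the ancestral path w_0, w_1, ... of a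
  vertex and for each vertex x, eventually d(w_n, w_(n+1)) < d(w_n, x)
  (AE_eventually_short_jumps). This also gives the direction: such a path finally stays in one
  component of the tree without x, for each x (ray_of_short_jumps).

  That claim and the bound on the number of descendants are first moment estimates, summed over
  all candidate paths w_0, ..., w_n. When the path has arrived at w_i, everything it has explored
  lies on one side of w_i (lineage_invariant). So a jump from w_i of length q passes over at least
  K^(q-1) - 1 vertices that are explored for the first time, and none of them has a mark below s =
  X(w_i); this costs a factor (1 - s)^(K^(q-1) - 1), while the decreasing marks along the path
  contribute the volume of a simplex (weight_peel). For paths that end at v with a mark above t,
  the costs have a finite sum A over the possible starting points of a jump, and the expected
  number of descendants of v is at most the sum of A^n / n! (weight_late_le). For long jumps,
  K^(-d(w,x)/3) times a power of the mark is a potential which one step of the path reproduces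
  with a factor of order 1/(k+1) (weight_potential_step), so the n-th ancestor jumps as far as x
  with a probability bounded by B^n / n!, and the Borel-Cantelli lemma applies.

  The children of a seed r lie in the cell of the vertices that have no seed closer than r. If
  this cell is infinite, it contains all vertices behind some vertex y (cell_contains_cone). Such
  a vertex v is a child of r if its mark is minimal in the ball of radius d(v, r) and r comes
  first in the indexing at v among the seeds at this distance (marked_minimum_is_child). The
  second event is independent of the marks and has probability at least 1/M. The expected number
  of such v at distance k behind y is bounded below uniformly in k; minima at different places are
  almost uncorrelated, so the variance of their number grows at most linearly in the number of
  levels, like the mean, and by Chebyshev's inequality there are infinitely many
  (AE_infinite_marked_minima).
\<close>

section \<open>Distances in a regular tree\<close>

text \<open>
  The last two assumptions express that there are no cycles: exactly one edge at x leads towards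
  v, and no edge joins two vertices at the same distance from v.
\<close>

locale tree_metric =
  fixes d :: "'v \<Rightarrow> 'v \<Rightarrow> nat" and K :: nat
  assumes K_ge2: "2 \<le> K"
    and dist_0_iff [simp]: "d x y = 0 \<longleftrightarrow> x = y"
    and dist_sym: "d x y = d y x"
    and dist_triangle: "d x y \<le> d x w + d w y"
    and card_nbrs: "card {y. d x y = 1} = Suc K"
    and ex1_closer_nbr: "v \<noteq> x \<Longrightarrow> \<exists>!n. d x n = 1 \<and> d n v < d x v"
    and nbr_dist_neq: "d x n = 1 \<Longrightarrow> d n v \<noteq> d x v"
begin

definition nbrs :: "'v \<Rightarrow> 'v set" where "nbrs x = {y. d x y = 1}"

definition nxt :: "'v \<Rightarrow> 'v \<Rightarrow> 'v" where
  "nxt x v = (THE n. d x n = 1 \<and> d n v < d x v)"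

text \<open>
  The vertex e lies on the geodesic from x to y.
\<close>

definition btw :: "'v \<Rightarrow> 'v \<Rightarrow> 'v \<Rightarrow> bool" where
  "btw x e y \<longleftrightarrow> d x y = d x e + d e y"

lemma dist_self [simp]: "d x x = 0" by simp

lemma nbr_cases:
  assumes "d x n = 1"
  shows "d n v = Suc (d x v) \<or> d x v = Suc (d n v)"
  using dist_triangle[of n v x] dist_triangle[of x v n] nbr_dist_neq[OF assms, of v] assms
    dist_sym[of n x] by linarith

lemma nxt:
  assumes "v \<noteq> x"
  shows "d x (nxt x v) = 1" "d x v = Suc (d (nxt x v) v)"
proof -
  have *: "d x (nxt x v) = 1 \<and> d (nxt x v) v < d x v"
    unfolding nxt_def by (rule theI'[OF ex1_closer_nbr[OF assms]])
  then show "d x (nxt x v) = 1" by simp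
  show "d x v = Suc (d (nxt x v) v)" using * nbr_cases[of x "nxt x v" v] by auto
qed

lemma nxt_eqI:
  assumes "d x n = 1" "d x v = Suc (d n v)"
  shows "nxt x v = n"
proof -
  have "v \<noteq> x" using assms(2) by (metis dist_self nat.distinct(1))
  from ex1_closer_nbr[OF this] show ?thesis
    unfolding nxt_def using assms by (intro the1_equality) auto
qed

lemma nxt_nbrs: "v \<noteq> x \<Longrightarrow> nxt x v \<in> nbrs x"
  using nxt(1) by (simp add: nbrs_def)

lemma farther_nbr:
  assumes "d x n = 1" "v \<noteq> x \<Longrightarrow> n \<noteq> nxt x v"
  shows "d n v = Suc (d x v)"
  using nbr_cases[OF assms(1), of v] assms nxt_eqI[OF assms(1), of v]
  by (metis dist_self nat.distinct(1))

text \<open>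
  On the way from x to v each step leads away from u, because the only neighbor closer to u is the
  vertex that has just been left.
\<close>

lemma btw_of_nxt_neq:
  assumes "u \<noteq> x" "v \<noteq> x" "nxt x u \<noteq> nxt x v"
  shows "btw u x v"
  using assms
proof (induction "d x v" arbitrary: x rule: less_induct)
  case less
  let ?y = "nxt x v"
  have y: "d x ?y = 1" "d x v = Suc (d ?y v)" using nxt less.prems by auto
  have uy: "d ?y u = Suc (d x u)" using farther_nbr[OF y(1), of u] less.prems by metis
  have yx: "d ?y x = 1" using y(1) dist_sym by metis
  show ?case
  proof (cases "?y = v")
    case True
    then show ?thesis using uy y unfolding btw_def by (metis dist_sym dist_self Suc_eq_plus1 One_nat_def)
  next
    case False
    have nu: "nxt ?y u = x" using nxt_eqI[OF yx uy] .
    have "nxt ?y v \<noteq> x" using nxt(2)[of v ?y] False y by (metis n_not_Suc_n le_antisym lessI less_or_eq_imp_le)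
    then have "btw u ?y v" using less.hyps[of ?y] y nu False uy
      by (metis dist_self lessI nat.distinct(1))
    then show ?thesis using uy y dist_sym[of u x] dist_sym[of u ?y] unfolding btw_def by simp
  qed
qed

lemma not_btw_nxt_eq:
  assumes "u \<noteq> x" "v \<noteq> x" "nxt x u = nxt x v"
  shows "\<not> btw u x v"
  using dist_triangle[of u v "nxt x v"] nxt[of u x] nxt[of v x] assms dist_sym
  unfolding btw_def by (metis add_Suc add_Suc_right le_imp_less_Suc less_SucI less_not_refl nat_less_le)

lemma btw_iff_nxt_neq:
  "u \<noteq> x \<Longrightarrow> v \<noteq> x \<Longrightarrow> btw u x v \<longleftrightarrow> nxt x u \<noteq> nxt x v"
  using btw_of_nxt_neq not_btw_nxt_eq by blast

lemma btw_refl [simp]: "btw e e y" "btw x e e"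
  by (auto simp: btw_def)

text \<open>
  If e separates c from u, then b is separated by e from at least one of them.
\<close>

lemma tripod:
  assumes "btw c e u"
  shows "btw c e b \<or> btw b e u"
proof (cases "e = c \<or> e = u \<or> e = b")
  case False
  then show ?thesis using assms btw_iff_nxt_neq by metis
qed auto

text \<open>
  For adjacent x and n these are the vertices at distance k from n that are reached from x through
  n.
\<close>

definition cone :: "'v \<Rightarrow> 'v \<Rightarrow> nat \<Rightarrow> 'v set" where
  "cone x n k = {u. d n u = k \<and> d x u = Suc k}"

lemma finite_nbrs [simp]: "finite (nbrs x)"
  using card_nbrs[of x] unfolding nbrs_def by (metis card.infinite nat.distinct(1))

lemma card_nbrs': "card (nbrs x) = Suc K"
  using card_nbrs unfolding nbrs_def by simp

lemma nbrs_sym: "x \<in> nbrs y \<longleftrightarrow> y \<in> nbrs x"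
  using dist_sym unfolding nbrs_def by simp

lemma cone_nxt: "d x n = 1 \<Longrightarrow> u \<in> cone x n k \<Longrightarrow> nxt x u = n \<and> u \<noteq> x"
  unfolding cone_def using nxt_eqI[of x n u] by auto

lemma cone_disjoint:
  assumes "n \<in> nbrs x" "m \<in> nbrs x" "n \<noteq> m"
  shows "cone x n k \<inter> cone x m l = {}"
  using assms cone_nxt unfolding nbrs_def by blast

lemma cone_Suc:
  assumes "n \<in> nbrs x"
  shows "cone x n (Suc k) = (\<Union>m\<in>nbrs n - {x}. cone n m k)"
proof (intro equalityI subsetI)
  fix u assume u: "u \<in> cone x n (Suc k)"
  then have "u \<noteq> n" by (auto simp: cone_def)
  from nxt[OF this] u have m: "d n (nxt n u) = 1" "d (nxt n u) u = k" "d n u = Suc k" "d x u = Suc (Suc k)"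
    by (auto simp: cone_def)
  then have "nxt n u \<noteq> x" by auto
  with m show "u \<in> (\<Union>m\<in>nbrs n - {x}. cone n m k)" by (auto simp: cone_def nbrs_def)
next
  fix u assume "u \<in> (\<Union>m\<in>nbrs n - {x}. cone n m k)"
  then obtain m where m: "d n m = 1" "m \<noteq> x" "u \<in> cone n m k" by (auto simp: nbrs_def)
  then have "nxt n u = m" "u \<noteq> n" using cone_nxt by auto
  moreover have "d n x = 1" using assms dist_sym by (simp add: nbrs_def)
  ultimately have "d x u = Suc (d n u)" using farther_nbr[of n x u] m by metis
  then show "u \<in> cone x n (Suc k)" using m by (auto simp: cone_def)
qed

lemma cone_card:
  assumes "n \<in> nbrs x"
  shows "finite (cone x n k) \<and> card (cone x n k) = K ^ k"
  using assms
proof (induction k arbitrary: x n)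
  case 0
  have "cone x n 0 = {n}" using 0 by (auto simp: cone_def nbrs_def)
  then show ?case by simp
next
  case (Suc k)
  have fin: "finite (nbrs n - {x})" by simp
  have x: "x \<in> nbrs n" using Suc.prems nbrs_sym by simp
  have "card (\<Union>m\<in>nbrs n - {x}. cone n m k) = (\<Sum>m\<in>nbrs n - {x}. card (cone n m k))"
    using Suc.IH cone_disjoint by (intro card_UN_disjoint fin) (blast, blast)
  also have "\<dots> = (\<Sum>m\<in>nbrs n - {x}. K ^ k)" using Suc.IH by (intro sum.cong) auto
  also have "\<dots> = K * K ^ k" using x card_nbrs'[of n] by simp
  finally show ?case using Suc.IH fin by (simp add: cone_Suc[OF Suc.prems])
qed

lemmas finite_cone = cone_card[THEN conjunct1]
lemmas card_cone = cone_card[THEN conjunct2]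

definition sphere :: "'v \<Rightarrow> nat \<Rightarrow> 'v set" where "sphere x r = {u. d x u = r}"

lemma sphere_0: "sphere x 0 = {x}" by (auto simp: sphere_def)

lemma sphere_Suc: "sphere x (Suc k) = (\<Union>n\<in>nbrs x. cone x n k)"
proof (intro equalityI subsetI)
  fix u assume u: "u \<in> sphere x (Suc k)"
  then have "u \<noteq> x" by (auto simp: sphere_def)
  from nxt[OF this] u show "u \<in> (\<Union>n\<in>nbrs x. cone x n k)"
    by (auto simp: cone_def nbrs_def sphere_def)
qed (auto simp: cone_def sphere_def)

lemma finite_sphere [simp]: "finite (sphere x r)"
  by (cases r) (auto simp: sphere_0 sphere_Suc finite_cone)

lemma card_sphere_Suc: "card (sphere x (Suc k)) = Suc K * K ^ k"
proof -
  have "card (\<Union>n\<in>nbrs x. cone x n k) = (\<Sum>n\<in>nbrs x. card (cone x n k))"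
    using finite_cone cone_disjoint by (intro card_UN_disjoint) (simp, blast, blast)
  also have "\<dots> = (\<Sum>n\<in>nbrs x. K ^ k)" using card_cone by (intro sum.cong) auto
  finally show ?thesis using card_nbrs'[of x] by (simp add: sphere_Suc)
qed

lemma finite_dist_less: "finite {u. d a u < r}"
proof -
  have "{u. d a u < r} = (\<Union>k<r. sphere a k)" by (auto simp: sphere_def)
  then show ?thesis by simp
qed

lemma countable_UNIV: "countable (UNIV :: 'v set)"
proof -
  fix x :: 'v
  have "(UNIV :: 'v set) = (\<Union>k. sphere x k)" by (auto simp: sphere_def)
  then show ?thesis by (metis countable_UN countable_finite finite_sphere countableI_type)
qed

text \<open>
  The neighbor of a towards c leads back; each of the other K neighbors of a is the root of a
  cone.
\<close>

lemma card_forward_sphere: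
  assumes "c \<noteq> a"
  shows "card {u. d a u = k \<and> btw c a u} = K ^ k"
proof (cases k)
  case 0
  then have "{u. d a u = k \<and> btw c a u} = {a}" by auto
  then show ?thesis using 0 by simp
next
  case (Suc l)
  have "{u. d a u = k \<and> btw c a u} = (\<Union>n\<in>nbrs a - {nxt a c}. cone a n l)" (is "?L = ?R")
  proof (intro equalityI subsetI)
    fix u assume u: "u \<in> ?L"
    then have ua: "u \<noteq> a" using Suc by auto
    then have "nxt a u \<noteq> nxt a c" using u assms btw_iff_nxt_neq[of c a u] by auto
    then show "u \<in> ?R" using nxt[OF ua] u Suc by (auto simp: nbrs_def cone_def)
  next
    fix u assume "u \<in> ?R"
    then obtain n where n: "d a n = 1" "n \<noteq> nxt a c" "u \<in> cone a n l" by (auto simp: nbrs_def)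
    then have "nxt a u = n" "u \<noteq> a" using cone_nxt by auto
    then show "u \<in> ?L" using n assms Suc btw_iff_nxt_neq[of c a u] by (auto simp: cone_def)
  qed
  also have "card \<dots> = (\<Sum>n\<in>nbrs a - {nxt a c}. card (cone a n l))"
    using finite_cone cone_disjoint by (intro card_UN_disjoint) (simp, blast, blast)
  also have "\<dots> = (\<Sum>n\<in>nbrs a - {nxt a c}. K ^ l)" using card_cone by (intro sum.cong) auto
  also have "\<dots> = K ^ k" using card_nbrs'[of a] nxt_nbrs[OF assms] Suc by simp
  finally show ?thesis .
qed

text \<open>
  A geodesic of length q from w that first goes b steps towards x ends at distance d w x + q - 2 b
  from x, and there are about K^(q-b) of these. As K a^2 > 1, the sum over b is of the order of
  its term for b = 0. The induction moves w one step towards x.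
\<close>

lemma sum_power_dist_sphere_le:
  fixes a :: real
  assumes a: "0 < a" "a \<le> 1" and Ka: "real K * a\<^sup>2 > 1" and C: "C = max 2 (1 / (1 - 1 / (real K * a\<^sup>2)))"
  shows "(\<Sum>u\<in>sphere w q. a ^ d u x) \<le> C * (real K * a) ^ q * a ^ d w x"
proof (induction q arbitrary: w)
  case 0
  have "1 * a ^ d w x \<le> C * a ^ d w x" using a C by (intro mult_right_mono) auto
  then show ?case by (simp add: sphere_0)
next
  case (Suc q)
  define b where "b = real K * a\<^sup>2"
  have cone_sum: "(\<Sum>u\<in>cone w n q. a ^ d u x) = (real K * a) ^ q * (a * a ^ d w x)"
    if n: "n \<in> nbrs w" and n': "x \<noteq> w \<Longrightarrow> n \<noteq> nxt w x" for n
  proof -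
    have "d u x = d w x + Suc q" if u: "u \<in> cone w n q" for u
    proof (cases "x = w")
      case True
      then show ?thesis using u dist_sym[of u] by (auto simp: cone_def)
    next
      case False
      then have "btw u w x" using n n' cone_nxt[of w n u q] u btw_iff_nxt_neq[of u w x]
        by (metis mem_Collect_eq nbrs_def)
      then show ?thesis using u dist_sym[of u] unfolding btw_def cone_def by auto
    qed
    then have "(\<Sum>u\<in>cone w n q. a ^ d u x) = (\<Sum>u\<in>cone w n q. a ^ (d w x + Suc q))" by simp
    also have "\<dots> = real K ^ q * a ^ (d w x + Suc q)" using card_cone[OF n] by simp
    finally show ?thesis by (simp add: power_add power_mult_distrib mult_ac)
  qed
  have split: "(\<Sum>u\<in>sphere w (Suc q). a ^ d u x) = (\<Sum>n\<in>nbrs w. \<Sum>u\<in>cone w n q. a ^ d u x)"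
    unfolding sphere_Suc using finite_cone cone_disjoint by (intro sum.UNION_disjoint) (simp, blast, blast)
  have Kq: "0 \<le> (real K * a) ^ q" using a by simp
  show ?case
  proof (cases "x = w")
    case True
    have "(\<Sum>u\<in>sphere w (Suc q). a ^ d u x) = (\<Sum>n\<in>nbrs w. (real K * a) ^ q * (a * a ^ d w x))"
      unfolding split using cone_sum True by (intro sum.cong) auto
    also have "\<dots> = (real K + 1) * ((real K * a) ^ q * (a * a ^ d w x))" using card_nbrs'[of w] by simp
    also have "\<dots> \<le> (2 * real K) * ((real K * a) ^ q * (a * a ^ d w x))"
      using K_ge2 a Kq by (intro mult_right_mono) auto
    also have "\<dots> = 2 * ((real K * a) ^ Suc q * a ^ d w x)" by simp
    also have "\<dots> \<le> C * ((real K * a) ^ Suc q * a ^ d w x)"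
      using C a by (intro mult_right_mono) auto
    finally show ?thesis by (simp add: mult.assoc)
  next
    case False
    let ?n = "nxt w x"
    have n: "?n \<in> nbrs w" "d w x = Suc (d ?n x)" using nxt_nbrs nxt(2) False by auto
    have "(\<Sum>u\<in>cone w ?n q. a ^ d u x) \<le> (\<Sum>u\<in>sphere ?n q. a ^ d u x)"
      using a by (intro sum_mono2 finite_sphere) (auto simp: cone_def sphere_def)
    also have "\<dots> \<le> C * (real K * a) ^ q * a ^ d ?n x" by (rule Suc.IH)
    finally have 1: "(\<Sum>u\<in>cone w ?n q. a ^ d u x) \<le> C * (real K * a) ^ q * a ^ d ?n x" .
    have "(\<Sum>m\<in>nbrs w - {?n}. \<Sum>u\<in>cone w m q. a ^ d u x)
        = (\<Sum>m\<in>nbrs w - {?n}. (real K * a) ^ q * (a * a ^ d w x))"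
      using cone_sum by (intro sum.cong) auto
    also have "\<dots> = real K * ((real K * a) ^ q * (a * a ^ d w x))" using card_nbrs'[of w] n by simp
    finally have 2: "(\<Sum>m\<in>nbrs w - {?n}. \<Sum>u\<in>cone w m q. a ^ d u x) = (real K * a) ^ Suc q * a ^ d w x"
      by simp
    have Cb: "1 + C / b \<le> C"
    proof -
      have "C \<ge> 1 / (1 - 1 / b)" using C b_def by simp
      moreover have b1: "b > 1" using Ka b_def by simp
      ultimately have "C * (1 - 1 / b) \<ge> 1" by (simp add: field_simps)
      then show ?thesis by (simp add: algebra_simps)
    qed
    have "(\<Sum>u\<in>sphere w (Suc q). a ^ d u x) =
        (\<Sum>u\<in>cone w ?n q. a ^ d u x) + (\<Sum>m\<in>nbrs w - {?n}. \<Sum>u\<in>cone w m q. a ^ d u x)"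
      unfolding split using n by (intro sum.remove) auto
    also have "\<dots> \<le> C * (real K * a) ^ q * a ^ d ?n x + (real K * a) ^ Suc q * a ^ d w x"
      using 1 2 by simp
    also have "C * (real K * a) ^ q * a ^ d ?n x = C / b * ((real K * a) ^ Suc q * a ^ d w x)"
      using a K_ge2 n(2) by (simp add: b_def power2_eq_square field_simps)
    also have "C / b * ((real K * a) ^ Suc q * a ^ d w x) + (real K * a) ^ Suc q * a ^ d w x
        = (1 + C / b) * ((real K * a) ^ Suc q * a ^ d w x)" by (simp add: algebra_simps)
    also have "\<dots> \<le> C * ((real K * a) ^ Suc q * a ^ d w x)" using Cb a by (intro mult_right_mono) auto
    finally show ?thesis by (simp add: mult.assoc)
  qed
qed

end

section \<open>Independent uniform marks\<close>

definition unif :: "real measure" where "unif = uniform_measure lborel {0..1}"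

lemma sets_unif [simp, measurable_cong]: "sets unif = sets borel"
  by (simp add: unif_def)

lemma space_unif [simp]: "space unif = UNIV" by (simp add: unif_def)

lemma prob_space_unif: "prob_space unif"
  unfolding unif_def by (rule prob_space_uniform_measure) auto

lemma nn_integral_unif:
  assumes [measurable]: "f \<in> borel_measurable borel"
  shows "(\<integral>\<^sup>+x. f x \<partial>unif) = (\<integral>\<^sup>+x. f x * indicator {0..1} x \<partial>lborel)"
  unfolding unif_def by (subst nn_integral_uniform_measure) (auto simp: divide_ennreal_def)

lemma emeasure_unif_atLeast:
  assumes "0 \<le> s" "s \<le> 1"
  shows "emeasure unif {s..} = ennreal (1 - s)"
proof -
  have "{0..1} \<inter> {s..} = {s..1}" using assms by auto
  then show ?thesis unfolding unif_def using assms by (subst emeasure_uniform_measure) (auto simp: divide_ennreal_def)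
qed

lemma measurable_emeasure_unif_atLeast [measurable]:
  "(\<lambda>s. emeasure unif {s..}) \<in> borel_measurable borel"
proof -
  interpret prob_space unif by (rule prob_space_unif)
  have "(\<lambda>s. emeasure unif {s..}) = (\<lambda>s. \<integral>\<^sup>+y. indicator {p. fst p \<le> snd p} (s, y) \<partial>unif)"
  proof
    fix s :: real
    have "(\<integral>\<^sup>+y. indicator {p. fst p \<le> snd p} (s, y) \<partial>unif) = (\<integral>\<^sup>+y. indicator {s..} y \<partial>unif)"
      by (intro nn_integral_cong) (auto simp: indicator_def)
    then show "emeasure unif {s..} = (\<integral>\<^sup>+y. indicator {p. fst p \<le> snd p} (s, y) \<partial>unif)" by simp
  qed
  also have "\<dots> \<in> borel_measurable borel" by measurable
  finally show ?thesis .
qed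

text \<open>
  The contribution of a new mark that has to be at most s.
\<close>

definition below :: "(real \<Rightarrow> ennreal) \<Rightarrow> real \<Rightarrow> ennreal" where
  "below \<phi> s = (\<integral>\<^sup>+y. \<phi> y * indicator {..s} y \<partial>unif)"

lemma measurable_below [measurable]:
  assumes [measurable]: "\<phi> \<in> borel_measurable borel"
  shows "below \<phi> \<in> borel_measurable borel"
proof -
  interpret prob_space unif by (rule prob_space_unif)
  have "below \<phi> = (\<lambda>s. \<integral>\<^sup>+y. \<phi> y * indicator {p. snd p \<le> fst p} (s, y) \<partial>unif)"
    unfolding below_def by (intro ext nn_integral_cong) (auto simp: indicator_def)
  also have "\<dots> \<in> borel_measurable borel" by measurable
  finally show ?thesis .
qed

definition unif_field :: "('v \<Rightarrow> real) measure" where "unif_field = (\<Pi>\<^sub>M _\<in>UNIV. unif)"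

lemma prob_space_field: "prob_space unif_field"
  unfolding unif_field_def by (intro prob_space_PiM prob_space_unif)

lemma space_field [simp]: "space unif_field = UNIV"
  by (auto simp: unif_field_def space_PiM PiE_def)

lemma sets_field: "sets (unif_field :: ('v \<Rightarrow> real) measure) = sets (\<Pi>\<^sub>M _\<in>UNIV. borel)"
  unfolding unif_field_def by (intro sets_PiM_cong) auto

lemma measurable_field_component [measurable]: "(\<lambda>x. x v) \<in> borel_measurable unif_field"
proof -
  have "(\<lambda>x. x v) \<in> measurable unif_field unif" unfolding unif_field_def by (intro measurable_component_singleton) auto
  then show ?thesis by (simp cong: measurable_cong_sets)
qed

lemma measurable_field_upd: "(\<lambda>(x, y). x(b := y)) \<in> measurable (unif_field \<Otimes>\<^sub>M borel) unif_field"
proof -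
  have "(\<lambda>(x, y). x(b := y)) = (\<lambda>p v. if v = b then snd p else fst p v)"
    by (auto simp: fun_eq_iff)
  also have "\<dots> \<in> measurable (unif_field \<Otimes>\<^sub>M borel) (\<Pi>\<^sub>M _\<in>UNIV. borel)"
    by (rule measurable_PiM_single') (auto simp: PiE_def, measurable)
  finally show ?thesis by (simp add: sets_field cong: measurable_cong_sets)
qed

lemma AE_field_unit: "AE x in unif_field. x v \<in> {0<..1::real}"
proof -
  have "AE y in lborel. y \<in> {0..1::real} \<longrightarrow> y \<in> {0<..1}"
    using AE_lborel_singleton[of "0::real"] by eventually_elim auto
  then have "AE y in unif. y \<in> {0<..1::real}"
    unfolding unif_def by (intro AE_uniform_measureI) auto
  then show ?thesis unfolding unif_field_def
    by (intro AE_PiM_component prob_space_unif) auto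
qed

text \<open>
  Replacing the mark of b by an independent copy does not change the law of the marks. This is how
  single marks are integrated out below, without fixing a finite set of coordinates.
\<close>

lemma nn_integral_resample:
  assumes f [measurable]: "f \<in> borel_measurable unif_field"
  shows "(\<integral>\<^sup>+x. f x \<partial>unif_field) = (\<integral>\<^sup>+x. \<integral>\<^sup>+y. f (x(b := y)) \<partial>unif \<partial>unif_field)"
proof -
  interpret u: prob_space unif by (rule prob_space_unif)
  let ?N = "\<Pi>\<^sub>M _\<in>UNIV - {b}. unif"
  interpret N: prob_space ?N by (intro prob_space_PiM prob_space_unif)
  interpret pair_sigma_finite unif ?N ..
  have ins: "insert b (UNIV - {b}) = UNIV" by auto
  have M: "unif_field = distr (unif \<Otimes>\<^sub>M ?N) unif_field (\<lambda>(x, X). X(b := x))"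
    using distr_pair_PiM_eq_PiM[of "UNIV - {b}" "\<lambda>_. unif" b, OF prob_space_unif prob_space_unif]
    unfolding ins unif_field_def by simp
  have meas: "(\<lambda>(x, X). X(b := x)) \<in> measurable (unif \<Otimes>\<^sub>M ?N) unif_field"
    using measurable_compose[OF measurable_pair_swap' measurable_add_dim[where i=b and I="UNIV - {b}" and M="\<lambda>_. unif"]]
    unfolding ins unif_field_def by (simp add: case_prod_beta cong: measurable_cong_sets)
  have *: "(\<integral>\<^sup>+x. g x \<partial>unif_field) = (\<integral>\<^sup>+X. \<integral>\<^sup>+y. g (X(b := y)) \<partial>unif \<partial>?N)"
    if g [measurable]: "g \<in> borel_measurable unif_field" for g
  proof -
    have gm: "(\<lambda>p. g ((\<lambda>(x, X). X(b := x)) p)) \<in> borel_measurable (unif \<Otimes>\<^sub>M ?N)"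
      using measurable_compose[OF meas g] .
    have "(\<integral>\<^sup>+x. g x \<partial>unif_field) = (\<integral>\<^sup>+x. g x \<partial>distr (unif \<Otimes>\<^sub>M ?N) unif_field (\<lambda>(x, X). X(b := x)))"
      using M by simp
    also have "\<dots> = (\<integral>\<^sup>+p. g ((\<lambda>(x, X). X(b := x)) p) \<partial>(unif \<Otimes>\<^sub>M ?N))"
      using g by (intro nn_integral_distr meas) simp
    also have "\<dots> = (\<integral>\<^sup>+X. \<integral>\<^sup>+y. g (X(b := y)) \<partial>unif \<partial>?N)"
      using nn_integral_snd[OF gm] by simp
    finally show ?thesis .
  qed
  have g: "(\<lambda>x. \<integral>\<^sup>+y. f (x(b := y)) \<partial>unif) \<in> borel_measurable unif_field"
    using measurable_field_upd [measurable] by measurable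
  show ?thesis
    unfolding *[OF g] by (simp add: *[OF f] u.emeasure_space_1 flip: space_unif)
qed

lemma nn_integral_resample_point:
  assumes G [measurable]: "G \<in> borel_measurable unif_field"
    and g [measurable]: "case_prod g \<in> borel_measurable (borel \<Otimes>\<^sub>M borel)"
    and indep: "\<And>x y. G (x(b := y)) = G x" and ab: "a \<noteq> b"
  shows "(\<integral>\<^sup>+x. G x * g (x a) (x b) \<partial>unif_field) = (\<integral>\<^sup>+x. G x * (\<integral>\<^sup>+y. g (x a) y \<partial>unif) \<partial>unif_field)"
proof -
  have gm: "(\<lambda>x. g (x a) (x b)) \<in> borel_measurable unif_field"
    using measurable_compose[OF measurable_Pair[OF measurable_field_component[of a] measurable_field_component[of b]] g]
    by simp
  have gs: "g s \<in> borel_measurable unif" for s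
    using measurable_compose[OF measurable_Pair1'[of s borel borel] g] by (simp cong: measurable_cong_sets)
  have "(\<integral>\<^sup>+x. G x * g (x a) (x b) \<partial>unif_field)
      = (\<integral>\<^sup>+x. \<integral>\<^sup>+y. G (x(b := y)) * g ((x(b := y)) a) ((x(b := y)) b) \<partial>unif \<partial>unif_field)"
    using gm by (intro nn_integral_resample) measurable
  also have "\<dots> = (\<integral>\<^sup>+x. \<integral>\<^sup>+y. G x * g (x a) y \<partial>unif \<partial>unif_field)"
    using ab by (simp add: indep)
  also have "\<dots> = (\<integral>\<^sup>+x. G x * (\<integral>\<^sup>+y. g (x a) y \<partial>unif) \<partial>unif_field)"
    using gs by (intro nn_integral_cong nn_integral_cmult) auto
  finally show ?thesis .
qed

text \<open>
  Given the mark of a, each vertex of F contributes the same independent factor.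
\<close>

lemma nn_integral_resample_block:
  assumes F: "finite F" "a \<notin> F"
    and G: "G \<in> borel_measurable unif_field"
    and indep: "\<And>u x y. u \<in> F \<Longrightarrow> G (x(u := y)) = G x"
  shows "(\<integral>\<^sup>+x. G x * indicator {x. \<forall>u\<in>F. x a \<le> x u} x \<partial>unif_field)
       = (\<integral>\<^sup>+x. G x * emeasure unif {x a..} ^ card F \<partial>unif_field)"
  using F G indep
proof (induction F arbitrary: G rule: finite_induct)
  case empty
  then show ?case by simp
next
  case (insert b F)
  have [measurable]: "G \<in> borel_measurable unif_field" by fact
  have fin [measurable]: "finite F" by fact
  have set [measurable]: "{x. \<forall>u\<in>F. x a \<le> x u} \<in> sets unif_field"
  proof -
    have le: "{x \<in> space unif_field. x a \<le> x u} \<in> sets unif_field" for u by measurable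
    have "{x \<in> space unif_field. \<forall>u\<in>F. x a \<le> x u} \<in> sets unif_field"
      using fin le by (intro sets.sets_Collect_finite_All) auto
    then show ?thesis by simp
  qed
  have "(\<integral>\<^sup>+x. G x * indicator {x. \<forall>u\<in>insert b F. x a \<le> x u} x \<partial>unif_field)
      = (\<integral>\<^sup>+x. (G x * indicator {x. \<forall>u\<in>F. x a \<le> x u} x) * indicator {p. fst p \<le> snd p} (x a, x b) \<partial>unif_field)"
    by (intro nn_integral_cong) (auto simp: indicator_def)
  also have "\<dots> = (\<integral>\<^sup>+x. (G x * indicator {x. \<forall>u\<in>F. x a \<le> x u} x)
       * (\<integral>\<^sup>+y. indicator {p. fst p \<le> snd p} (x a, y) \<partial>unif) \<partial>unif_field)"
  proof (rule nn_integral_resample_point[where g="\<lambda>s y. indicator {p. fst p \<le> snd p} (s, y)"])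
    show "(\<lambda>x. G x * indicator {x. \<forall>u\<in>F. x a \<le> x u} x) \<in> borel_measurable unif_field" by measurable
    show "(\<lambda>(s, y). indicator {p :: real \<times> real. fst p \<le> snd p} (s, y) :: ennreal)
        \<in> borel_measurable (borel \<Otimes>\<^sub>M borel)" by measurable
    show "a \<noteq> b" using insert.prems(1) by auto
    fix x y
    have "G (x(b := y)) = G x" by (rule insert.prems(3)) simp
    moreover have "x(b := y) \<in> {x. \<forall>u\<in>F. x a \<le> x u} \<longleftrightarrow> x \<in> {x. \<forall>u\<in>F. x a \<le> x u}"
      using insert.prems(1) insert.hyps(2) by auto
    ultimately show "G (x(b := y)) * indicator {x. \<forall>u\<in>F. x a \<le> x u} (x(b := y))
      = G x * indicator {x. \<forall>u\<in>F. x a \<le> x u} x" by (simp add: indicator_def)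
  qed
  also have "\<dots> = (\<integral>\<^sup>+x. (G x * emeasure unif {x a..}) * indicator {x. \<forall>u\<in>F. x a \<le> x u} x \<partial>unif_field)"
  proof (intro nn_integral_cong)
    fix x :: "'a \<Rightarrow> real"
    have "(\<integral>\<^sup>+y. indicator {p. fst p \<le> snd p} (x a, y) \<partial>unif) = (\<integral>\<^sup>+y. indicator {x a..} y \<partial>unif)"
      by (intro nn_integral_cong) (auto simp: indicator_def)
    then show "G x * indicator {x. \<forall>u\<in>F. x a \<le> x u} x * (\<integral>\<^sup>+y. indicator {p. fst p \<le> snd p} (x a, y) \<partial>unif)
      = G x * emeasure unif {x a..} * indicator {x. \<forall>u\<in>F. x a \<le> x u} x"
      by (simp add: mult_ac)
  qed
  also have "\<dots> = (\<integral>\<^sup>+x. (G x * emeasure unif {x a..}) * emeasure unif {x a..} ^ card F \<partial>unif_field)"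
  proof (rule insert.IH)
    show "(\<lambda>x. G x * emeasure unif {x a..}) \<in> borel_measurable unif_field" by measurable
    show "G (x(u := y)) * emeasure unif {(x(u := y)) a..} = G x * emeasure unif {x a..}"
      if "u \<in> F" for u x y
    proof -
      have "G (x(u := y)) = G x" by (rule insert.prems(3)) (use that in simp)
      then show ?thesis using insert.prems(1) that by auto
    qed
  qed (use insert.prems(1) in auto)
  finally show ?case using insert.hyps by (simp add: mult_ac)
qed

section \<open>Candidate ancestral paths\<close>

context tree_metric begin

text \<open>
  A candidate path is a list that starts with its current vertex a. Moving on to b, it examines
  all vertices closer to a than b. Those that are examined for the first time include all that lie
  beyond a as seen from the previous vertex of the path; for the first step there is no previous
  vertex.
\<close>

fun fresh :: "'v list \<Rightarrow> 'v \<Rightarrow> 'v set" where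
  "fresh [] b = {}"
| "fresh (a # r) b = {u. u \<noteq> a \<and> d a u < d a b \<and> (r = [] \<or> btw (hd r) a u)}"

fun explored :: "'v list \<Rightarrow> 'v set" where
  "explored [] = {}"
| "explored [a] = {a}"
| "explored (b # a # r) = insert b (explored (a # r) \<union> fresh (a # r) b)"

text \<open>
  Every step examines new vertices. This holds for all paths that occur as ancestral paths (see
  lineage_invariant) and makes the steps independent.
\<close>

fun admissible :: "'v list \<Rightarrow> bool" where
  "admissible [] = False"
| "admissible [a] = True"
| "admissible (b # a # r) \<longleftrightarrow>
     admissible (a # r) \<and> b \<notin> explored (a # r) \<and> fresh (a # r) b \<inter> explored (a # r) = {}"

text \<open>
  A necessary condition on the marks for the list to be an ancestral path. The comparisons are not
  strict, because different arrival times may have equal marks.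
\<close>

fun descent :: "'v list \<Rightarrow> ('v \<Rightarrow> real) \<Rightarrow> bool" where
  "descent [] x = False"
| "descent [a] x = True"
| "descent (b # a # r) x \<longleftrightarrow>
     descent (a # r) x \<and> x b \<le> x a \<and> (\<forall>u\<in>fresh (a # r) b. x a \<le> x u)"

lemma hd_in_explored: "h \<noteq> [] \<Longrightarrow> hd h \<in> explored h"
  by (cases h rule: explored.cases) auto

lemma finite_dist_less_conj [simp]: "finite {u. u \<noteq> a \<and> d a u < r \<and> Q u}"
  by (rule finite_subset[OF _ finite_dist_less[of a r]]) auto

lemma finite_fresh [simp]: "finite (fresh h b)"
  by (cases h) simp_all

lemma descent_cong:
  "(\<And>u. u \<in> explored h \<Longrightarrow> x u = y u) \<Longrightarrow> descent h x = descent h y"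
proof (induction h rule: explored.induct)
  case (3 b a r)
  have "a \<in> explored (a # r)" using hd_in_explored[of "a # r"] by simp
  then show ?case using 3 by auto
qed auto

lemma measurable_descent [measurable]: "{x. descent h x} \<in> sets (unif_field :: ('v \<Rightarrow> real) measure)"
proof -
  have "Measurable.pred (unif_field :: ('v \<Rightarrow> real) measure) (descent h)"
  proof (induction h rule: explored.induct)
    case 1
    have "descent [] = (\<lambda>_. False)" by (simp add: fun_eq_iff)
    then show ?case by simp
  next
    case (2 a)
    have "descent [a] = (\<lambda>_. True)" by (simp add: fun_eq_iff)
    then show ?case by simp
  next
    case (3 b a r)
    have le: "Measurable.pred unif_field (\<lambda>x. x v \<le> (x w :: real))" for v w :: 'v
    proof -
      have "{x \<in> space unif_field. x v \<le> (x w :: real)} \<in> sets unif_field" by measurable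
      then show ?thesis by (simp add: pred_def)
    qed
    have "Measurable.pred unif_field (\<lambda>x. \<forall>u\<in>fresh (a # r) b. x a \<le> (x u :: real))"
      using le by (intro pred_intros_finite finite_fresh) auto
    then show ?case using 3 le by (simp only: descent.simps) (intro pred_intros_logic)
  qed
  then show ?thesis by (simp add: pred_def)
qed

lemma admissible_hd_neq: "admissible (a # c # r) \<Longrightarrow> c \<noteq> a"
  using hd_in_explored[of "c # r"] by auto

text \<open>
  The vertices at distance d a b - 1 from a in the K branches that do not lead back are fresh; if
  this distance is 0, the only such vertex is a itself, which explains the summand 1.
\<close>

lemma card_fresh_ge:
  assumes "admissible (a # r)" "a \<noteq> b"
  shows "K ^ (d a b - 1) \<le> card (fresh (a # r) b) + 1"
proof -
  obtain c where c: "c \<noteq> a" "r \<noteq> [] \<Longrightarrow> c = hd r"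
  proof (cases r)
    case Nil
    obtain c where "c \<in> nbrs a" using card_nbrs'[of a] by (metis card.empty equals0I nat.distinct(1))
    then have "c \<noteq> a" by (auto simp: nbrs_def)
    then show ?thesis using that Nil by auto
  next
    case (Cons c r')
    then show ?thesis using that assms admissible_hd_neq by auto
  qed
  have "d a b > 0" using assms by (simp add: neq0_conv[symmetric] del: neq0_conv)
  then have "{u. d a u = d a b - 1 \<and> btw c a u} \<subseteq> insert a (fresh (a # r) b)" using c by auto
  then have "card {u. d a u = d a b - 1 \<and> btw c a u} \<le> card (insert a (fresh (a # r) b))"
    by (intro card_mono) auto
  also have "\<dots> \<le> card (fresh (a # r) b) + 1" by (simp add: card_insert_if)
  finally show ?thesis using card_forward_sphere[OF c(1)] by simp
qed

text \<open>
  The expectation of \<phi>, applied to the mark of the current vertex, on the event that the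
  marks admit the candidate path.
\<close>

definition weight :: "'v list \<Rightarrow> (real \<Rightarrow> ennreal) \<Rightarrow> ennreal" where
  "weight h \<phi> = (\<integral>\<^sup>+x. indicator {x. admissible h \<and> descent h x} x * \<phi> (x (hd h)) \<partial>unif_field)"

lemma measurable_adm_descent [measurable]: "{x. admissible h \<and> descent h x} \<in> sets (unif_field :: ('v \<Rightarrow> real) measure)"
  by (cases "admissible h") (use measurable_descent[of h] in auto)

lemma weight_mono:
  assumes "\<And>s. 0 < s \<Longrightarrow> s \<le> 1 \<Longrightarrow> admissible h \<Longrightarrow> \<phi> s \<le> \<psi> s"
  shows "weight h \<phi> \<le> weight h \<psi>"
  unfolding weight_def
proof (rule nn_integral_mono_AE, rule eventually_mono[OF AE_field_unit[of "hd h"]])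
  fix x :: "'v \<Rightarrow> real"
  assume x: "x (hd h) \<in> {0<..1}"
  show "indicator {x. admissible h \<and> descent h x} x * \<phi> (x (hd h))
      \<le> indicator {x. admissible h \<and> descent h x} x * \<psi> (x (hd h))"
  proof (cases "admissible h")
    case True
    then have "\<phi> (x (hd h)) \<le> \<psi> (x (hd h))" using assms x by auto
    then show ?thesis by (rule mult_left_mono) simp
  qed simp
qed

lemma weight_not_admissible: "\<not> admissible h \<Longrightarrow> weight h \<phi> = 0"
  by (simp add: weight_def)

lemma weight_cmult:
  assumes "\<phi> \<in> borel_measurable borel"
  shows "weight h (\<lambda>s. c * \<phi> s) = c * weight h \<phi>"
proof -
  note assms [measurable]
  have "weight h (\<lambda>s. c * \<phi> s)
      = (\<integral>\<^sup>+x. c * (indicator {x. admissible h \<and> descent h x} x * \<phi> (x (hd h))) \<partial>unif_field)"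
    unfolding weight_def by (intro nn_integral_cong) (rule mult.left_commute)
  also have "\<dots> = c * weight h \<phi>"
    unfolding weight_def by (intro nn_integral_cmult) measurable
  finally show ?thesis .
qed

lemma weight_sum:
  assumes [measurable]: "\<And>b. \<phi> b \<in> borel_measurable borel"
  shows "(\<integral>\<^sup>+(b::'v). weight h (\<phi> b) \<partial>count_space UNIV) = weight h (\<lambda>s. \<integral>\<^sup>+b. \<phi> b s \<partial>count_space UNIV)"
proof -
  have "(\<integral>\<^sup>+b. weight h (\<phi> b) \<partial>count_space UNIV) =
      (\<integral>\<^sup>+x. \<integral>\<^sup>+b. indicator {x. admissible h \<and> descent h x} x * \<phi> b (x (hd h)) \<partial>count_space UNIV \<partial>unif_field)"
    unfolding weight_def using countable_UNIV
    by (intro nn_integral_count_space_nn_integral[symmetric]) measurable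
  also have "\<dots> = weight h (\<lambda>s. \<integral>\<^sup>+b. \<phi> b s \<partial>count_space UNIV)"
    unfolding weight_def by (intro nn_integral_cong nn_integral_cmult) simp
  finally show ?thesis .
qed

lemma weight_singleton:
  assumes [measurable]: "\<phi> \<in> borel_measurable borel"
  shows "weight [a] \<phi> = (\<integral>\<^sup>+y. \<phi> y \<partial>unif)"
proof -
  interpret prob_space "unif_field :: ('v \<Rightarrow> real) measure" by (rule prob_space_field)
  have "weight [a] \<phi> = (\<integral>\<^sup>+(x::'v \<Rightarrow> real). \<phi> (x a) \<partial>unif_field)" by (simp add: weight_def)
  also have "\<dots> = (\<integral>\<^sup>+(x::'v \<Rightarrow> real). \<integral>\<^sup>+y. \<phi> y \<partial>unif \<partial>unif_field)"
    by (subst nn_integral_resample[of _ a]) auto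
  also have "\<dots> = (\<integral>\<^sup>+y. \<phi> y \<partial>unif)" using emeasure_space_1 by (simp flip: space_field)
  finally show ?thesis .
qed

lemma descent_upd: "u \<notin> explored h \<Longrightarrow> descent h (x(u := y)) = descent h x"
  by (intro descent_cong) auto

lemma weight_block:
  assumes F: "finite F" "F \<inter> explored h = {}" and h: "h \<noteq> []"
    and [measurable]: "\<phi> \<in> borel_measurable borel"
  shows "(\<integral>\<^sup>+x. indicator {x. admissible h \<and> descent h x} x * \<phi> (x (hd h))
      * indicator {x. \<forall>u\<in>F. x (hd h) \<le> x u} x \<partial>unif_field)
    = weight h (\<lambda>s. emeasure unif {s..} ^ card F * \<phi> s)"
proof -
  have hd: "hd h \<notin> F" using hd_in_explored[OF h] F by auto
  have "(\<integral>\<^sup>+x. (indicator {x. admissible h \<and> descent h x} x * \<phi> (x (hd h)))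
      * indicator {x. \<forall>u\<in>F. x (hd h) \<le> x u} x \<partial>unif_field)
    = (\<integral>\<^sup>+x. (indicator {x. admissible h \<and> descent h x} x * \<phi> (x (hd h)))
      * emeasure unif {x (hd h)..} ^ card F \<partial>unif_field)"
  proof (rule nn_integral_resample_block[OF F(1) hd])
    show "indicator {x. admissible h \<and> descent h x} (x(u := y)) * \<phi> ((x(u := y)) (hd h))
      = indicator {x. admissible h \<and> descent h x} x * \<phi> (x (hd h))" if "u \<in> F" for u x y
    proof -
      have "u \<notin> explored h" "u \<noteq> hd h" using that F hd by auto
      then show ?thesis using descent_upd[of u h x y] by (simp add: indicator_def)
    qed
  qed measurable
  then show ?thesis unfolding weight_def by (simp add: mult_ac)
qed

text \<open>
  The mark of b and the marks of the fresh vertices enter only through their comparison with the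
  mark s of a. Integrating them out leaves the integral of \<phi> below s and, for each fresh
  vertex, the probability that its mark is at least s.
\<close>

lemma weight_peel:
  assumes [measurable]: "\<phi> \<in> borel_measurable borel"
  shows "weight (b # a # r) \<phi> \<le>
    weight (a # r) (\<lambda>s. emeasure unif {s..} ^ card (fresh (a # r) b) * below \<phi> s)"
proof (cases "admissible (b # a # r)")
  case False
  then show ?thesis by (simp add: weight_not_admissible)
next
  case True
  let ?h = "a # r" and ?F = "fresh (a # r) b"
  have b: "b \<notin> explored ?h" "b \<notin> ?F" "b \<noteq> a"
    using True hd_in_explored[of "a # r"] by auto
  have F: "?F \<inter> explored ?h = {}" using True by auto
  have set [measurable]: "{x. \<forall>u\<in>?F. x a \<le> x u} \<in> sets (unif_field :: ('v \<Rightarrow> real) measure)"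
  proof -
    have le: "{x \<in> space unif_field. x a \<le> (x u :: real)} \<in> sets unif_field" for u :: 'v by measurable
    have "{x \<in> space unif_field. \<forall>u\<in>?F. x a \<le> (x u :: real)} \<in> sets unif_field"
      using le by (intro sets.sets_Collect_finite_All) auto
    then show ?thesis by simp
  qed
  let ?G = "\<lambda>x. indicator {x. admissible ?h \<and> descent ?h x} x * indicator {x. \<forall>u\<in>?F. x a \<le> x u} x :: ennreal"
  have "weight (b # ?h) \<phi> = (\<integral>\<^sup>+x. ?G x * (\<phi> (x b) * indicator {p. snd p \<le> fst p} (x a, x b)) \<partial>unif_field)"
    unfolding weight_def using True by (intro nn_integral_cong) (auto simp: indicator_def)
  also have "\<dots> = (\<integral>\<^sup>+x. ?G x * (\<integral>\<^sup>+y. \<phi> y * indicator {p. snd p \<le> fst p} (x a, y) \<partial>unif) \<partial>unif_field)"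
  proof (rule nn_integral_resample_point[where g="\<lambda>s y. \<phi> y * indicator {p. snd p \<le> fst p} (s, y)"])
    show "?G \<in> borel_measurable unif_field" by measurable
    show "(\<lambda>(s, y). \<phi> y * indicator {p :: real \<times> real. snd p \<le> fst p} (s, y))
        \<in> borel_measurable (borel \<Otimes>\<^sub>M borel)" by measurable
    fix x :: "'v \<Rightarrow> real" and y :: real
    have "(\<forall>u\<in>?F. (x(b := y)) a \<le> (x(b := y)) u) = (\<forall>u\<in>?F. x a \<le> x u)" using b by auto
    then show "?G (x(b := y)) = ?G x" using descent_upd[OF b(1), of x y] by (simp add: indicator_def)
  qed (use b in auto)
  also have "\<dots> = (\<integral>\<^sup>+x. indicator {x. admissible ?h \<and> descent ?h x} x * below \<phi> (x (hd ?h))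
      * indicator {x. \<forall>u\<in>?F. x (hd ?h) \<le> x u} x \<partial>unif_field)"
  proof (intro nn_integral_cong)
    fix x :: "'v \<Rightarrow> real"
    have "(\<integral>\<^sup>+y. \<phi> y * indicator {p. snd p \<le> fst p} (x a, y) \<partial>unif) = below \<phi> (x a)"
      unfolding below_def by (intro nn_integral_cong) (auto simp: indicator_def)
    then show "?G x * (\<integral>\<^sup>+y. \<phi> y * indicator {p. snd p \<le> fst p} (x a, y) \<partial>unif) =
      indicator {x. admissible ?h \<and> descent ?h x} x * below \<phi> (x (hd ?h))
      * indicator {x. \<forall>u\<in>?F. x (hd ?h) \<le> x u} x" by (simp add: mult_ac)
  qed
  also have "\<dots> = weight ?h (\<lambda>s. emeasure unif {s..} ^ card ?F * below \<phi> s)"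
    using F by (intro weight_block) auto
  finally show ?thesis by simp
qed

text \<open>
  The sum over all lists of length n, with a recursion that splits off the last step of a
  candidate path.
\<close>

primrec list_sum :: "nat \<Rightarrow> ('v list \<Rightarrow> ennreal) \<Rightarrow> ennreal" where
  "list_sum 0 f = f []"
| "list_sum (Suc n) f = (\<integral>\<^sup>+b. list_sum n (\<lambda>h. f (b # h)) \<partial>count_space UNIV)"

lemma list_sum_mono:
  "(\<And>h. length h = n \<Longrightarrow> f h \<le> g h) \<Longrightarrow> list_sum n f \<le> list_sum n g"
proof (induction n arbitrary: f g)
  case (Suc n)
  have "list_sum n (\<lambda>h. f (b # h)) \<le> list_sum n (\<lambda>h. g (b # h))" for b
    by (rule Suc.IH) (rule Suc.prems, simp)
  then show ?case by (simp add: nn_integral_mono)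
qed simp

lemma list_sum_cong:
  "(\<And>h. length h = n \<Longrightarrow> f h = g h) \<Longrightarrow> list_sum n f = list_sum n g"
  by (intro antisym list_sum_mono) auto

lemma list_sum_nn_integral_count:
  "list_sum n (\<lambda>h. \<integral>\<^sup>+(b::'v). g b h \<partial>count_space UNIV) = (\<integral>\<^sup>+b. list_sum n (g b) \<partial>count_space UNIV)"
proof (induction n arbitrary: g)
  case (Suc n)
  show ?case
    unfolding list_sum.simps Suc.IH
    by (rule nn_integral_count_space_nn_integral[OF countable_UNIV]) simp
qed simp

lemma list_sum_Suc: "list_sum (Suc n) f = list_sum n (\<lambda>h. \<integral>\<^sup>+b. f (b # h) \<partial>count_space UNIV)"
  by (simp add: list_sum_nn_integral_count)

lemma list_sum_cmult: "list_sum n (\<lambda>h. c * f h) = c * list_sum n f"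
proof (induction n arbitrary: f)
  case (Suc n)
  show ?case unfolding list_sum.simps Suc.IH by (rule nn_integral_cmult) simp
qed simp

lemma nn_integral_count_ge: "f b \<le> (\<integral>\<^sup>+b. f b \<partial>count_space UNIV)"
proof -
  have "f b = (\<integral>\<^sup>+x. f x * indicator {b} x \<partial>count_space UNIV)"
    by (subst nn_integral_indicator_singleton) auto
  also have "\<dots> \<le> (\<integral>\<^sup>+b. f b \<partial>count_space UNIV)"
    by (intro nn_integral_mono) (auto simp: indicator_def)
  finally show ?thesis .
qed

lemma list_sum_ge: "length h = n \<Longrightarrow> f h \<le> list_sum n f"
proof (induction n arbitrary: f h)
  case (Suc n)
  then obtain b h' where h: "h = b # h'" "length h' = n" by (cases h) auto
  have "f h \<le> list_sum n (\<lambda>h. f (b # h))" using Suc.IH[of h' "\<lambda>h. f (b # h)"] h by simp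
  also have "\<dots> \<le> list_sum (Suc n) f" unfolding list_sum.simps by (rule nn_integral_count_ge)
  finally show ?case .
qed simp

lemma measurable_nn_integral_count:
  assumes "\<And>b :: 'v. (\<lambda>x. f x b) \<in> borel_measurable N"
  shows "(\<lambda>x. \<integral>\<^sup>+b. f x b \<partial>count_space UNIV) \<in> borel_measurable N"
proof -
  interpret sigma_finite_measure "count_space (UNIV :: 'v set)"
    by (rule sigma_finite_measure_count_space_countable[OF countable_UNIV])
  have g: "(\<lambda>p. f (snd p) (fst p)) \<in> borel_measurable (count_space UNIV \<Otimes>\<^sub>M N)"
    using assms countable_UNIV by (intro measurable_pair_measure_countable1) simp_all
  have "case_prod f \<in> borel_measurable (N \<Otimes>\<^sub>M count_space UNIV)"
    using measurable_compose[OF measurable_pair_swap' g] by (simp add: case_prod_beta)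
  then show ?thesis by (rule borel_measurable_nn_integral)
qed

lemma measurable_list_sum [measurable (raw)]:
  "(\<And>h. (\<lambda>x. f x h) \<in> borel_measurable N) \<Longrightarrow> (\<lambda>x. list_sum n (f x)) \<in> borel_measurable N"
proof (induction n arbitrary: f)
  case (Suc n)
  have "(\<lambda>x. list_sum n (\<lambda>h. f x (b # h))) \<in> borel_measurable N" for b
    by (rule Suc.IH) (rule Suc.prems)
  then show ?case unfolding list_sum.simps by (rule measurable_nn_integral_count)
qed simp

lemma nn_integral_list_sum:
  "(\<And>h. (\<lambda>x. f x h) \<in> borel_measurable N) \<Longrightarrow>
    (\<integral>\<^sup>+x. list_sum n (f x) \<partial>N) = list_sum n (\<lambda>h. \<integral>\<^sup>+x. f x h \<partial>N)"
proof (induction n arbitrary: f)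
  case (Suc n)
  have m: "(\<lambda>x. list_sum n (\<lambda>h. f x (b # h))) \<in> borel_measurable N" for b
    by (rule measurable_list_sum) (rule Suc.prems)
  have "(\<integral>\<^sup>+x. list_sum (Suc n) (f x) \<partial>N) = (\<integral>\<^sup>+b. \<integral>\<^sup>+x. list_sum n (\<lambda>h. f x (b # h)) \<partial>N \<partial>count_space UNIV)"
    unfolding list_sum.simps using m countable_UNIV
    by (intro nn_integral_count_space_nn_integral) auto
  also have "\<dots> = (\<integral>\<^sup>+b. list_sum n (\<lambda>h. \<integral>\<^sup>+x. f x (b # h) \<partial>N) \<partial>count_space UNIV)"
    by (intro nn_integral_cong Suc.IH) (rule Suc.prems)
  finally show ?case by simp
qed simp

end

section \<open>Descendants with late marks\<close>

text \<open>
  Bernoulli's inequality bounds (1 + s)^m from below, and (1 - s)^m (1 + s)^m is at most 1.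
\<close>

lemma one_minus_power_le_inverse:
  fixes s :: real
  assumes "0 < s" "s \<le> 1" "0 < N" "N \<le> real m + 1"
  shows "(1 - s) ^ m \<le> 1 / (s * N)"
proof -
  have "s * N \<le> s * (real m + 1)" using assms by (intro mult_left_mono) auto
  also have "\<dots> \<le> 1 + real m * s" using assms by (simp add: algebra_simps)
  also have "\<dots> \<le> (1 + s) ^ m" using assms by (intro Bernoulli_inequality) auto
  finally have "s * N * (1 - s) ^ m \<le> (1 + s) ^ m * (1 - s) ^ m"
    using assms by (intro mult_right_mono) auto
  also have "\<dots> = (1 - s\<^sup>2) ^ m"
    by (simp add: power_mult_distrib[symmetric] algebra_simps power2_eq_square)
  also have "\<dots> \<le> 1" using assms by (intro power_le_one) (auto simp: power_le_one)
  finally show ?thesis using assms by (simp add: field_simps)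
qed

text \<open>
  Interpolation between the bounds 1 and 1 / (s N).
\<close>

lemma one_minus_power_le_powr:
  fixes s :: real
  assumes "0 < s" "s \<le> 1" "0 < N" "N \<le> real m + 1" "0 \<le> \<beta>" "\<beta> \<le> 1"
  shows "(1 - s) ^ m \<le> (s * N) powr - \<beta>"
proof (cases "1 \<le> s * N")
  case True
  have "(1 - s) ^ m \<le> (s * N) powr - 1"
    using one_minus_power_le_inverse[OF assms(1-4)] assms by (simp add: powr_minus_divide)
  also have "\<dots> \<le> (s * N) powr - \<beta>" using True assms by (intro powr_mono) auto
  finally show ?thesis .
next
  case False
  have "(1 - s) ^ m \<le> 1" using assms by (intro power_le_one) auto
  also have "1 = 1 powr - \<beta>" by simp
  also have "\<dots> \<le> (s * N) powr - \<beta>" using False assms by (intro powr_mono2') auto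
  finally show ?thesis .
qed

text \<open>
  As (1 + s/2)^2 (1 - s) is at most 1, Bernoulli's inequality can be used twice.
\<close>

lemma one_minus_power_le_square:
  fixes s :: real
  assumes "0 < s" "s \<le> 1" "0 < N" "N \<le> real m + 1"
  shows "(1 - s) ^ m \<le> 4 / (s * N)\<^sup>2"
proof -
  have "s / 2 * N \<le> s / 2 * (real m + 1)" using assms by (intro mult_left_mono) auto
  also have "\<dots> \<le> 1 + real m * (s / 2)" using assms by (simp add: algebra_simps)
  also have "\<dots> \<le> (1 + s / 2) ^ m" using assms by (intro Bernoulli_inequality) auto
  finally have "(s / 2 * N)\<^sup>2 \<le> ((1 + s / 2) ^ m)\<^sup>2"
    using assms by (intro power_mono) auto
  then have "(s / 2 * N)\<^sup>2 * (1 - s) ^ m \<le> ((1 + s / 2) ^ m)\<^sup>2 * (1 - s) ^ m"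
    using assms by (intro mult_right_mono) auto
  also have "\<dots> = ((1 + s / 2)\<^sup>2 * (1 - s)) ^ m"
    by (simp add: power_mult_distrib power_mult[symmetric] mult.commute)
  also have "\<dots> \<le> 1"
  proof (intro power_le_one)
    have "(1 + s / 2)\<^sup>2 * (1 - s) = 1 - 3 / 4 * s\<^sup>2 - s ^ 3 / 4"
      by (simp add: power2_eq_square power3_eq_cube field_simps)
    also have "\<dots> \<le> 1" using assms zero_le_power2[of s] zero_le_power[of s 3] by linarith
    finally show "(1 + s / 2)\<^sup>2 * (1 - s) \<le> 1" .
  qed (use assms in auto)
  finally show ?thesis using assms by (simp add: power_mult_distrib field_simps)
qed

lemma below_powr:
  assumes "0 \<le> s" "s \<le> 1" "- 1 < e"
  shows "below (\<lambda>y. ennreal (y powr e)) s = ennreal (s powr (e + 1) / (e + 1))"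
proof -
  have "below (\<lambda>y. ennreal (y powr e)) s = (\<integral>\<^sup>+y. ennreal (y powr e) * indicator {0..s} y \<partial>lborel)"
    unfolding below_def using assms
    by (subst nn_integral_unif) (auto intro!: nn_integral_cong simp: indicator_def)
  also have "\<dots> = ennreal (s powr (e + 1) / (e + 1))"
    using assms by (intro nn_integral_has_integral_lebesgue' has_integral_powr_from_0) auto
  finally show ?thesis .
qed

lemma below_cmult:
  assumes [measurable]: "\<phi> \<in> borel_measurable borel"
  shows "below (\<lambda>y. c * \<phi> y) s = c * below \<phi> s"
proof -
  have "below (\<lambda>y. c * \<phi> y) s = (\<integral>\<^sup>+y. c * (\<phi> y * indicator {..s} y) \<partial>unif)"
    unfolding below_def by (intro nn_integral_cong) (rule mult.assoc)
  also have "\<dots> = c * below \<phi> s"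
  proof -
    have "(\<lambda>y. \<phi> y * indicator {..s} y) \<in> borel_measurable borel" by measurable
    then show ?thesis unfolding below_def
      by (intro nn_integral_cmult) (simp cong: measurable_cong_sets)
  qed
  finally show ?thesis .
qed

lemma below_mono: "(\<And>y. y \<le> s \<Longrightarrow> \<phi> y \<le> \<psi> y) \<Longrightarrow> below \<phi> s \<le> below \<psi> s"
  unfolding below_def by (intro nn_integral_mono) (auto simp: indicator_def)

context tree_metric begin

lemma nn_integral_by_spheres:
  "(\<integral>\<^sup>+b. f b \<partial>count_space UNIV) = (\<Sum>q. \<Sum>b\<in>sphere w q. f b)"
proof -
  have "(\<integral>\<^sup>+b. f b \<partial>count_space UNIV)
      = (\<integral>\<^sup>+b. (\<Sum>q. f b * indicator (sphere w q) b) \<partial>count_space UNIV)"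
  proof (intro nn_integral_cong)
    fix b
    have "(\<Sum>q. f b * indicator (sphere w q) b) = (\<Sum>q\<in>{d w b}. f b * indicator (sphere w q) b)"
      by (intro suminf_finite) (auto simp: sphere_def)
    then show "f b = (\<Sum>q. f b * indicator (sphere w q) b)" by (simp add: sphere_def)
  qed
  also have "\<dots> = (\<Sum>q. \<integral>\<^sup>+b. f b * indicator (sphere w q) b \<partial>count_space UNIV)"
    by (intro nn_integral_suminf) simp
  also have "\<dots> = (\<Sum>q. \<Sum>b\<in>sphere w q. f b)"
    by (simp add: nn_integral_count_space_indicator[symmetric] nn_integral_count_space_finite)
  finally show ?thesis .
qed

text \<open>
  A bound for the cost (1 - s)^(K^(q-1) - 1) of a jump of length q from a vertex with mark s > t.
\<close>

definition far_weight :: "real \<Rightarrow> nat \<Rightarrow> real" where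
  "far_weight t q = (if q = 0 then 0 else 4 / (t * real K ^ (q - 1))\<^sup>2)"

text \<open>
  There are about K^q vertices at distance q, and the weight decays like K^(-2q).
\<close>

lemma sum_far_weight_finite:
  assumes t: "0 < t"
  shows "\<exists>A\<ge>0. \<forall>v. (\<integral>\<^sup>+a. ennreal (far_weight t (d a v)) \<partial>count_space UNIV) \<le> ennreal A"
proof (intro exI conjI allI)
  define g where "g q = (if q = 0 then 0 else 4 * (real K + 1) / t\<^sup>2 * (1 / real K) ^ (q - 1))" for q
  have Kr: "real K \<ge> 2" using K_ge2 by simp
  have "summable (\<lambda>q. g (Suc q))"
    unfolding g_def using Kr by (simp add: summable_geometric summable_mult power_one_over[symmetric])
  then have sm: "summable g" by (simp add: summable_Suc_iff)
  have nn: "0 \<le> g q" for q using t by (simp add: g_def)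
  show "0 \<le> suminf g" using nn sm by (intro suminf_nonneg) auto
  fix v
  have "(\<integral>\<^sup>+a. ennreal (far_weight t (d a v)) \<partial>count_space UNIV)
      = (\<Sum>q. \<Sum>a\<in>sphere v q. ennreal (far_weight t q))"
    unfolding nn_integral_by_spheres[where w=v]
    by (intro suminf_cong sum.cong) (auto simp: sphere_def dist_sym)
  also have "\<dots> = (\<Sum>q. ennreal (g q))"
  proof (intro suminf_cong)
    fix q show "(\<Sum>a\<in>sphere v q. ennreal (far_weight t q)) = ennreal (g q)"
    proof (cases q)
      case (Suc k)
      have "(\<Sum>a\<in>sphere v q. ennreal (far_weight t q)) = ennreal (real (card (sphere v q)) * far_weight t q)"
        by (simp add: far_weight_def ennreal_mult'' ennreal_of_nat_eq_real_of_nat)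
      also have "real (card (sphere v q)) * far_weight t q = g q"
        unfolding Suc card_sphere_Suc using Kr t
        by (simp add: far_weight_def g_def power2_eq_square field_simps)
      finally show ?thesis .
    qed (simp add: far_weight_def g_def)
  qed
  also have "\<dots> = ennreal (suminf g)" using nn sm by (intro suminf_ennreal2)
  finally show "(\<integral>\<^sup>+a. ennreal (far_weight t (d a v)) \<partial>count_space UNIV) \<le> ennreal (suminf g)" by simp
qed

text \<open>
  Integrating the indicator of t < s along k decreasing marks produces the factor s^k / k!.
\<close>

definition late :: "real \<Rightarrow> nat \<Rightarrow> real \<Rightarrow> ennreal" where
  "late t k s = ennreal (1 / fact k) * ennreal (s powr real k) * indicator {t<..} s"

lemma measurable_late [measurable]: "late t k \<in> borel_measurable borel"
  unfolding late_def by measurable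

lemma below_late:
  assumes "0 < s" "s \<le> 1"
  shows "below (late t k) s \<le> late t (Suc k) s"
proof (cases "t < s")
  case True
  have "below (late t k) s \<le> below (\<lambda>y. ennreal (1 / fact k) * ennreal (y powr real k)) s"
    by (intro below_mono) (auto simp: late_def indicator_def)
  also have "\<dots> = ennreal (1 / fact k) * ennreal (s powr (real k + 1) / (real k + 1))"
    using assms by (subst below_cmult) (auto simp: below_powr)
  also have "\<dots> = late t (Suc k) s"
    using True by (simp add: late_def ennreal_mult[symmetric] field_simps)
  finally show ?thesis .
next
  case False
  have "below (late t k) s \<le> below (\<lambda>_. 0) s"
    using False by (intro below_mono) (auto simp: late_def)
  then show ?thesis by (simp add: below_def)
qed

text \<open>
  The last vertex v of the path is fixed and the others are summed over: each of the n steps costs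
  a factor A, and the marks decrease along the path, which accounts for the factorial.
\<close>

lemma weight_late_le:
  assumes t: "0 < t"
    and A: "0 \<le> A" "\<And>v. (\<integral>\<^sup>+a. ennreal (far_weight t (d a v)) \<partial>count_space UNIV) \<le> ennreal A"
  shows "list_sum (Suc n) (\<lambda>h. indicator {h. hd h = v} h * weight h (late t k)) \<le> ennreal (A ^ n / fact (n + k))"
proof (induction n arbitrary: v k)
  case 0
  have "list_sum (Suc 0) (\<lambda>h. indicator {h. hd h = v} h * weight h (late t k))
      = (\<integral>\<^sup>+b. weight [b] (late t k) * indicator {v} b \<partial>count_space UNIV)"
    by (auto intro!: nn_integral_cong simp: indicator_def)
  also have "\<dots> = weight [v] (late t k)" by (subst nn_integral_indicator_singleton) auto
  also have "\<dots> \<le> weight [v] (\<lambda>s. ennreal (1 / fact k))"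
  proof (intro weight_mono)
    fix s :: real assume s: "0 < s" "s \<le> 1"
    then have "s powr real k \<le> 1" by (simp add: powr_realpow power_le_one)
    then show "late t k s \<le> ennreal (1 / fact k)"
      unfolding late_def by (simp add: indicator_def ennreal_mult[symmetric] divide_right_mono ennreal_leI)
  qed
  also have "\<dots> = ennreal (1 / fact k)"
    by (simp add: weight_singleton prob_space.emeasure_space_1[OF prob_space_unif] flip: space_unif)
  finally show ?case by simp
next
  case (Suc n)
  have step: "weight (v # h) (late t k)
      \<le> ennreal (far_weight t (d (hd h) v)) * weight h (late t (Suc k))"
    if h: "length h = Suc n" for h
  proof -
    obtain a r where ar: "h = a # r" using h by (cases h) auto
    show ?thesis
    proof (cases "admissible (v # h)")
      case True
      then have adm: "admissible h" "a \<noteq> v" using ar hd_in_explored[of "a # r"] by auto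
      have "weight (v # h) (late t k)
        \<le> weight h (\<lambda>s. emeasure unif {s..} ^ card (fresh h v) * below (late t k) s)"
        unfolding ar by (rule weight_peel) measurable
      also have "\<dots> \<le> weight h (\<lambda>s. ennreal (far_weight t (d a v)) * late t (Suc k) s)"
      proof (intro weight_mono)
        fix s :: real assume s: "0 < s" "s \<le> 1"
        show "emeasure unif {s..} ^ card (fresh h v) * below (late t k) s
          \<le> ennreal (far_weight t (d a v)) * late t (Suc k) s"
        proof (cases "t < s")
          case True
          have "real (K ^ (d a v - 1)) \<le> real (card (fresh h v) + 1)"
            using card_fresh_ge[of a r v] adm ar by (intro of_nat_mono) auto
          then have "(1 - s) ^ card (fresh h v) \<le> 4 / (s * real K ^ (d a v - 1))\<^sup>2"
            using s K_ge2 by (intro one_minus_power_le_square) auto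
          also have "\<dots> \<le> 4 / (t * real K ^ (d a v - 1))\<^sup>2"
            using t True K_ge2 by (intro divide_left_mono power_mono mult_right_mono) auto
          also have "\<dots> = far_weight t (d a v)" using adm by (simp add: far_weight_def)
          finally have "emeasure unif {s..} ^ card (fresh h v) \<le> ennreal (far_weight t (d a v))"
            using s by (simp add: emeasure_unif_atLeast ennreal_power ennreal_leI)
          then show ?thesis using below_late[OF s] by (intro mult_mono) auto
        next
          case False
          then have "late t (Suc k) s = 0" by (simp add: late_def)
          then show ?thesis using below_late[OF s, of t k] by simp
        qed
      qed
      also have "\<dots> = ennreal (far_weight t (d a v)) * weight h (late t (Suc k))"
        by (rule weight_cmult) measurable
      finally show ?thesis by (simp add: ar)
    qed (simp add: weight_not_admissible)
  qed
  have "list_sum (Suc (Suc n)) (\<lambda>h. indicator {h. hd h = v} h * weight h (late t k))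
      = (\<integral>\<^sup>+b. list_sum (Suc n) (\<lambda>h. weight (v # h) (late t k)) * indicator {v} b \<partial>count_space UNIV)"
    unfolding list_sum.simps(2)[of "Suc n"]
  proof (intro nn_integral_cong)
    fix b
    show "list_sum (Suc n) (\<lambda>h. indicator {h. hd h = v} (b # h) * weight (b # h) (late t k))
      = list_sum (Suc n) (\<lambda>h. weight (v # h) (late t k)) * indicator {v} b"
    proof (cases "b = v")
      case False
      have "list_sum (Suc n) (\<lambda>h. 0 * weight (v # h) (late t k)) = 0" unfolding list_sum_cmult by simp
      then show ?thesis using False by (simp del: list_sum.simps)
    qed (simp del: list_sum.simps)
  qed
  also have "\<dots> = list_sum (Suc n) (\<lambda>h. weight (v # h) (late t k))"
    by (subst nn_integral_indicator_singleton) auto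
  also have "\<dots> \<le> list_sum (Suc n) (\<lambda>h. ennreal (far_weight t (d (hd h) v)) * weight h (late t (Suc k)))"
    by (intro list_sum_mono step)
  also have "\<dots> = list_sum (Suc n) (\<lambda>h. \<integral>\<^sup>+a. ennreal (far_weight t (d a v)) *
      (indicator {h. hd h = a} h * weight h (late t (Suc k))) \<partial>count_space UNIV)"
  proof (intro list_sum_cong)
    fix h :: "'v list"
    have "(\<integral>\<^sup>+a. ennreal (far_weight t (d a v)) *
        (indicator {h. hd h = a} h * weight h (late t (Suc k))) \<partial>count_space UNIV)
      = (\<integral>\<^sup>+a. (ennreal (far_weight t (d a v)) * weight h (late t (Suc k))) * indicator {hd h} a \<partial>count_space UNIV)"
      by (intro nn_integral_cong) (auto simp: indicator_def)
    also have "\<dots> = ennreal (far_weight t (d (hd h) v)) * weight h (late t (Suc k))"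
      by (subst nn_integral_indicator_singleton) auto
    finally show "ennreal (far_weight t (d (hd h) v)) * weight h (late t (Suc k)) =
      (\<integral>\<^sup>+a. ennreal (far_weight t (d a v)) *
        (indicator {h. hd h = a} h * weight h (late t (Suc k))) \<partial>count_space UNIV)" by simp
  qed
  also have "\<dots> = (\<integral>\<^sup>+a. ennreal (far_weight t (d a v)) *
      list_sum (Suc n) (\<lambda>h. indicator {h. hd h = a} h * weight h (late t (Suc k))) \<partial>count_space UNIV)"
    unfolding list_sum_nn_integral_count list_sum_cmult ..
  also have "\<dots> \<le> (\<integral>\<^sup>+a. ennreal (far_weight t (d a v)) * ennreal (A ^ n / fact (n + Suc k)) \<partial>count_space UNIV)"
    by (intro nn_integral_mono mult_left_mono Suc.IH) simp
  also have "\<dots> = (\<integral>\<^sup>+a. ennreal (far_weight t (d a v)) \<partial>count_space UNIV) * ennreal (A ^ n / fact (n + Suc k))"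
    by (rule nn_integral_multc) simp
  also have "\<dots> \<le> ennreal A * ennreal (A ^ n / fact (n + Suc k))"
    by (intro mult_right_mono A) simp
  also have "\<dots> = ennreal (A ^ Suc n / fact (Suc n + k))"
    using A by (subst ennreal_mult[symmetric]) auto
  finally show ?case .
qed

end

section \<open>Candidate paths with long jumps\<close>

lemma ennreal_mult3:
  "0 \<le> a \<Longrightarrow> 0 \<le> b \<Longrightarrow> 0 \<le> c \<Longrightarrow> ennreal (a * (b * c)) = ennreal a * (ennreal b * ennreal c)"
  by (simp add: ennreal_mult)

context tree_metric begin

text \<open>
  The exponent 1/3 has to be less than 1/2 to give K decay^2 > 1, and its sum with the exponent
  3/4 that is used for the marks has to exceed 1, so that the sum over all jumps in
  sum_approach_le converges.
\<close>

definition decay :: real where "decay = real K powr (- 1 / 3)"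

lemma decay: "0 < decay" "decay \<le> 1" "1 < real K * decay\<^sup>2"
proof -
  have K: "real K > 1" using K_ge2 by simp
  then show "0 < decay" by (simp add: decay_def)
  have "real K powr (- 1 / 3) \<le> real K powr 0" using K by (intro powr_mono) auto
  then show "decay \<le> 1" using K by (simp add: decay_def)
  have "decay\<^sup>2 = real K powr (- 2 / 3)"
    using K by (simp add: decay_def power2_eq_square powr_add[symmetric])
  then have "real K * decay\<^sup>2 = real K powr (1 / 3)"
    using K by (simp add: powr_mult_base)
  also have "\<dots> > real K powr 0" using K by (intro powr_less_mono) auto
  finally show "1 < real K * decay\<^sup>2" using K by simp
qed

text \<open>
  The cost of a jump from a to b at mark s, multiplied with the spatial part of the potential at
  b.
\<close>

definition approach :: "real \<Rightarrow> 'v \<Rightarrow> 'v \<Rightarrow> 'v \<Rightarrow> real" where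
  "approach s x a b = (if b = a then 0 else (s * real K ^ (d a b - 1)) powr (- 3 / 4) * decay ^ d b x)"

text \<open>
  A jump of length q costs (s K^(q-1))^(-3/4), and by sum_power_dist_sphere_le its possible ends
  have total potential of order K^(2q/3), relative to the potential at a. The product decays like
  K^(-q/12).
\<close>

lemma sum_approach_le:
  "\<exists>C\<ge>0. \<forall>s x a. 0 < s \<longrightarrow>
    (\<integral>\<^sup>+b. ennreal (approach s x a b) \<partial>count_space UNIV) \<le> ennreal (C * s powr (- 3 / 4) * decay ^ d a x)"
proof -
  define C1 where "C1 = max 2 (1 / (1 - 1 / (real K * decay\<^sup>2)))"
  define \<rho> where "\<rho> = real K powr (- 1 / 12)"
  define C where "C = C1 * real K powr (3 / 4) * (1 / (1 - \<rho>))"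
  have Kr: "real K > 1" using K_ge2 by simp
  have "real K powr (- 1 / 12) < real K powr 0" using Kr by (intro powr_less_mono) auto
  then have \<rho>: "0 < \<rho>" "\<rho> < 1" using Kr by (auto simp: \<rho>_def)
  have C1: "C1 \<ge> 0" by (simp add: C1_def)
  show ?thesis
  proof (intro exI[of _ C] conjI allI impI)
    show "0 \<le> C" using C1 \<rho> by (simp add: C_def)
    fix s :: real and x a assume s: "0 < s"
    define c where "c = s powr (- 3 / 4) * decay ^ d a x * C1 * real K powr (3 / 4)"
    have c: "0 \<le> c" using C1 decay by (simp add: c_def)
    have "(\<integral>\<^sup>+b. ennreal (approach s x a b) \<partial>count_space UNIV)
        = (\<Sum>q. \<Sum>b\<in>sphere a q. ennreal (approach s x a b))"
      by (rule nn_integral_by_spheres)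
    also have "\<dots> \<le> (\<Sum>q. ennreal (c * \<rho> ^ q))"
    proof (intro suminf_le)
      fix q
      show "(\<Sum>b\<in>sphere a q. ennreal (approach s x a b)) \<le> ennreal (c * \<rho> ^ q)"
      proof (cases q)
        case 0
        then show ?thesis by (simp add: sphere_0 approach_def)
      next
        case (Suc k)
        have "(\<Sum>b\<in>sphere a q. ennreal (approach s x a b)) = ennreal (\<Sum>b\<in>sphere a q. approach s x a b)"
          using decay by (intro sum_ennreal) (auto simp: approach_def)
        also have "(\<Sum>b\<in>sphere a q. approach s x a b)
            = (s * real K ^ (q - 1)) powr (- 3 / 4) * (\<Sum>b\<in>sphere a q. decay ^ d b x)"
          unfolding sum_distrib_left
          by (intro sum.cong) (auto simp: approach_def sphere_def Suc)
        also have "\<dots> \<le> (s * real K ^ (q - 1)) powr (- 3 / 4) * (C1 * (real K * decay) ^ q * decay ^ d a x)"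
          using sum_power_dist_sphere_le[OF decay C1_def] by (intro mult_left_mono) auto
        also have "\<dots> = c * \<rho> ^ q"
        proof -
          have 1: "(s * real K ^ (q - 1)) powr (- 3 / 4)
              = s powr (- 3 / 4) * real K powr (- 3 / 4 * real (q - 1))"
            using s Kr by (simp add: powr_mult powr_realpow[symmetric] powr_powr mult.commute)
          have 2: "(real K * decay) ^ q = real K powr (2 / 3 * real q)"
          proof -
            have "real K * decay = real K powr (2 / 3)"
              using Kr by (simp add: decay_def powr_mult_base)
            then show ?thesis using Kr by (simp add: powr_powr powr_realpow[symmetric])
          qed
          have 3: "\<rho> ^ q = real K powr (- 1 / 12 * real q)"
            using Kr \<rho> by (simp add: \<rho>_def powr_powr powr_realpow[symmetric])
          have "- 3 / 4 * real (q - 1) + 2 / 3 * real q = 3 / 4 + - 1 / 12 * real q"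
          proof -
            have "real (q - 1) = real q - 1" using Suc by simp
            moreover have "- 3 / 4 * (y - 1) + 2 / 3 * y = 3 / 4 + - 1 / 12 * y" for y :: real
              by (simp add: field_simps)
            ultimately show ?thesis by simp
          qed
          then have 4: "real K powr (- 3 / 4 * real (q - 1)) * real K powr (2 / 3 * real q)
              = real K powr (3 / 4) * real K powr (- 1 / 12 * real q)"
            by (simp only: powr_add[symmetric])
          show ?thesis unfolding 1 2 3 c_def
            using arg_cong[OF 4, of "\<lambda>u. s powr (- 3 / 4) * C1 * decay ^ d a x * u"]
            by (simp only: mult_ac)
        qed
        finally show ?thesis using ennreal_leI by blast
      qed
    qed auto
    also have "\<dots> = ennreal (\<Sum>q. c * \<rho> ^ q)"
      using c \<rho> by (intro suminf_ennreal2) (auto intro!: summable_mult summable_geometric)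
    also have "(\<Sum>q. c * \<rho> ^ q) = C * s powr (- 3 / 4) * decay ^ d a x"
      using \<rho> by (subst suminf_mult) (auto simp: suminf_geometric c_def C_def intro!: summable_geometric)
    finally show "(\<integral>\<^sup>+b. ennreal (approach s x a b) \<partial>count_space UNIV)
        \<le> ennreal (C * s powr (- 3 / 4) * decay ^ d a x)" .
  qed
qed

text \<open>
  With each step of the path the index k increases by one and a factor of order 1 / (k + 1) is
  gained; this makes the sum over all lengths of paths converge.
\<close>

definition potential :: "'v \<Rightarrow> nat \<Rightarrow> 'v \<Rightarrow> real \<Rightarrow> ennreal" where
  "potential x k w s = ennreal (decay ^ d w x) * ennreal (s powr (real k / 4 - 3 / 4))"

lemma measurable_potential [measurable]: "potential x k w \<in> borel_measurable borel"
  unfolding potential_def by measurable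

lemma below_potential:
  assumes "0 < s" "s \<le> 1"
  shows "below (potential x k w) s
    = ennreal (decay ^ d w x * (s powr (real (Suc k) / 4) * (4 / real (Suc k))))"
proof -
  have e: "real k / 4 - 3 / 4 + 1 = real (Suc k) / 4" by (simp add: field_simps)
  have "below (potential x k w) s
      = ennreal (decay ^ d w x) * ennreal (s powr (real (Suc k) / 4) / (real (Suc k) / 4))"
    unfolding potential_def using assms by (subst below_cmult) (auto simp: below_powr e)
  then show ?thesis using decay by (simp add: ennreal_mult[symmetric])
qed

lemma weight_potential_step:
  assumes C: "0 \<le> C" "\<And>s x a. 0 < s \<Longrightarrow>
      (\<integral>\<^sup>+b. ennreal (approach s x a b) \<partial>count_space UNIV) \<le> ennreal (C * s powr (- 3 / 4) * decay ^ d a x)"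
    and h: "h \<noteq> []"
  shows "(\<integral>\<^sup>+b. weight (b # h) (potential x k b) \<partial>count_space UNIV)
    \<le> ennreal (4 * C / real (Suc k)) * weight h (potential x (Suc k) (hd h))"
proof -
  obtain a r where ar: "h = a # r" using h by (cases h) auto
  define c where "c s = s powr (real (Suc k) / 4) * (4 / real (Suc k))" for s :: real
  have c: "0 \<le> c s" for s by (simp add: c_def)
  have [measurable]: "c \<in> borel_measurable borel" unfolding c_def by measurable
  have [measurable]: "(\<lambda>s. approach s x a b) \<in> borel_measurable borel" for b
    unfolding approach_def by measurable
  have "weight (b # h) (potential x k b) \<le> weight h (\<lambda>s. ennreal (c s) * ennreal (approach s x a b))" for b
  proof (cases "admissible (b # h)")
    case True
    then have adm: "admissible h" "a \<noteq> b" using ar hd_in_explored[of "a # r"] by auto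
    have "weight (b # h) (potential x k b)
      \<le> weight h (\<lambda>s. emeasure unif {s..} ^ card (fresh h b) * below (potential x k b) s)"
      unfolding ar by (rule weight_peel) measurable
    also have "\<dots> \<le> weight h (\<lambda>s. ennreal (c s) * ennreal (approach s x a b))"
    proof (intro weight_mono)
      fix s :: real assume s: "0 < s" "s \<le> 1"
      have "real (K ^ (d a b - 1)) \<le> real (card (fresh h b) + 1)"
        using card_fresh_ge[of a r b] adm ar by (intro of_nat_mono) auto
      then have "(1 - s) ^ card (fresh h b) \<le> (s * real K ^ (d a b - 1)) powr (- (3 / 4))"
        using s K_ge2 by (intro one_minus_power_le_powr) auto
      then have "emeasure unif {s..} ^ card (fresh h b) \<le> ennreal ((s * real K ^ (d a b - 1)) powr (- 3 / 4))"
        using s by (simp add: emeasure_unif_atLeast ennreal_power ennreal_leI)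
      then have "emeasure unif {s..} ^ card (fresh h b) * below (potential x k b) s
        \<le> ennreal ((s * real K ^ (d a b - 1)) powr (- 3 / 4)) * ennreal (decay ^ d b x * c s)"
        using s by (intro mult_mono) (auto simp: below_potential c_def)
      also have "\<dots> = ennreal (c s) * ennreal (approach s x a b)"
        using decay c[of s] adm by (simp add: approach_def ennreal_mult[symmetric] mult_ac)
      finally show "emeasure unif {s..} ^ card (fresh h b) * below (potential x k b) s
          \<le> ennreal (c s) * ennreal (approach s x a b)" .
    qed
    finally show ?thesis .
  qed (simp add: weight_not_admissible)
  then have "(\<integral>\<^sup>+b. weight (b # h) (potential x k b) \<partial>count_space UNIV)
      \<le> (\<integral>\<^sup>+b. weight h (\<lambda>s. ennreal (c s) * ennreal (approach s x a b)) \<partial>count_space UNIV)"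
    by (intro nn_integral_mono) auto
  also have "\<dots> = weight h (\<lambda>s. \<integral>\<^sup>+b. ennreal (c s) * ennreal (approach s x a b) \<partial>count_space UNIV)"
    by (rule weight_sum) measurable
  also have "\<dots> \<le> weight h (\<lambda>s. ennreal (4 * C / real (Suc k)) * potential x (Suc k) a s)"
  proof (intro weight_mono)
    fix s :: real assume s: "0 < s" "s \<le> 1"
    have "(\<integral>\<^sup>+b. ennreal (c s) * ennreal (approach s x a b) \<partial>count_space UNIV)
        = ennreal (c s) * (\<integral>\<^sup>+b. ennreal (approach s x a b) \<partial>count_space UNIV)"
      by (rule nn_integral_cmult) simp
    also have "\<dots> \<le> ennreal (c s) * ennreal (C * s powr (- 3 / 4) * decay ^ d a x)"
      using C(2) s by (intro mult_left_mono) auto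
    also have "\<dots> = ennreal (c s * (C * s powr (- 3 / 4) * decay ^ d a x))"
      using c C decay by (simp add: ennreal_mult)
    also have "c s * (C * s powr (- 3 / 4) * decay ^ d a x)
        = 4 * C / real (Suc k) * (decay ^ d a x * s powr (real (Suc k) / 4 - 3 / 4))"
      using s by (simp add: c_def powr_diff powr_minus_divide)
    also have "ennreal \<dots> = ennreal (4 * C / real (Suc k)) * potential x (Suc k) a s"
      unfolding potential_def by (rule ennreal_mult3) (use C(1) decay in auto)
    finally show "(\<integral>\<^sup>+b. ennreal (c s) * ennreal (approach s x a b) \<partial>count_space UNIV)
        \<le> ennreal (4 * C / real (Suc k)) * potential x (Suc k) a s" .
  qed
  also have "\<dots> = ennreal (4 * C / real (Suc k)) * weight h (potential x (Suc k) a)"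
    by (rule weight_cmult) measurable
  finally show ?thesis by (simp add: ar)
qed

lemma weight_potential_le:
  "\<exists>B\<ge>0. \<forall>v x n. list_sum (Suc n) (\<lambda>h. indicator {h. last h = v} h * weight h (potential x 0 (hd h)))
     \<le> ennreal (B ^ Suc n / fact (Suc n))"
proof -
  obtain C where C: "0 \<le> C" "\<And>s x a. 0 < s \<Longrightarrow>
      (\<integral>\<^sup>+b. ennreal (approach s x a b) \<partial>count_space UNIV) \<le> ennreal (C * s powr (- 3 / 4) * decay ^ d a x)"
    using sum_approach_le by blast
  define B where "B = 4 * max C 1"
  have B: "4 \<le> B" "4 * C \<le> B" by (auto simp: B_def)
  have main: "list_sum (Suc n) (\<lambda>h. indicator {h. last h = v} h * weight h (potential x k (hd h)))
     \<le> ennreal (B ^ Suc n * fact k / fact (Suc n + k))" for v x n k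
  proof (induction n arbitrary: k)
    case 0
    have "list_sum (Suc 0) (\<lambda>h. indicator {h. last h = v} h * weight h (potential x k (hd h)))
        = (\<integral>\<^sup>+b. weight [b] (potential x k b) * indicator {v} b \<partial>count_space UNIV)"
      by (auto intro!: nn_integral_cong simp: indicator_def)
    also have "\<dots> = weight [v] (potential x k v)" by (subst nn_integral_indicator_singleton) auto
    also have "\<dots> = (\<integral>\<^sup>+y. potential x k v y \<partial>unif)" by (rule weight_singleton) measurable
    also have "\<dots> = below (potential x k v) 1"
      unfolding below_def by (simp add: nn_integral_unif, intro nn_integral_cong) (auto simp: indicator_def)
    also have "\<dots> = ennreal (decay ^ d v x * (4 / real (Suc k)))"
      by (subst below_potential) auto
    also have "\<dots> \<le> ennreal (B * fact k / fact (Suc k))"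
    proof (intro ennreal_leI)
      have "decay ^ d v x * (4 / real (Suc k)) \<le> 1 * (4 / real (Suc k))"
        using decay by (intro mult_right_mono power_le_one) auto
      also have "\<dots> \<le> B / real (Suc k)" using B by (simp add: divide_right_mono)
      also have "\<dots> = B * fact k / fact (Suc k)" by (simp add: fact_Suc[of k] del: of_nat_Suc)
      finally show "decay ^ d v x * (4 / real (Suc k)) \<le> B * fact k / fact (Suc k)" .
    qed
    finally show ?case by simp
  next
    case (Suc n)
    let ?I = "\<lambda>h. indicator {h. last h = v} h :: ennreal"
    have "list_sum (Suc (Suc n)) (\<lambda>h. ?I h * weight h (potential x k (hd h)))
        = list_sum (Suc n) (\<lambda>h. \<integral>\<^sup>+b. ?I (b # h) * weight (b # h) (potential x k b) \<partial>count_space UNIV)"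
      by (subst list_sum_Suc) simp
    also have "\<dots> = list_sum (Suc n) (\<lambda>h. ?I h * (\<integral>\<^sup>+b. weight (b # h) (potential x k b) \<partial>count_space UNIV))"
    proof (intro list_sum_cong)
      fix h :: "'v list" assume "length h = Suc n"
      then have "h \<noteq> []" by auto
      then have "?I (b # h) = ?I h" for b by (simp add: indicator_def)
      then show "(\<integral>\<^sup>+b. ?I (b # h) * weight (b # h) (potential x k b) \<partial>count_space UNIV)
        = ?I h * (\<integral>\<^sup>+b. weight (b # h) (potential x k b) \<partial>count_space UNIV)"
        by (simp add: nn_integral_cmult)
    qed
    also have "\<dots> \<le> list_sum (Suc n) (\<lambda>h. ennreal (B / real (Suc k)) * (?I h * weight h (potential x (Suc k) (hd h))))"
    proof (intro list_sum_mono)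
      fix h :: "'v list" assume "length h = Suc n"
      then have h: "h \<noteq> []" by auto
      have "(\<integral>\<^sup>+b. weight (b # h) (potential x k b) \<partial>count_space UNIV)
          \<le> ennreal (4 * C / real (Suc k)) * weight h (potential x (Suc k) (hd h))"
        by (rule weight_potential_step[OF C h])
      also have "\<dots> \<le> ennreal (B / real (Suc k)) * weight h (potential x (Suc k) (hd h))"
        using B by (intro mult_right_mono ennreal_leI divide_right_mono) auto
      finally show "?I h * (\<integral>\<^sup>+b. weight (b # h) (potential x k b) \<partial>count_space UNIV)
          \<le> ennreal (B / real (Suc k)) * (?I h * weight h (potential x (Suc k) (hd h)))"
        by (subst mult.left_commute) (intro mult_left_mono, auto)
    qed
    also have "\<dots> = ennreal (B / real (Suc k)) * list_sum (Suc n) (\<lambda>h. ?I h * weight h (potential x (Suc k) (hd h)))"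
      by (rule list_sum_cmult)
    also have "\<dots> \<le> ennreal (B / real (Suc k)) * ennreal (B ^ Suc n * fact (Suc k) / fact (Suc n + Suc k))"
      by (intro mult_left_mono Suc.IH) simp
    also have "\<dots> = ennreal (B / real (Suc k) * (B ^ Suc n * fact (Suc k) / fact (Suc n + Suc k)))"
      using B by (intro ennreal_mult[symmetric]) auto
    also have "B / real (Suc k) * (B ^ Suc n * fact (Suc k) / fact (Suc n + Suc k))
        = B ^ Suc (Suc n) * fact k / fact (Suc (Suc n) + k)"
      by (simp add: fact_Suc[of k] del: of_nat_Suc)
    finally show ?case .
  qed
  show ?thesis
  proof (intro exI[of _ B] conjI allI)
    fix v x n
    show "list_sum (Suc n) (\<lambda>h. indicator {h. last h = v} h * weight h (potential x 0 (hd h)))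
     \<le> ennreal (B ^ Suc n / fact (Suc n))" using main[of n v x 0] by simp
  qed (use B in simp)
qed

text \<open>
  This bounds the probability that the current vertex of the path finds no smaller mark closer
  than x: by card_fresh_ge it has examined about K^(d(a,x)) fresh vertices, where a is the current
  vertex.
\<close>

lemma weight_reach_le:
  assumes "h \<noteq> []"
  shows "weight h (\<lambda>s. emeasure unif {s..} ^ card (fresh h x))
    \<le> ennreal (real K) * weight h (potential x 0 (hd h))"
proof -
  obtain a r where ar: "h = a # r" using assms by (cases h) auto
  have Kr: "real K > 1" using K_ge2 by simp
  have "weight h (\<lambda>s. emeasure unif {s..} ^ card (fresh h x))
    \<le> weight h (\<lambda>s. ennreal (real K) * potential x 0 (hd h) s)"
  proof (intro weight_mono)
    fix s :: real assume s: "0 < s" "s \<le> 1" and adm: "admissible h"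
    have "(1 - s) ^ card (fresh h x) \<le> real K * (decay ^ d a x * s powr (- 3 / 4))"
    proof (cases "a = x")
      case True
      have "(1 - s) ^ card (fresh h x) \<le> 1" using s by (intro power_le_one) auto
      also have "1 = 1 powr (- 3 / 4)" by simp
      also have "\<dots> \<le> s powr (- 3 / 4)" using s by (intro powr_mono2') auto
      also have "\<dots> \<le> real K * s powr (- 3 / 4)"
        using mult_right_mono[of 1 "real K" "s powr (- 3 / 4)"] Kr by simp
      finally show ?thesis using True by simp
    next
      case False
      have dpos: "d a x \<ge> 1" using False by (simp add: Suc_le_eq neq0_conv[symmetric] del: neq0_conv)
      have "real (K ^ (d a x - 1)) \<le> real (card (fresh h x) + 1)"
        using card_fresh_ge[of a r x] adm ar False by (intro of_nat_mono) auto
      then have "(1 - s) ^ card (fresh h x) \<le> (s * real K ^ (d a x - 1)) powr (- (3 / 4))"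
        using s K_ge2 by (intro one_minus_power_le_powr) auto
      also have "\<dots> = s powr (- 3 / 4) * real K powr (- 3 / 4 * (real (d a x) - 1))"
        using s Kr dpos by (simp add: powr_mult powr_realpow[symmetric] powr_powr mult.commute of_nat_diff)
      also have "\<dots> \<le> s powr (- 3 / 4) * real K powr (1 + - 1 / 3 * real (d a x))"
      proof -
        have "- 3 / 4 * (y - 1) \<le> 1 + - 1 / 3 * y" if "1 \<le> y" for y :: real
          using that by (simp add: field_simps)
        from this[of "real (d a x)"] show ?thesis
          using Kr dpos by (intro mult_left_mono powr_mono) auto
      qed
      also have "real K powr (1 + - 1 / 3 * real (d a x)) = real K * decay ^ d a x"
      proof -
        have "decay ^ d a x = real K powr (- 1 / 3 * real (d a x))"
          using Kr by (simp add: decay_def powr_powr powr_realpow[symmetric])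
        then show ?thesis unfolding powr_add using Kr by simp
      qed
      finally show ?thesis by (simp add: mult_ac)
    qed
    then have "emeasure unif {s..} ^ card (fresh h x) \<le> ennreal (real K * (decay ^ d a x * s powr (- 3 / 4)))"
      using s by (simp add: emeasure_unif_atLeast ennreal_power ennreal_leI)
    also have "\<dots> = ennreal (real K) * potential x 0 (hd h) s"
      using decay ar by (simp add: potential_def ennreal_mult[symmetric])
    finally show "emeasure unif {s..} ^ card (fresh h x) \<le> ennreal (real K) * potential x 0 (hd h) s" .
  qed
  also have "\<dots> = ennreal (real K) * weight h (potential x 0 (hd h))"
    by (rule weight_cmult) measurable
  finally show ?thesis .
qed

end

section \<open>Ancestral paths\<close>

text \<open>
  Finite pieces of ancestral paths, listed from the last ancestor back to the starting vertex.
\<close>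

fun lineage :: "('v \<Rightarrow> 'v option) \<Rightarrow> 'v list \<Rightarrow> bool" where
  "lineage par [] = False"
| "lineage par [a] = True"
| "lineage par (b # a # r) \<longleftrightarrow> par a = Some b \<and> lineage par (a # r)"

lemma ancestor_lineage:
  "ancestor par n v = Some w \<Longrightarrow> \<exists>h. length h = Suc n \<and> hd h = w \<and> last h = v \<and> lineage par h"
proof (induction n arbitrary: w)
  case 0
  then show ?case by (intro exI[of _ "[v]"]) simp
next
  case (Suc n)
  then obtain a where a: "ancestor par n v = Some a" "par a = Some w" by (auto simp: bind_eq_Some_conv)
  from Suc.IH[OF a(1)] obtain h where h: "length h = Suc n" "hd h = a" "last h = v" "lineage par h" by blast
  then obtain r where "h = a # r" by (cases h) auto
  then show ?case using h a by (intro exI[of _ "w # h"]) auto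
qed

lemma ancestor_add:
  "ancestor par (m + n) v = Option.bind (ancestor par m v) (ancestor par n)"
proof (induction n)
  case 0
  have "ancestor par 0 = Some" by (simp add: fun_eq_iff)
  then show ?case by simp
next
  case (Suc n)
  then show ?case by (cases "ancestor par m v") simp_all
qed

context tree_metric begin

definition increasing :: "('v \<Rightarrow> nat \<Rightarrow> 'v) \<Rightarrow> bool" where
  "increasing \<zeta> \<longleftrightarrow> (\<forall>v. bij (\<zeta> v) \<and> (\<forall>i j. j < i \<longrightarrow> d v (\<zeta> v j) \<le> d v (\<zeta> v i)))"

lemma parent_SomeD:
  assumes inc: "increasing \<zeta>" and p: "parent t \<zeta> v = Some w"
  shows "t w < t v" "d v u < d v w \<Longrightarrow> t v \<le> t u"
proof -
  let ?Q = "\<lambda>j. t (\<zeta> v j) < t v"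
  from p have ex: "\<exists>j. ?Q j" and w: "w = \<zeta> v (LEAST j. ?Q j)"
    by (auto simp: parent_def split: if_splits)
  show "t w < t v" unfolding w using LeastI_ex[OF ex] .
  assume u: "d v u < d v w"
  show "t v \<le> t u"
  proof (rule ccontr)
    assume "\<not> t v \<le> t u"
    moreover obtain i where i: "u = \<zeta> v i" using inc unfolding increasing_def by (metis bij_pointE)
    ultimately have "?Q i" by simp
    then have le: "(LEAST j. ?Q j) \<le> i" by (rule Least_le)
    show False
    proof (cases "(LEAST j. ?Q j) = i")
      case True
      then show ?thesis using w i u by simp
    next
      case False
      then have "d v w \<le> d v u" using le inc w i unfolding increasing_def by (metis le_neq_implies_less)
      then show ?thesis using u by simp
    qed
  qed
qed

lemma parent_not_None:
  assumes inc: "increasing \<zeta>" and u: "t u < t v"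
  shows "parent t \<zeta> v \<noteq> None"
proof -
  obtain i where "u = \<zeta> v i" using inc unfolding increasing_def by (metis bij_pointE)
  then show ?thesis using u by (auto simp: parent_def)
qed

text \<open>
  The third part says that the geodesics from the current vertex b to explored vertices contain no
  vertex that arrives before b. The parent c of b does arrive before b, so c is unexplored and no
  explored vertex lies beyond c as seen from b; this makes the next step admissible. To pass from
  b to c, use that by the tripod property a geodesic that starts at c is covered by the one from c
  to b, whose vertices other than c are too close to b to arrive earlier, and by one that starts
  at b.
\<close>

lemma lineage_invariant:
  assumes inc: "increasing \<zeta>"
    and mono: "\<And>u v. t u \<le> t v \<Longrightarrow> x u \<le> x v"
    and "lineage (parent t \<zeta>) h"
  shows "admissible h \<and> descent h x
    \<and> (\<forall>u\<in>explored h. \<forall>e. btw (hd h) e u \<longrightarrow> t (hd h) \<le> t e)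
    \<and> (\<forall>u\<in>explored h. u \<noteq> hd h \<longrightarrow> tl h \<noteq> [] \<longrightarrow> \<not> btw (hd (tl h)) (hd h) u)"
  using assms(3)
proof (induction h rule: explored.induct)
  case (2 a)
  have "t a \<le> t e" if "btw a e a" for e
  proof -
    have "d a a = d a e + d e a" using that unfolding btw_def .
    then have "d a e = 0" unfolding dist_self by linarith
    then have "a = e" by (simp only: dist_0_iff)
    then show ?thesis by simp
  qed
  then show ?case by simp
next
  case (3 c b r)
  let ?h = "b # r"
  have p: "parent t \<zeta> b = Some c" and l: "lineage (parent t \<zeta>) ?h" using "3.prems" by auto
  have tc: "t c < t b" and near: "\<And>u. d b u < d b c \<Longrightarrow> t b \<le> t u"
    using parent_SomeD[OF inc p] by auto
  have cb: "c \<noteq> b" using tc by auto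
  from "3.IH"[OF l] have IH: "admissible ?h" "descent ?h x"
    and I1: "\<And>u e. u \<in> explored ?h \<Longrightarrow> btw b e u \<Longrightarrow> t b \<le> t e"
    and I2: "\<And>u. u \<in> explored ?h \<Longrightarrow> u \<noteq> b \<Longrightarrow> r \<noteq> [] \<Longrightarrow> \<not> btw (hd r) b u"
    by auto
  have c: "c \<notin> explored ?h"
  proof
    assume "c \<in> explored ?h"
    from I1[OF this, of c] show False using tc by simp
  qed
  have F: "fresh ?h c \<inter> explored ?h = {}"
  proof (rule ccontr)
    assume "fresh ?h c \<inter> explored ?h \<noteq> {}"
    then obtain u where u: "u \<in> explored ?h" "u \<noteq> b" "r = [] \<or> btw (hd r) b u" by auto
    then show False using I2 by (cases r) auto
  qed
  have near': "t b \<le> t u" if "u \<in> fresh ?h c" for u using near that by auto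
  have desc: "descent (c # ?h) x"
    using IH(2) mono tc near' by (simp del: fresh.simps add: less_imp_le)
  have adm: "admissible (c # ?h)" using IH(1) c F by simp
  have tri: "t c \<le> t e" if u: "btw b e u \<Longrightarrow> t b \<le> t e" and e: "btw c e u" for e u
  proof (cases "btw b e u")
    case True
    then show ?thesis using u tc by simp
  next
    case False
    then have "btw c e b" using tripod[OF e, of b] by simp
    then have be: "d b c = d b e + d e c" unfolding btw_def using dist_sym by (metis add.commute)
    show ?thesis
    proof (cases "e = c")
      case False
      then have "0 < d e c" by (simp add: neq0_conv[symmetric] del: neq0_conv)
      then have "d b e < d b c" using be by simp
      then show ?thesis using near[of e] tc by simp
    qed simp
  qed
  have inv1: "t c \<le> t e" if u: "u \<in> explored (c # ?h)" and e: "btw c e u" for u e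
  proof -
    from u consider "u = c" | "u \<in> explored ?h" | "u \<in> fresh ?h c" by auto
    then show ?thesis
    proof cases
      case 1
      then have "d c c = d c e + d e c" using e unfolding btw_def by blast
      then have "d c e = 0" unfolding dist_self by linarith
      then have "c = e" by (simp only: dist_0_iff)
      then show ?thesis by simp
    next
      case 2
      show ?thesis by (rule tri[OF I1[OF 2] e])
    next
      case 3
      then have du: "d b u < d b c" by simp
      have "t b \<le> t e" if "btw b e u"
        using that du near[of e] unfolding btw_def by simp
      from tri[OF this e] show ?thesis .
    qed
  qed
  have inv2: "\<not> btw b c u" if u: "u \<in> explored (c # ?h)" "u \<noteq> c" for u
  proof -
    from u consider "u \<in> explored ?h" | "u \<in> fresh ?h c" by auto
    then show ?thesis
    proof cases
      case 1
      then show ?thesis using I1[OF 1, of c] tc by auto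
    next
      case 2
      then have "d b u < d b c" by simp
      then show ?thesis unfolding btw_def by simp
    qed
  qed
  show ?case using adm desc inv1 inv2 by (simp del: explored.simps admissible.simps descent.simps)
qed simp

end

text \<open>
  The mark is a weakly increasing function of the arrival time, as a distribution function may be
  constant on an interval.
\<close>

locale coloring = tree_metric d K + prob_space P
  for d :: "'v \<Rightarrow> 'v \<Rightarrow> nat" and K :: nat and P :: "'a measure" +
  fixes \<tau> :: "'v \<Rightarrow> 'a \<Rightarrow> real" and z :: "'v \<Rightarrow> 'a \<Rightarrow> nat \<Rightarrow> 'v" and X :: "'a \<Rightarrow> 'v \<Rightarrow> real"
  assumes measurable_X: "X \<in> measurable P unif_field"
    and distr_X: "distr P unif_field X = unif_field"
    and X_mono: "\<omega> \<in> space P \<Longrightarrow> \<tau> u \<omega> \<le> \<tau> v \<omega> \<Longrightarrow> X \<omega> u \<le> X \<omega> v"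
    and increasing_z: "\<omega> \<in> space P \<Longrightarrow> increasing (\<lambda>v. z v \<omega>)"
begin

definition par :: "'a \<Rightarrow> 'v \<Rightarrow> 'v option" where
  "par \<omega> = parent (\<lambda>v. \<tau> v \<omega>) (\<lambda>v. z v \<omega>)"

lemma lineage_par:
  assumes "\<omega> \<in> space P" "lineage (par \<omega>) h"
  shows "admissible h" "descent h (X \<omega>)" "fresh h x \<inter> explored h = {}"
proof -
  note inv = lineage_invariant[OF increasing_z[OF assms(1)], of "\<lambda>v. \<tau> v \<omega>" "X \<omega>" h]
  show "admissible h" "descent h (X \<omega>)"
    using inv X_mono assms unfolding par_def by blast+
  obtain a r where ar: "h = a # r" using assms(2) by (cases h) auto
  have q: "\<And>u. u \<in> explored h \<Longrightarrow> u \<noteq> hd h \<Longrightarrow> tl h \<noteq> [] \<Longrightarrow> \<not> btw (hd (tl h)) (hd h) u"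
    using inv X_mono assms unfolding par_def by blast
  show "fresh h x \<inter> explored h = {}"
  proof (cases "r = []")
    case False
    then show ?thesis using q ar by auto
  qed (auto simp: ar)
qed

lemma countable_lists: "countable (UNIV :: 'v list set)"
  using Countable_Set.countable_lists[OF countable_UNIV] by (simp add: lists_UNIV)

text \<open>
  These marks allow that the path continues from its current vertex to x or farther.
\<close>

definition clear_ball :: "'v list \<Rightarrow> 'v \<Rightarrow> ('v \<Rightarrow> real) set" where
  "clear_ball h x = {y. admissible h \<and> descent h y \<and> fresh h x \<inter> explored h = {} \<and> (\<forall>u\<in>fresh h x. y (hd h) \<le> y u)}"

lemma sets_clear_ball [measurable]: "clear_ball h x \<in> sets (unif_field :: ('v \<Rightarrow> real) measure)"
proof -
  have le: "{y \<in> space unif_field. y v \<le> (y u :: real)} \<in> sets unif_field" for u v :: 'v by measurable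
  have "{y \<in> space unif_field. \<forall>u\<in>fresh h x. y (hd h) \<le> (y u :: real)} \<in> sets unif_field"
    using le by (intro sets.sets_Collect_finite_All) auto
  then have "{y. admissible h \<and> descent h y} \<inter> {y. \<forall>u\<in>fresh h x. y (hd h) \<le> (y u :: real)} \<in> sets unif_field"
    by (intro sets.Int) auto
  moreover have "clear_ball h x = (if fresh h x \<inter> explored h = {} then
      {y. admissible h \<and> descent h y} \<inter> {y. \<forall>u\<in>fresh h x. y (hd h) \<le> (y u :: real)} else {})"
    by (auto simp: clear_ball_def)
  ultimately show ?thesis by simp
qed

lemma emeasure_clear_ball_le:
  assumes "h \<noteq> []"
  shows "emeasure unif_field (clear_ball h x) \<le> ennreal (real K) * weight h (potential x 0 (hd h))"
proof (cases "fresh h x \<inter> explored h = {}")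
  case True
  have "emeasure unif_field (clear_ball h x)
    = (\<integral>\<^sup>+y. indicator {y. admissible h \<and> descent h y} y * 1
    * indicator {y. \<forall>u\<in>fresh h x. y (hd h) \<le> y u} y \<partial>unif_field)"
    unfolding nn_integral_indicator[OF sets_clear_ball, symmetric]
    using True by (intro nn_integral_cong) (auto simp: indicator_def clear_ball_def)
  also have "\<dots> = weight h (\<lambda>s. emeasure unif {s..} ^ card (fresh h x) * 1)"
    using True assms by (intro weight_block) auto
  also have "\<dots> \<le> ennreal (real K) * weight h (potential x 0 (hd h))"
    using weight_reach_le[OF assms] by simp
  finally show ?thesis .
next
  case False
  then have "clear_ball h x = {}" by (auto simp: clear_ball_def)
  then show ?thesis by simp
qed

text \<open>
  By the bound on candidate paths, the n-th ancestor w of v finds no earlier arrival closer than x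
  with probability at most K B^(n+1) / (n+1)!, which is summable.
\<close>

lemma AE_eventually_short_jumps:
  "AE \<omega> in P. \<exists>N. \<forall>n\<ge>N. \<forall>w. ancestor (par \<omega>) n v = Some w \<longrightarrow> (\<exists>u. d w u < d w x \<and> \<tau> u \<omega> < \<tau> w \<omega>)"
proof -
  define E where "E n = (\<Union>h\<in>{h. length h = Suc n \<and> last h = v}. clear_ball h x)" for n
  have E [measurable]: "E n \<in> sets unif_field" for n
    unfolding E_def using countable_subset[OF subset_UNIV countable_lists]
    by (intro sets.countable_UN') auto
  obtain B where B: "0 \<le> B" "\<And>n. list_sum (Suc n) (\<lambda>h. indicator {h. last h = v} h * weight h (potential x 0 (hd h)))
     \<le> ennreal (B ^ Suc n / fact (Suc n))"
    using weight_potential_le by blast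
  have bound: "emeasure unif_field (E n) \<le> ennreal (real K * (B ^ Suc n / fact (Suc n)))" for n
  proof -
    have "emeasure unif_field (E n) = (\<integral>\<^sup>+y. indicator (E n) y \<partial>unif_field)" by simp
    also have "\<dots> \<le> (\<integral>\<^sup>+y. list_sum (Suc n) (\<lambda>h. indicator {h. last h = v} h * indicator (clear_ball h x) y) \<partial>unif_field)"
    proof (intro nn_integral_mono)
      fix y :: "'v \<Rightarrow> real"
      show "indicator (E n) y \<le> list_sum (Suc n) (\<lambda>h. indicator {h. last h = v} h * indicator (clear_ball h x) y)"
      proof (cases "y \<in> E n")
        case True
        then obtain h where h: "length h = Suc n" "last h = v" "y \<in> clear_ball h x" by (auto simp: E_def)
        have "(1::ennreal) = indicator {h. last h = v} h * indicator (clear_ball h x) y" using h by simp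
        also have "\<dots> \<le> list_sum (Suc n) (\<lambda>h. indicator {h. last h = v} h * indicator (clear_ball h x) y)"
          by (rule list_sum_ge[OF h(1)])
        finally show ?thesis using True by simp
      qed simp
    qed
    also have "\<dots> = list_sum (Suc n) (\<lambda>h. \<integral>\<^sup>+y. indicator {h. last h = v} h * indicator (clear_ball h x) y \<partial>unif_field)"
      by (rule nn_integral_list_sum) measurable
    also have "\<dots> \<le> list_sum (Suc n) (\<lambda>h. ennreal (real K) * (indicator {h. last h = v} h * weight h (potential x 0 (hd h))))"
    proof (intro list_sum_mono)
      fix h :: "'v list" assume "length h = Suc n"
      then have "h \<noteq> []" by auto
      then have "emeasure unif_field (clear_ball h x) \<le> ennreal (real K) * weight h (potential x 0 (hd h))"
        by (rule emeasure_clear_ball_le)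
      moreover have "(\<integral>\<^sup>+y. indicator {h. last h = v} h * indicator (clear_ball h x) y \<partial>unif_field)
          = indicator {h. last h = v} h * emeasure unif_field (clear_ball h x)"
        by (subst nn_integral_cmult) auto
      ultimately show "(\<integral>\<^sup>+y. indicator {h. last h = v} h * indicator (clear_ball h x) y \<partial>unif_field)
          \<le> ennreal (real K) * (indicator {h. last h = v} h * weight h (potential x 0 (hd h)))"
        by (simp add: indicator_def)
    qed
    also have "\<dots> \<le> ennreal (real K) * ennreal (B ^ Suc n / fact (Suc n))"
      unfolding list_sum_cmult by (intro mult_left_mono B) simp
    also have "\<dots> = ennreal (real K * (B ^ Suc n / fact (Suc n)))"
      by (rule ennreal_mult[symmetric]) (use B(1) in auto)
    finally show ?thesis .
  qed
  interpret f: prob_space "unif_field :: ('v \<Rightarrow> real) measure" by (rule prob_space_field)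
  have "summable (\<lambda>n. B ^ n / fact n)" using summable_exp[of B] by (simp add: divide_inverse mult.commute)
  then have "summable (\<lambda>n. B ^ Suc n / fact (Suc n))" by (subst summable_Suc_iff)
  then have "summable (\<lambda>n. real K * (B ^ Suc n / fact (Suc n)))" by (rule summable_mult)
  moreover have "norm (measure unif_field (E n)) \<le> real K * (B ^ Suc n / fact (Suc n))" for n
    using bound[of n] B by (simp add: f.emeasure_eq_measure)
  ultimately have "summable (\<lambda>n. measure unif_field (E n))"
    by (rule summable_comparison_test'[where N=0])
  then have "AE y in unif_field. eventually (\<lambda>n. y \<in> space unif_field - E n) sequentially"
    by (intro borel_cantelli_AE1) (auto simp: f.emeasure_eq_measure)
  then have "AE y in distr P unif_field X. eventually (\<lambda>n. y \<notin> E n) sequentially"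
    unfolding distr_X by simp
  then have "AE \<omega> in P. eventually (\<lambda>n. X \<omega> \<notin> E n) sequentially"
    by (rule AE_distrD[OF measurable_X])
  then show ?thesis
  proof (rule AE_mp, intro AE_I2 impI)
    fix \<omega> assume \<omega>: "\<omega> \<in> space P" and "eventually (\<lambda>n. X \<omega> \<notin> E n) sequentially"
    then obtain N where N: "\<And>n. n \<ge> N \<Longrightarrow> X \<omega> \<notin> E n" by (auto simp: eventually_sequentially)
    show "\<exists>N. \<forall>n\<ge>N. \<forall>w. ancestor (par \<omega>) n v = Some w \<longrightarrow> (\<exists>u. d w u < d w x \<and> \<tau> u \<omega> < \<tau> w \<omega>)"
    proof (intro exI[of _ N] allI impI)
      fix n w assume n: "N \<le> n" and w: "ancestor (par \<omega>) n v = Some w"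
      obtain h where h: "length h = Suc n" "hd h = w" "last h = v" "lineage (par \<omega>) h"
        using ancestor_lineage[OF w] by blast
      have "X \<omega> \<notin> clear_ball h x" using N[OF n] h by (auto simp: E_def)
      then obtain u where u: "u \<in> fresh h x" "\<not> X \<omega> w \<le> X \<omega> u"
        using lineage_par[OF \<omega> h(4)] h by (auto simp: clear_ball_def)
      have "d w u < d w x" using u h by (cases h) auto
      moreover have "\<tau> u \<omega> < \<tau> w \<omega>" using X_mono[OF \<omega>, of w u] u by force
      ultimately show "\<exists>u. d w u < d w x \<and> \<tau> u \<omega> < \<tau> w \<omega>" by blast
    qed
  qed
qed

text \<open>
  A mark that is minimal on the whole tree is minimal within every distance q, which has
  probability at most 4 K decay^q.
\<close>

lemma AE_ex_earlier: "AE \<omega> in P. \<exists>u. \<tau> u \<omega> < \<tau> v \<omega>"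
proof -
  interpret f: prob_space "unif_field :: ('v \<Rightarrow> real) measure" by (rule prob_space_field)
  define E where "E = {y :: 'v \<Rightarrow> real. \<forall>u\<in>UNIV. y v \<le> y u}"
  have le: "{y \<in> space unif_field. y v \<le> (y u :: real)} \<in> sets unif_field" for u :: 'v by measurable
  have "{y \<in> space unif_field. \<forall>u\<in>UNIV. y v \<le> (y u :: real)} \<in> sets unif_field"
    using le countable_UNIV by (intro sets.sets_Collect_countable_All') auto
  then have E [measurable]: "E \<in> sets unif_field" by (simp add: E_def)
  have le: "measure unif_field E \<le> 4 * real K * decay ^ q" for q
  proof -
    have "card (sphere v q) \<noteq> 0"
      using K_ge2 by (cases q) (auto simp: sphere_0 card_sphere_Suc)
    then have "sphere v q \<noteq> {}" by (metis card.empty)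
    then obtain x where x: "d v x = q" by (auto simp: sphere_def)
    have "E \<subseteq> clear_ball [v] x" by (auto simp: E_def clear_ball_def)
    then have "emeasure unif_field E \<le> emeasure unif_field (clear_ball [v] x)" by (intro emeasure_mono) auto
    also have "\<dots> \<le> ennreal (real K) * weight [v] (potential x 0 v)"
      using emeasure_clear_ball_le[of "[v]" x] by simp
    also have "weight [v] (potential x 0 v) = (\<integral>\<^sup>+y. potential x 0 v y \<partial>unif)"
      by (rule weight_singleton) measurable
    also have "\<dots> = below (potential x 0 v) 1"
      unfolding below_def by (simp add: nn_integral_unif, intro nn_integral_cong) (auto simp: indicator_def)
    also have "\<dots> = ennreal (decay ^ q * 4)" by (subst below_potential) (auto simp: x)
    also have "ennreal (real K) * ennreal (decay ^ q * 4) = ennreal (4 * real K * decay ^ q)"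
      using decay by (simp add: ennreal_mult[symmetric] mult_ac)
    finally show ?thesis using decay by (simp add: f.emeasure_eq_measure)
  qed
  have "decay \<noteq> 1"
  proof
    assume "decay = 1"
    then have "ln (decay) = 0" by simp
    then show False using K_ge2 by (simp add: decay_def ln_powr)
  qed
  then have "decay < 1" using decay by simp
  then have lim: "(\<lambda>q. 4 * real K * decay ^ q) \<longlonglongrightarrow> 4 * real K * 0"
    using decay by (intro tendsto_mult_left LIMSEQ_realpow_zero) auto
  have "measure unif_field E \<le> 4 * real K * 0" by (rule LIMSEQ_le_const[OF lim]) (use le in blast)
  then have "measure unif_field E \<le> 0" by simp
  then have "E \<in> null_sets unif_field" using measure_nonneg[of unif_field E] by (auto simp: null_sets_def f.emeasure_eq_measure)
  then have "AE y in distr P unif_field X. y \<notin> E" unfolding distr_X by (rule AE_not_in)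
  then have "AE \<omega> in P. X \<omega> \<notin> E" by (rule AE_distrD[OF measurable_X])
  then show ?thesis
  proof (rule AE_mp, intro AE_I2 impI)
    fix \<omega> assume \<omega>: "\<omega> \<in> space P" and "X \<omega> \<notin> E"
    then obtain u where "\<not> X \<omega> v \<le> X \<omega> u" by (auto simp: E_def)
    then show "\<exists>u. \<tau> u \<omega> < \<tau> v \<omega>" using X_mono[OF \<omega>, of v u] by (intro exI[of _ u]) (auto simp: not_le[symmetric])
  qed
qed

text \<open>
  Each descendant of v is the start of a candidate path that ends at v.
\<close>

lemma nn_integral_card_descendants_late:
  assumes t: "0 < t"
  shows "(\<integral>\<^sup>+\<omega>. emeasure (count_space UNIV) (descendants (par \<omega>) v) * indicator {\<omega>. t < X \<omega> v} \<omega> \<partial>P) < \<infinity>"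
proof -
  define f :: "'v list \<Rightarrow> ('v \<Rightarrow> real) \<Rightarrow> ennreal" where
    "f h y = indicator {h. hd h = v} h * (indicator {y. admissible h \<and> descent h y} y * late t 0 (y (hd h)))" for h y
  have f [measurable]: "f h \<in> borel_measurable unif_field" for h unfolding f_def by measurable
  have pt: "emeasure (count_space UNIV) (descendants (par \<omega>) v) * indicator {\<omega>. t < X \<omega> v} \<omega>
      \<le> (\<Sum>n. list_sum (Suc n) (\<lambda>h. f h (X \<omega>)))" if \<omega>: "\<omega> \<in> space P" for \<omega>
  proof (cases "t < X \<omega> v")
    case True
    have "emeasure (count_space UNIV) (descendants (par \<omega>) v)
        = (\<integral>\<^sup>+w. indicator (descendants (par \<omega>) v) w \<partial>count_space UNIV)" by simp
    also have "\<dots> \<le> (\<integral>\<^sup>+w. (\<Sum>n. list_sum (Suc n) (\<lambda>h. indicator {last h} w * f h (X \<omega>))) \<partial>count_space UNIV)"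
    proof (intro nn_integral_mono)
      fix w
      show "indicator (descendants (par \<omega>) v) w
          \<le> (\<Sum>n. list_sum (Suc n) (\<lambda>h. indicator {last h} w * f h (X \<omega>)))"
      proof (cases "w \<in> descendants (par \<omega>) v")
        case w: True
        then obtain n where n: "ancestor (par \<omega>) n w = Some v"
          by (auto simp: descendants_def ancestral_path_def)
        obtain h where h: "length h = Suc n" "hd h = v" "last h = w" "lineage (par \<omega>) h"
          using ancestor_lineage[OF n] by blast
        have "late t 0 (X \<omega> v) = 1" using True t by (simp add: late_def)
        then have "(1::ennreal) = indicator {last h} w * f h (X \<omega>)"
          using h lineage_par[OF \<omega> h(4)] by (simp add: f_def)
        also have "\<dots> \<le> list_sum (Suc n) (\<lambda>h. indicator {last h} w * f h (X \<omega>))"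
          by (rule list_sum_ge[OF h(1)])
        also have "\<dots> \<le> (\<Sum>n. list_sum (Suc n) (\<lambda>h. indicator {last h} w * f h (X \<omega>)))"
          using sum_le_suminf[of "\<lambda>n. list_sum (Suc n) (\<lambda>h. indicator {last h} w * f h (X \<omega>))" "{n}"]
          by (simp del: list_sum.simps)
        finally show ?thesis using w by simp
      qed simp
    qed
    also have "\<dots> = (\<Sum>n. \<integral>\<^sup>+w. list_sum (Suc n) (\<lambda>h. indicator {last h} w * f h (X \<omega>)) \<partial>count_space UNIV)"
      by (rule nn_integral_suminf) simp
    also have "\<dots> = (\<Sum>n. list_sum (Suc n) (\<lambda>h. f h (X \<omega>)))"
    proof (intro suminf_cong)
      fix n
      have "(\<integral>\<^sup>+w. list_sum (Suc n) (\<lambda>h. indicator {last h} w * f h (X \<omega>)) \<partial>count_space UNIV)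
          = list_sum (Suc n) (\<lambda>h. \<integral>\<^sup>+w. indicator {last h} w * f h (X \<omega>) \<partial>count_space UNIV)"
        by (rule list_sum_nn_integral_count[symmetric])
      also have "\<dots> = list_sum (Suc n) (\<lambda>h. f h (X \<omega>))"
        by (intro list_sum_cong) (simp add: nn_integral_multc)
      finally show "(\<integral>\<^sup>+w. list_sum (Suc n) (\<lambda>h. indicator {last h} w * f h (X \<omega>)) \<partial>count_space UNIV)
          = list_sum (Suc n) (\<lambda>h. f h (X \<omega>))" .
    qed
    finally show ?thesis using True by simp
  qed simp
  obtain A where A: "0 \<le> A" "\<And>v. (\<integral>\<^sup>+a. ennreal (far_weight t (d a v)) \<partial>count_space UNIV) \<le> ennreal A"
    using sum_far_weight_finite[OF t] by blast
  have "(\<integral>\<^sup>+\<omega>. emeasure (count_space UNIV) (descendants (par \<omega>) v) * indicator {\<omega>. t < X \<omega> v} \<omega> \<partial>P)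
      \<le> (\<integral>\<^sup>+\<omega>. (\<Sum>n. list_sum (Suc n) (\<lambda>h. f h (X \<omega>))) \<partial>P)"
    using pt by (intro nn_integral_mono)
  also have "\<dots> = (\<integral>\<^sup>+y. (\<Sum>n. list_sum (Suc n) (\<lambda>h. f h y)) \<partial>distr P unif_field X)"
    by (subst nn_integral_distr[OF measurable_X]) (simp_all del: list_sum.simps add: measurable_list_sum)
  also have "\<dots> = (\<integral>\<^sup>+y. (\<Sum>n. list_sum (Suc n) (\<lambda>h. f h y)) \<partial>unif_field)" unfolding distr_X ..
  also have "\<dots> = (\<Sum>n. \<integral>\<^sup>+y. list_sum (Suc n) (\<lambda>h. f h y) \<partial>unif_field)"
    by (rule nn_integral_suminf) (simp del: list_sum.simps add: measurable_list_sum)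
  also have "\<dots> = (\<Sum>n. list_sum (Suc n) (\<lambda>h. \<integral>\<^sup>+y. f h y \<partial>unif_field))"
    by (intro suminf_cong nn_integral_list_sum) simp
  also have "\<dots> = (\<Sum>n. list_sum (Suc n) (\<lambda>h. indicator {h. hd h = v} h * weight h (late t 0)))"
  proof (intro suminf_cong list_sum_cong)
    fix h
    show "(\<integral>\<^sup>+y. f h y \<partial>unif_field) = indicator {h. hd h = v} h * weight h (late t 0)"
      unfolding f_def weight_def by (rule nn_integral_cmult) measurable
  qed
  also have "\<dots> \<le> (\<Sum>n. ennreal (A ^ n / fact n))"
    using weight_late_le[OF t A, where k=0] by (intro suminf_le) auto
  also have "\<dots> < \<infinity>"
  proof -
    have "summable (\<lambda>n. A ^ n / fact n)" using summable_exp[of A] by (simp add: divide_inverse mult.commute)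
    then have "(\<Sum>n. ennreal (A ^ n / fact n)) \<noteq> top" using A by (intro ennreal_suminf_neq_top) auto
    then show ?thesis by (simp add: less_top)
  qed
  finally show ?thesis .
qed

end

section \<open>Components of genealogical graphs\<close>

definition coalesce :: "('v \<Rightarrow> 'v option) \<Rightarrow> 'v \<Rightarrow> 'v \<Rightarrow> bool" where
  "coalesce par u v \<longleftrightarrow> (\<exists>n m w. ancestor par n u = Some w \<and> ancestor par m v = Some w)"

text \<open>
  The connected component of v: each vertex has at most one parent, so two vertices are connected
  exactly if their ancestral paths meet.
\<close>

definition kin :: "('v \<Rightarrow> 'v option) \<Rightarrow> 'v \<Rightarrow> 'v graph" where
  "kin par v = with_proj \<lparr>pverts = {u. coalesce par u v}, parcs = {(a, b). par a = Some b \<and> coalesce par a v}\<rparr>"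

lemma coalesce_refl: "coalesce par u u"
  unfolding coalesce_def by (intro exI[of _ 0]) simp

lemma coalesce_sym: "coalesce par u v \<Longrightarrow> coalesce par v u"
  unfolding coalesce_def by blast

lemma ancestor_diff:
  assumes "ancestor par n v = Some a" "ancestor par m v = Some b" "n \<le> m"
  shows "ancestor par (m - n) a = Some b"
  using ancestor_add[of par n "m - n" v] assms by simp

lemma ancestor_trans:
  "ancestor par n u = Some w \<Longrightarrow> ancestor par m w = Some x \<Longrightarrow> ancestor par (n + m) u = Some x"
  by (simp add: ancestor_add)

lemma coalesce_trans:
  assumes "coalesce par u v" "coalesce par v w"
  shows "coalesce par u w"
proof -
  obtain n m a where 1: "ancestor par n u = Some a" "ancestor par m v = Some a"
    using assms(1) by (auto simp: coalesce_def)
  obtain k l b where 2: "ancestor par k v = Some b" "ancestor par l w = Some b"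
    using assms(2) by (auto simp: coalesce_def)
  show ?thesis
  proof (cases "m \<le> k")
    case True
    have "ancestor par (n + (k - m)) u = Some b"
      by (rule ancestor_trans[OF 1(1) ancestor_diff[OF 1(2) 2(1) True]])
    then show ?thesis using 2 unfolding coalesce_def by blast
  next
    case False
    then have "ancestor par (l + (m - k)) w = Some a"
      by (intro ancestor_trans[OF 2(2)] ancestor_diff[OF 2(1) 1(2)]) simp
    then show ?thesis using 1 unfolding coalesce_def by blast
  qed
qed

lemma coalesce_ancestor: "ancestor par n u = Some w \<Longrightarrow> coalesce par u w"
  unfolding coalesce_def by (intro exI[of _ n] exI[of _ 0] exI[of _ w]) simp

lemma coalesce_parent: "par a = Some b \<Longrightarrow> coalesce par a b"
  using coalesce_ancestor[of par 1 a b] by simp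

lemma verts_kin [simp]: "verts (kin par v) = {u. coalesce par u v}"
  and arcs_kin: "arcs (kin par v) = {(a, b). par a = Some b \<and> coalesce par a v}"
  and tail_kin [simp]: "tail (kin par v) = fst"
  and head_kin [simp]: "head (kin par v) = snd"
  by (simp_all add: kin_def)

lemma verts_genealogical [simp]: "verts (genealogical_graph par) = UNIV"
  and arcs_genealogical: "arcs (genealogical_graph par) = {(a, b). par a = Some b}"
  and tail_genealogical [simp]: "tail (genealogical_graph par) = fst"
  and head_genealogical [simp]: "head (genealogical_graph par) = snd"
  by (simp_all add: genealogical_graph_def)

lemma wf_kin: "wf_digraph (kin par v)"
proof
  fix e assume e: "e \<in> arcs (kin par v)"
  then show "tail (kin par v) e \<in> verts (kin par v)" by (auto simp: arcs_kin)
  from e show "head (kin par v) e \<in> verts (kin par v)"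
    using coalesce_trans[OF coalesce_sym[OF coalesce_parent]] by (auto simp: arcs_kin)
qed

lemma wf_genealogical: "wf_digraph (genealogical_graph par)"
  by unfold_locales auto

lemma subgraph_kin: "subgraph (kin par v) (genealogical_graph par)"
  by (intro subgraphI wf_kin wf_genealogical) (auto simp: arcs_kin arcs_genealogical compatible_def)

lemma kin_reaches_ancestor:
  assumes "coalesce par u v"
  shows "ancestor par n u = Some w \<Longrightarrow> u \<rightarrow>\<^sup>*\<^bsub>kin par v\<^esub> w"
proof (induction n arbitrary: w)
  case 0
  then show ?case using assms wf_digraph.reachable_refl[OF wf_kin] by simp
next
  case (Suc n)
  then obtain a where a: "ancestor par n u = Some a" "par a = Some w" by (auto simp: bind_eq_Some_conv)
  have "coalesce par a v" using coalesce_trans[OF coalesce_sym[OF coalesce_ancestor[OF a(1)]] assms] .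
  then have "(a, w) \<in> arcs_ends (kin par v)" using a by (force simp: arcs_ends_conv arcs_kin)
  then show ?case using wf_digraph.reachable_adj_trans[OF wf_kin Suc.IH[OF a(1)]] by blast
qed

lemma connected_kin: "Digraph_Component.connected (kin par v)"
proof -
  interpret wf_digraph "kin par v" by (rule wf_kin)
  interpret S: pair_wf_digraph "mk_symmetric (kin par v)" by (rule wellformed_mk_symmetric)
  have "u \<rightarrow>\<^sup>*\<^bsub>with_proj (mk_symmetric (kin par v))\<^esub> w"
    if uw: "coalesce par u v" "coalesce par w v" for u w
  proof -
    obtain n m x where x: "ancestor par n u = Some x" "ancestor par m w = Some x"
      using coalesce_trans[OF uw(1) coalesce_sym[OF uw(2)]] by (auto simp: coalesce_def)
    have ux: "u \<rightarrow>\<^sup>*\<^bsub>with_proj (mk_symmetric (kin par v))\<^esub> x"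
      by (rule reachable_mk_symmetricI[OF kin_reaches_ancestor[OF uw(1) x(1)]])
    have wx: "w \<rightarrow>\<^sup>*\<^bsub>with_proj (mk_symmetric (kin par v))\<^esub> x"
      by (rule reachable_mk_symmetricI[OF kin_reaches_ancestor[OF uw(2) x(2)]])
    show ?thesis
      by (rule S.reachable_trans[OF ux symmetric_reachable[OF symmetric_mk_symmetric wx]])
  qed
  then show ?thesis
    unfolding connected_def strongly_connected_def using coalesce_refl[of par v] by auto
qed

lemma connected_subgraph_coalesce:
  assumes H: "subgraph H (genealogical_graph par)" "Digraph_Component.connected H"
    and uv: "u \<in> verts H" "v \<in> verts H"
  shows "coalesce par u v"
proof -
  have "u \<rightarrow>\<^sup>*\<^bsub>with_proj (mk_symmetric H)\<^esub> v"
    using H uv unfolding connected_def strongly_connected_def by simp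
  then have "(u, v) \<in> (arcs_ends (with_proj (mk_symmetric H)))\<^sup>*" by (rule reachable_rtranclI)
  then show ?thesis
  proof (induction rule: rtrancl_induct)
    case base
    show ?case by (rule coalesce_refl)
  next
    case (step a b)
    have HG: "arcs H \<subseteq> {(a, b). par a = Some b}" "tail H = fst" "head H = snd"
      using H unfolding subgraph_def compatible_def by (auto simp: arcs_genealogical)
    have "par a = Some b \<or> par b = Some a"
      using step.hyps(2) HG by (auto simp: parcs_mk_symmetric)
    then have "coalesce par a b" using coalesce_parent coalesce_sym by metis
    then show ?case using coalesce_trans step.IH by metis
  qed
qed

lemma connected_subgraph_le_kin:
  assumes H: "subgraph H (genealogical_graph par)" "Digraph_Component.connected H" "v \<in> verts H"
  shows "subgraph H (kin par v)"
proof (intro subgraphI wf_kin)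
  show "verts H \<subseteq> verts (kin par v)" using connected_subgraph_coalesce[OF H(1,2) _ H(3)] by auto
  moreover have HG: "arcs H \<subseteq> {(a, b). par a = Some b}" "tail H = fst" "head H = snd" "wf_digraph H"
    using H unfolding subgraph_def compatible_def by (auto simp: arcs_genealogical)
  ultimately show "arcs H \<subseteq> arcs (kin par v)"
    using wf_digraph.tail_in_verts[OF HG(4)] by (fastforce simp: arcs_kin)
  show "compatible (kin par v) H" "wf_digraph H" using HG by (auto simp: compatible_def)
qed

lemma subgraph_antisym: "subgraph G H \<Longrightarrow> subgraph H G \<Longrightarrow> G = (H :: ('a, 'b) pre_digraph)"
  unfolding subgraph_def compatible_def by (auto intro!: pre_digraph.equality)

lemma components_genealogical: "components (genealogical_graph par) = range (kin par)"
proof (intro equalityI subsetI)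
  fix C assume "C \<in> components (genealogical_graph par)"
  then have C: "subgraph C (genealogical_graph par)" "Digraph_Component.connected C"
    and max: "\<And>H'. H' \<noteq> C \<Longrightarrow> subgraph C H' \<Longrightarrow> subgraph H' (genealogical_graph par) \<Longrightarrow> \<not> Digraph_Component.connected H'"
    unfolding components_def pre_digraph.max_subgraph_def by auto
  obtain v where v: "v \<in> verts C" using C(2) unfolding connected_def strongly_connected_def by auto
  have "C = kin par v"
    using max[of "kin par v"] connected_subgraph_le_kin[OF C v] subgraph_kin connected_kin by metis
  then show "C \<in> range (kin par)" by simp
next
  fix C assume "C \<in> range (kin par)"
  then obtain v where C: "C = kin par v" by auto
  have maximal: "H' = C" if "subgraph C H'" "subgraph H' (genealogical_graph par)" "Digraph_Component.connected H'" for H'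
  proof -
    have "v \<in> verts H'" using that(1) coalesce_refl[of par v] unfolding C subgraph_def by auto
    then show ?thesis using connected_subgraph_le_kin[OF that(2,3)] that(1) subgraph_antisym C by metis
  qed
  then show "C \<in> components (genealogical_graph par)"
    unfolding components_def pre_digraph.max_subgraph_def mem_Collect_eq
  proof (intro conjI allI impI notI)
    show "subgraph C (genealogical_graph par)" unfolding C by (rule subgraph_kin)
    show "Digraph_Component.connected C" unfolding C by (rule connected_kin)
    fix H' assume "H' \<noteq> C \<and> subgraph C H'" "subgraph H' (genealogical_graph par) \<and> Digraph_Component.connected H'"
    then show False using maximal[of H']
      by simp
  qed
qed

lemma kin_eq_iff: "kin par u = kin par v \<longleftrightarrow> coalesce par u v"
proof
  assume "kin par u = kin par v"
  then have "verts (kin par u) = verts (kin par v)" by simp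
  then show "coalesce par u v" using coalesce_refl[of par u] by (simp add: set_eq_iff)
next
  assume uv: "coalesce par u v"
  have "coalesce par a u = coalesce par a v" for a
    using coalesce_trans[OF _ uv] coalesce_trans[OF _ coalesce_sym[OF uv]] by blast
  then show "kin par u = kin par v" by (simp add: kin_def)
qed

lemma component_of_genealogical: "component_of (genealogical_graph par) v = kin par v"
  unfolding component_of_def components_genealogical
proof (rule the_equality)
  show "kin par v \<in> range (kin par) \<and> v \<in> verts (kin par v)" using coalesce_refl by auto
  show "C = kin par v" if "C \<in> range (kin par) \<and> v \<in> verts C" for C
    using that kin_eq_iff coalesce_sym by fastforce
qed

lemma cycle_arcs:
  assumes "pcas u p w"
  shows "\<And>j. Suc j < length p \<Longrightarrow> fst (p ! Suc j) = snd (p ! j)"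
    and "p \<noteq> [] \<Longrightarrow> fst (p ! 0) = u \<and> snd (p ! (length p - 1)) = w"
    and "tl (pawalk_verts u p) = map snd p"
proof -
  have "(\<forall>j. Suc j < length p \<longrightarrow> fst (p ! Suc j) = snd (p ! j))
    \<and> (p \<noteq> [] \<longrightarrow> fst (p ! 0) = u \<and> snd (p ! (length p - 1)) = w) \<and> pawalk_verts u p = u # map snd p"
    using assms
  proof (induction p arbitrary: u)
    case (Cons e p)
    then have e: "fst e = u" and p: "pcas (snd e) p w" by auto
    note IH = Cons.IH[OF p]
    show ?case
    proof (intro conjI allI impI)
      fix j assume "Suc j < length (e # p)"
      then show "fst ((e # p) ! Suc j) = snd ((e # p) ! j)" using IH by (cases j) auto
    next
      show "snd ((e # p) ! (length (e # p) - 1)) = w" using IH p by (cases p) auto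
    next
      show "pawalk_verts u (e # p) = u # map snd (e # p)" using e IH by simp
    qed (use e in simp)
  qed simp
  then show "\<And>j. Suc j < length p \<Longrightarrow> fst (p ! Suc j) = snd (p ! j)"
    "p \<noteq> [] \<Longrightarrow> fst (p ! 0) = u \<and> snd (p ! (length p - 1)) = w"
    "tl (pawalk_verts u p) = map snd p" by auto
qed

text \<open>
  On a cycle, the vertex with the largest value of t would have both of its neighbors as parents.
\<close>

lemma no_undirected_cycle_functional:
  fixes t :: "'v \<Rightarrow> real"
  assumes H: "arcs H \<subseteq> {(a, b). par a = Some b}" "tail H = fst" "head H = snd"
    and t: "\<And>a b. par a = Some b \<Longrightarrow> t b < t a"
  shows "no_undirected_cycle H"
  unfolding no_undirected_cycle_def
proof
  assume "\<exists>p. pre_digraph.cycle (with_proj (mk_symmetric H)) p \<and> 3 \<le> length p"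
  then obtain p u where aw: "pre_digraph.awalk (with_proj (mk_symmetric H)) u p u"
    and dist: "distinct (tl (pawalk_verts u p))" and n: "3 \<le> length p"
    unfolding pre_digraph.cycle_def awalk_verts_with_proj_eq by auto
  define n where "n = length p"
  have n3: "3 \<le> n" using n n_def by simp
  have set: "set p \<subseteq> parcs (mk_symmetric H)" and cas: "pcas u p u"
    using aw unfolding pre_digraph.awalk_def cas_with_proj_eq by auto
  define q where "q j = p ! (j mod n)" for j
  have q_in: "q j \<in> set p" for j
  proof -
    have "j mod n < n" using n3 by simp
    then show ?thesis unfolding q_def n_def by simp
  qed
  have q_step: "fst (q (Suc j)) = snd (q j)" for j
  proof (cases "Suc (j mod n) = n")
    case True
    then have "Suc j mod n = 0" "j mod n = n - 1" using mod_Suc[of j n] by auto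
    moreover have "p \<noteq> []" using n3 n_def by auto
    ultimately show ?thesis using cycle_arcs(2)[OF cas] unfolding q_def n_def by metis
  next
    case False
    then have "Suc j mod n = Suc (j mod n)" "Suc (j mod n) < n"
    proof -
      show "Suc j mod n = Suc (j mod n)" using False mod_Suc[of j n] by simp
      have "j mod n < n" using n3 by simp
      then show "Suc (j mod n) < n" using False by simp
    qed
    then show ?thesis using cycle_arcs(1)[OF cas, of "j mod n"] unfolding q_def n_def by auto
  qed
  have q_inj: "i mod n = j mod n" if "snd (q i) = snd (q j)" for i j
  proof -
    have "distinct (map snd p)" using dist cycle_arcs(3)[OF cas] by simp
    moreover have "0 < n" using n3 by simp
    then have "i mod n < length p" "j mod n < length p" by (simp_all flip: n_def)
    ultimately show ?thesis using that nth_eq_iff_index_eq[of "map snd p" "i mod n" "j mod n"]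
      unfolding q_def by simp
  qed
  have arc: "par (fst e) = Some (snd e) \<or> par (snd e) = Some (fst e)" if e: "e \<in> set p" for e
  proof -
    have "e \<in> parcs (mk_symmetric H)" using e set by blast
    then obtain x where x: "x \<in> arcs H" "e = (fst x, snd x) \<or> e = (snd x, fst x)"
      using H(2,3) by (auto simp: parcs_mk_symmetric)
    have "par (fst x) = Some (snd x)" using x(1) H(1) by auto
    then show ?thesis using x(2) by auto
  qed
  obtain j where j: "\<And>i. t (snd (q i)) \<le> t (snd (q j))"
  proof -
    let ?A = "(\<lambda>e. t (snd e)) ` set p"
    have "?A \<noteq> {}" using n3 n_def by auto
    then have "Max ?A \<in> ?A" by (intro Max_in) auto
    then obtain e where e: "e \<in> set p" "t (snd e) = Max ?A" by auto
    then obtain j where "j < n" "p ! j = e" unfolding n_def by (auto simp: in_set_conv_nth)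
    then have "q j = e" by (simp add: q_def)
    moreover have "t (snd (q i)) \<le> Max ?A" for i using q_in by (intro Max_ge) auto
    ultimately show ?thesis using that e by metis
  qed
  \<comment> \<open>q has period n, so the arc before q j is q (j + (n - 1)).\<close>
  have prev: "fst (q j) = snd (q (j + (n - 1)))"
  proof -
    have "Suc (j + (n - 1)) = j + n" using n3 by simp
    then have "q (Suc (j + (n - 1))) = q j" by (simp add: q_def)
    then show ?thesis using q_step[of "j + (n - 1)"] by simp
  qed
  have "par (snd (q j)) = Some (fst (q j))"
    using arc[OF q_in[of j]] t[of "fst (q j)" "snd (q j)"] j[of "j + (n - 1)"] prev by fastforce
  moreover have "par (snd (q j)) = Some (snd (q (Suc j)))"
    using arc[OF q_in[of "Suc j"]] t[of "snd (q (Suc j))" "snd (q j)"] j[of "Suc j"] q_step[of j] by fastforce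
  ultimately have "snd (q (Suc j)) = snd (q (j + (n - 1)))" using prev by simp
  then have "Suc j mod n = (j + (n - 1)) mod n" by (rule q_inj)
  moreover have "j + (n - 1) = Suc j + (n - 2)" using n3 by simp
  ultimately have "(Suc j + (n - 2)) mod n = Suc j mod n" by metis
  then have "n dvd (Suc j + (n - 2)) - Suc j" using mod_eq_dvd_iff_nat[of "Suc j" "Suc j + (n - 2)" n] by simp
  then have "n dvd n - 2" by simp
  then have "n \<le> n - 2" using n3 by (intro dvd_imp_le) auto
  then show False using n3 by simp
qed

lemma oriented_tree_kin:
  fixes t :: "'v \<Rightarrow> real"
  assumes t: "\<And>a b. par a = Some b \<Longrightarrow> t b < t a"
  shows "oriented_tree (kin par v)"
  unfolding oriented_tree_def
proof (intro conjI connected_kin)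
  show "\<forall>(u, w)\<in>arcs (kin par v). (w, u) \<notin> arcs (kin par v)"
  proof (clarsimp simp: arcs_kin)
    fix a b assume "par a = Some b" "par b = Some a"
    then show False using t[of a b] t[of b a] by simp
  qed
  show "no_undirected_cycle (kin par v)"
    by (rule no_undirected_cycle_functional[where par=par and t=t]) (use t in \<open>auto simp: arcs_kin\<close>)
qed

lemma ancestor_of_root:
  assumes "par r = None" "ancestor par n r = Some w"
  shows "w = r"
proof (cases n)
  case (Suc m)
  have "ancestor par (1 + m) r = None" unfolding ancestor_add using assms(1) by simp
  then show ?thesis using assms Suc by simp
qed (use assms in simp)

lemma coalesce_root_iff:
  assumes "par r = None"
  shows "coalesce par u r \<longleftrightarrow> (\<exists>n. ancestor par n u = Some r)"
  unfolding coalesce_def using ancestor_of_root[of par r, OF assms] by (metis ancestor.simps(1))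

lemma oriented_tree_rooted_kin:
  fixes t :: "'v \<Rightarrow> real"
  assumes t: "\<And>a b. par a = Some b \<Longrightarrow> t b < t a" and r: "par r = None"
  shows "oriented_tree_rooted_at (kin par r) r"
  unfolding oriented_tree_rooted_at_def
proof (intro conjI ballI)
  show "oriented_tree (kin par r)" by (rule oriented_tree_kin[OF t])
  show "r \<in> verts (kin par r)" by (simp add: coalesce_refl)
  fix v assume "v \<in> verts (kin par r)"
  then have v: "coalesce par v r" by simp
  then obtain n where "ancestor par n v = Some r" using coalesce_root_iff[of par r v, OF r] by blast
  then show "v \<rightarrow>\<^sup>*\<^bsub>kin par r\<^esub> r" by (rule kin_reaches_ancestor[OF v])
qed

lemma infinite_degree_kin_root:
  assumes r: "par r = None"
  shows "infinite_degree (kin par r) r \<longleftrightarrow> infinite {c. par c = Some r}"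
proof -
  have "in_arcs (kin par r) r \<union> out_arcs (kin par r) r = (\<lambda>c. (c, r)) ` {c. par c = Some r}"
    using r coalesce_parent[of par _ r] by (auto simp: in_arcs_def out_arcs_def arcs_kin)
  then show ?thesis unfolding infinite_degree_def by (simp add: finite_image_iff inj_on_def)
qed

text \<open>
  The component of a root consists of the root and of the descendants of its children.
\<close>

lemma infinite_verts_kin_root_iff:
  assumes r: "par r = None"
    and fin: "\<And>c. par c = Some r \<Longrightarrow> finite (descendants par c)"
  shows "infinite (verts (kin par r)) \<longleftrightarrow> infinite {c. par c = Some r}"
proof -
  have "verts (kin par r) = insert r (\<Union>c\<in>{c. par c = Some r}. descendants par c)"
  proof (intro equalityI subsetI)
    fix u assume "u \<in> verts (kin par r)"
    then obtain n where n: "ancestor par n u = Some r" using coalesce_root_iff[of par r, OF r] by auto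
    show "u \<in> insert r (\<Union>c\<in>{c. par c = Some r}. descendants par c)"
    proof (cases n)
      case (Suc m)
      then obtain c where "ancestor par m u = Some c" "par c = Some r" using n by (auto simp: bind_eq_Some_conv)
      then show ?thesis by (auto simp: descendants_def ancestral_path_def)
    qed (use n in simp)
  next
    fix u assume u: "u \<in> insert r (\<Union>c\<in>{c. par c = Some r}. descendants par c)"
    show "u \<in> verts (kin par r)"
    proof (cases "u = r")
      case False
      then obtain c n where "par c = Some r" "ancestor par n u = Some c"
        using u by (auto simp: descendants_def ancestral_path_def)
      then have "ancestor par (Suc n) u = Some r" by simp
      then show ?thesis using coalesce_root_iff[of par r, OF r] by (auto simp del: ancestor.simps)
    qed (simp add: coalesce_refl)
  qed
  note eq = this
  have "finite {c. par c = Some r}" if f: "finite (verts (kin par r))"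
  proof (rule finite_subset[OF subsetI f])
    fix c assume "c \<in> {c. par c = Some r}"
    then show "c \<in> verts (kin par r)" using coalesce_parent[of par c r] by simp
  qed
  moreover have "finite (verts (kin par r))" if f: "finite {c. par c = Some r}"
  proof -
    have "finite (\<Union>c\<in>{c. par c = Some r}. descendants par c)"
      by (rule finite_UN_I[OF f]) (use fin in simp)
    then show ?thesis unfolding eq by simp
  qed
  ultimately show ?thesis by blast
qed

section \<open>Rerouting to roots\<close>

text \<open>
  The maps p and p' give the parents without and with seeds, S is the set of seeds. The functions
  t and t' exclude cycles.
\<close>

locale rerouting =
  fixes p p' :: "'v \<Rightarrow> 'v option" and S :: "'v set" and t t' :: "'v \<Rightarrow> real"
  assumes p_total: "\<And>v. p v \<noteq> None"
    and p'_None_iff: "\<And>v. p' v = None \<longleftrightarrow> v \<in> S"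
    and p'_cases: "\<And>v w. p' v = Some w \<Longrightarrow> w \<in> S \<or> p v = Some w"
    and eventually_kept: "\<And>v. \<exists>N. \<forall>n\<ge>N. \<forall>w. ancestor p n v = Some w \<longrightarrow> p' w = p w"
    and p_descends: "\<And>a b. p a = Some b \<Longrightarrow> t b < t a"
    and p'_descends: "\<And>a b. p' a = Some b \<Longrightarrow> t' b < t' a"
begin

definition kept :: "'v \<Rightarrow> bool" where "kept v \<longleftrightarrow> (\<forall>n. ancestor p' n v = ancestor p n v)"

lemma ancestor_p_total: "\<exists>w. ancestor p n v = Some w"
proof (induction n)
  case (Suc n)
  then obtain w where "ancestor p n v = Some w" by blast
  then show ?case using p_total[of w] by auto
qed simp

text \<open>
  A path that is rerouted ends at the seed.
\<close>

lemma keptI: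
  assumes "\<And>n. ancestor p' n v \<noteq> None"
  shows "kept v"
  unfolding kept_def
proof
  fix n show "ancestor p' n v = ancestor p n v"
  proof (induction n)
    case (Suc n)
    obtain w where w: "ancestor p' n v = Some w" using assms by blast
    obtain x where x: "p' w = Some x" using assms[of "Suc n"] w by auto
    have "p' x \<noteq> None" using assms[of "Suc (Suc n)"] w x by auto
    then have "x \<notin> S" using p'_None_iff by simp
    then have "p w = Some x" using p'_cases[OF x] by simp
    then show ?case using w x Suc by simp
  qed simp
qed

lemma kept_iff: "kept v \<longleftrightarrow> (\<forall>n. ancestor p' n v \<noteq> None)"
  using keptI ancestor_p_total unfolding kept_def by (metis option.distinct(1))

lemma not_kept_reaches_root:
  assumes "\<not> kept v"
  shows "\<exists>s\<in>S. \<exists>n. ancestor p' n v = Some s"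
proof -
  define n where "n = (LEAST n. ancestor p' n v = None)"
  have ex: "\<exists>n. ancestor p' n v = None" using assms kept_iff[of v] by simp
  have n: "ancestor p' n v = None" unfolding n_def by (rule LeastI_ex[OF ex])
  then obtain m where m: "n = Suc m" by (cases n) auto
  have "ancestor p' m v \<noteq> None" using not_less_Least[of m "\<lambda>n. ancestor p' n v = None"] m n_def by simp
  then obtain s where s: "ancestor p' m v = Some s" by blast
  then have "p' s = None" using n m by simp
  then show ?thesis using s p'_None_iff by blast
qed

lemma kept_ancestor: "kept v \<Longrightarrow> ancestor p n v = Some w \<Longrightarrow> kept w"
  unfolding kept_def using ancestor_add[of p n _ v] ancestor_add[of p' n _ v]
  by (metis Option.bind.bind_lunit)

lemma ex_kept_ancestor: "\<exists>n w. ancestor p n v = Some w \<and> kept w"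
proof -
  obtain N where N: "\<And>n w. n \<ge> N \<Longrightarrow> ancestor p n v = Some w \<Longrightarrow> p' w = p w"
    using eventually_kept by blast
  obtain w where w: "ancestor p N v = Some w" using ancestor_p_total by blast
  have "ancestor p' n w = ancestor p n w" for n
  proof (induction n)
    case (Suc n)
    obtain x where x: "ancestor p n w = Some x" using ancestor_p_total by blast
    have "ancestor p (N + n) v = Some x" by (rule ancestor_trans[OF w x])
    then have "p' x = p x" by (intro N[of "N + n"]) auto
    then show ?case using Suc x by simp
  qed simp
  then show ?thesis using w unfolding kept_def by blast
qed

lemma kept_coalesce:
  assumes "kept g"
  shows "coalesce p' u g \<longleftrightarrow> kept u \<and> coalesce p u g"
proof
  assume "coalesce p' u g"
  then obtain n m w where w: "ancestor p' n u = Some w" "ancestor p' m g = Some w"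
    by (auto simp: coalesce_def)
  have "ancestor p' k u \<noteq> None" for k
  proof (cases "k \<le> n")
    case True
    have "ancestor p' (k + (n - k)) u \<noteq> None" using True w by simp
    then show ?thesis unfolding ancestor_add by (auto simp: bind_eq_None_conv)
  next
    case False
    have "ancestor p' (m + (k - n)) g \<noteq> None" using assms kept_iff[of g] by simp
    then have "ancestor p' (k - n) w \<noteq> None" using w by (simp add: ancestor_add)
    moreover have "ancestor p' (n + (k - n)) u = ancestor p' (k - n) w" using w by (simp add: ancestor_add)
    ultimately show ?thesis using False by simp
  qed
  then have "kept u" by (rule keptI)
  moreover have "coalesce p u g" using w \<open>kept u\<close> assms unfolding kept_def coalesce_def by metis
  ultimately show "kept u \<and> coalesce p u g" by simp
next
  assume "kept u \<and> coalesce p u g"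
  then show "coalesce p' u g" using assms unfolding kept_def coalesce_def by metis
qed

text \<open>
  The part of a component that is not rerouted. All choices of the vertex g give the same graph,
  as two kept vertices of the same component have ancestral paths that meet with and without
  seeds.
\<close>

definition trunk :: "'v graph \<Rightarrow> 'v graph" where
  "trunk C = kin p' (SOME g. g \<in> verts C \<and> kept g)"

lemma trunk_kin:
  obtains g where "trunk (kin p v) = kin p' g" "coalesce p g v" "kept g"
proof -
  obtain n w where w: "ancestor p n v = Some w" "kept w" using ex_kept_ancestor by blast
  have "w \<in> verts (kin p v) \<and> kept w" using coalesce_sym[OF coalesce_ancestor[OF w(1)]] w by simp
  then have "(SOME g. g \<in> verts (kin p v) \<and> kept g) \<in> verts (kin p v) \<and> kept (SOME g. g \<in> verts (kin p v) \<and> kept g)"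
    by (rule someI)
  then show ?thesis using that unfolding trunk_def by simp
qed

lemma verts_trunk: "verts (trunk (kin p v)) = {u. kept u \<and> coalesce p u v}"
proof -
  obtain g where g: "trunk (kin p v) = kin p' g" "coalesce p g v" "kept g" by (rule trunk_kin)
  have "coalesce p u g \<longleftrightarrow> coalesce p u v" for u
    using coalesce_trans[OF _ g(2)] coalesce_trans[OF _ coalesce_sym[OF g(2)]] by blast
  then show ?thesis using kept_coalesce[OF g(3)] g(1) by auto
qed

lemma subgraph_trunk: "subgraph (trunk (kin p v)) (kin p v)"
proof -
  obtain g where g: "trunk (kin p v) = kin p' g" "coalesce p g v" "kept g" by (rule trunk_kin)
  show ?thesis
  proof (intro subgraphI wf_kin)
    show "verts (trunk (kin p v)) \<subseteq> verts (kin p v)" unfolding verts_trunk by auto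
    show "arcs (trunk (kin p v)) \<subseteq> arcs (kin p v)"
    proof (clarsimp simp: g(1) arcs_kin)
      fix a b assume ab: "p' a = Some b" "coalesce p' a g"
      then have "kept a" "coalesce p a g" using kept_coalesce[OF g(3)] by auto
      then have "ancestor p' 1 a = ancestor p 1 a" unfolding kept_def by blast
      then show "p a = Some b \<and> coalesce p a v" using ab(1) coalesce_trans[OF \<open>coalesce p a g\<close> g(2)] by simp
    qed
    show "wf_digraph (trunk (kin p v))" unfolding g(1) by (rule wf_kin)
  qed (simp add: compatible_def g(1))
qed

lemma infinite_trunk: "infinite (verts (trunk (kin p v)))"
proof -
  obtain g where g: "trunk (kin p v) = kin p' g" "coalesce p g v" "kept g" by (rule trunk_kin)
  define f where "f n = the (ancestor p n g)" for n
  have f: "ancestor p n g = Some (f n)" for n using ancestor_p_total[of n g] by (auto simp: f_def)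
  have "t (f (Suc n)) < t (f n)" for n
  proof -
    have "p (f n) = Some (f (Suc n))" using f[of n] f[of "Suc n"] by simp
    then show ?thesis by (rule p_descends)
  qed
  then have "t (f m) < t (f n)" if "n < m" for n m
    using lift_Suc_mono_less[of "\<lambda>n. - t (f n)" n m] that by simp
  then have "f m \<noteq> f n" if "n < m" for n m using that by fastforce
  then have "inj f" by (intro injI) (metis linorder_neqE_nat)
  then have "infinite (range f)" by (rule range_inj_infinite)
  moreover have "range f \<subseteq> verts (trunk (kin p v))"
    unfolding verts_trunk using kept_ancestor[OF g(3) f] coalesce_sym[OF coalesce_ancestor[OF f]]
      coalesce_trans[OF _ g(2)] by blast
  ultimately show ?thesis using finite_subset by blast
qed

text \<open>
  With seeds, the ancestral path of a vertex is either infinite, and then the vertex is kept and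
  lies in the trunk of its component, or it ends at exactly one seed.
\<close>

lemma bij_betw_components:
  assumes s: "inj_on s I" "s ` I = S"
  shows "bij_betw (case_sum trunk (\<lambda>j. component_of (genealogical_graph p') (s j)))
    (components (genealogical_graph p) <+> I) (components (genealogical_graph p'))"
proof -
  have root: "p' (s j) = None" if "j \<in> I" for j using that s p'_None_iff by blast
  have not_kept: "\<not> kept u" if u: "coalesce p' u (s j)" and j: "j \<in> I" for u j
  proof -
    obtain n where "ancestor p' n u = Some (s j)"
      using u coalesce_root_iff[of p' "s j" u, OF root[OF j]] by blast
    then have "ancestor p' (Suc n) u = None" using root[OF j] by simp
    then show ?thesis using kept_iff[of u] by metis
  qed
  show ?thesis
    unfolding bij_betw_def
  proof (intro conjI)
    show "inj_on (case_sum trunk (\<lambda>j. component_of (genealogical_graph p') (s j)))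
        (components (genealogical_graph p) <+> I)"
    proof (rule inj_onI)
      fix x y
      assume x: "x \<in> components (genealogical_graph p) <+> I" and y: "y \<in> components (genealogical_graph p) <+> I"
        and eq: "case_sum trunk (\<lambda>j. component_of (genealogical_graph p') (s j)) x
          = case_sum trunk (\<lambda>j. component_of (genealogical_graph p') (s j)) y"
      have clash: False if h: "trunk (kin p v) = kin p' (s j)" "j \<in> I" for v j
      proof -
        have "s j \<in> verts (trunk (kin p v))" using h coalesce_refl[of p' "s j"] by simp
        then have "kept (s j)" unfolding verts_trunk by simp
        then show False using not_kept[OF coalesce_refl h(2)] by simp
      qed
      consider (1) u v where "x = Inl (kin p u)" "y = Inl (kin p v)"
        | (2) u j where "x = Inl (kin p u)" "y = Inr j" "j \<in> I"
        | (3) u j where "y = Inl (kin p u)" "x = Inr j" "j \<in> I"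
        | (4) i j where "x = Inr i" "y = Inr j" "i \<in> I" "j \<in> I"
        using x y unfolding components_genealogical by blast
      then show "x = y"
      proof cases
        case 1
        obtain g where g: "trunk (kin p u) = kin p' g" "coalesce p g u" "kept g" by (rule trunk_kin)
        have "trunk (kin p v) = kin p' g" using eq 1 g(1) by simp
        then have "g \<in> verts (trunk (kin p v))" by (simp add: coalesce_refl)
        then have "coalesce p g v" unfolding verts_trunk by simp
        then have "coalesce p u v" using coalesce_trans[OF coalesce_sym[OF g(2)]] by blast
        then have "kin p u = kin p v" by (simp only: kin_eq_iff)
        then show ?thesis using 1 by simp
      next
        case 2
        then show ?thesis using eq clash[of u j] by (simp add: component_of_genealogical)
      next
        case 3
        then show ?thesis using eq clash[of u j] by (simp add: component_of_genealogical)
      next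
        case 4
        then have "coalesce p' (s i) (s j)" using eq by (simp add: component_of_genealogical kin_eq_iff)
        then obtain n where "ancestor p' n (s i) = Some (s j)" using coalesce_root_iff[of p' "s j" "s i", OF root[OF 4(4)]] by blast
        then have "s j = s i" by (rule ancestor_of_root[of p' "s i" n "s j", OF root[OF 4(3)]])
        then show ?thesis using 4 s(1) by (auto dest: inj_onD)
      qed
    qed
    show "case_sum trunk (\<lambda>j. component_of (genealogical_graph p') (s j)) `
        (components (genealogical_graph p) <+> I) = components (genealogical_graph p')" (is "?L = ?R")
    proof (intro equalityI subsetI)
      fix C assume "C \<in> ?L"
      then obtain x where x: "x \<in> range (kin p) <+> I"
        "C = case_sum trunk (\<lambda>j. kin p' (s j)) x"
        unfolding components_genealogical component_of_genealogical by blast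
      have "(\<exists>v. C = trunk (kin p v)) \<or> (\<exists>j\<in>I. C = kin p' (s j))"
        using x by (cases x) auto
      then consider v where "C = trunk (kin p v)" | j where "j \<in> I" "C = kin p' (s j)" by blast
      then show "C \<in> ?R"
      proof cases
        case 1
        then show ?thesis unfolding components_genealogical using trunk_kin[of v] by (metis rangeI)
      qed (simp add: components_genealogical)
    next
      fix C assume "C \<in> ?R"
      then obtain v where C: "C = kin p' v" unfolding components_genealogical by auto
      show "C \<in> ?L"
      proof (cases "kept v")
        case True
        obtain g where g: "trunk (kin p v) = kin p' g" "coalesce p g v" "kept g" by (rule trunk_kin)
        have "coalesce p' v g" using kept_coalesce[OF g(3)] True coalesce_sym[OF g(2)] by simp
        then have "C = trunk (kin p v)" using C g(1) kin_eq_iff by metis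
        then show ?thesis unfolding components_genealogical by (intro image_eqI[of _ _ "Inl (kin p v)"]) auto
      next
        case False
        then obtain x n where x: "x \<in> S" "ancestor p' n v = Some x" using not_kept_reaches_root by blast
        then obtain j where j: "j \<in> I" "x = s j" using s by blast
        have "coalesce p' v (s j)" using coalesce_ancestor[OF x(2)] j by simp
        then have "C = kin p' (s j)" using C kin_eq_iff by metis
        then show ?thesis using j by (intro image_eqI[of _ _ "Inr j"]) (auto simp: component_of_genealogical)
      qed
    qed
  qed
qed

lemma oriented_tree_trunk: "oriented_tree (trunk (kin p v))"
proof -
  obtain g where g: "trunk (kin p v) = kin p' g" by (rule trunk_kin)
  show ?thesis unfolding g by (rule oriented_tree_kin[OF p'_descends])
qed

lemma has_direction_trunk:
  assumes "has_direction T rt p (kin p v) \<xi>"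
  shows "has_direction T rt p' (trunk (kin p v)) \<xi>"
proof -
  have "ancestral_path p' u = ancestral_path p u" "\<forall>n. ancestor p' n u \<noteq> None" if "kept u" for u
    using that kept_iff[of u] unfolding kept_def ancestral_path_def by auto
  then show ?thesis using assms unfolding has_direction_def verts_trunk by auto
qed

lemma descendants_le:
  assumes "v \<notin> S"
  shows "descendants p' v \<subseteq> descendants p v"
proof
  fix w assume "w \<in> descendants p' v"
  then obtain n where n: "ancestor p' n w = Some v" by (auto simp: descendants_def ancestral_path_def)
  have "ancestor p n w = Some v"
    using n assms
  proof (induction n arbitrary: v)
    case (Suc n)
    then obtain a where a: "ancestor p' n w = Some a" "p' a = Some v" by (auto simp: bind_eq_Some_conv)
    have "a \<notin> S" using a(2) p'_None_iff by force
    then have "ancestor p n w = Some a" using Suc.IH a(1) by blast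
    moreover have "p a = Some v" using p'_cases[OF a(2)] Suc.prems(2) by simp
    ultimately show ?case by simp
  qed simp
  then show "w \<in> descendants p v" by (auto simp: descendants_def ancestral_path_def)
qed

end

section \<open>Directions of paths with short jumps\<close>

context tree_metric begin

text \<open>
  If d(w_n, w_(n+1)) < d(w_n, x), then x does not lie between these two vertices. So for each x,
  the neighbor e(x) of x in the direction of w_n is the same for all large n. The ray iterates e,
  starting from the root.
\<close>

lemma ray_of_short_jumps:
  fixes w :: "nat \<Rightarrow> 'v"
  assumes short: "\<And>x. \<exists>N. \<forall>n\<ge>N. d (w n) (w (Suc n)) < d (w n) x"
  shows "\<exists>\<xi>. \<xi> 0 = rt \<and> (\<forall>i. d (\<xi> i) (\<xi> (Suc i)) = 1) \<and> (\<forall>i. \<xi> (Suc (Suc i)) \<noteq> \<xi> i)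
    \<and> (\<forall>i. \<exists>N. \<forall>n\<ge>N. btw rt (\<xi> i) (w n))"
proof -
  have "\<exists>e. \<exists>N. \<forall>n\<ge>N. w n \<noteq> x \<and> nxt x (w n) = e" for x
  proof -
    obtain N where N: "\<And>n. n \<ge> N \<Longrightarrow> d (w n) (w (Suc n)) < d (w n) x" using short by blast
    have ne: "w n \<noteq> x" if "n \<ge> N" for n using N[OF that] by auto
    have "nxt x (w n) = nxt x (w N)" if "n \<ge> N" for n
      using that
    proof (induction n rule: dec_induct)
      case (step n)
      have "\<not> btw (w n) x (w (Suc n))" using N[of n] step.hyps unfolding btw_def by simp
      then have "nxt x (w n) = nxt x (w (Suc n))"
        using btw_of_nxt_neq[of "w n" x "w (Suc n)"] ne[of n] ne[of "Suc n"] step.hyps by fastforce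
      then show ?case using step.IH by simp
    qed simp
    then show ?thesis using ne by blast
  qed
  then obtain e where e: "\<And>x. \<exists>N. \<forall>n\<ge>N. w n \<noteq> x \<and> nxt x (w n) = e x" by metis
  have e1: "d x (e x) = 1" and e2: "\<exists>N. \<forall>n\<ge>N. d x (w n) = Suc (d (e x) (w n))" for x
  proof -
    obtain N where N: "\<And>n. n \<ge> N \<Longrightarrow> w n \<noteq> x \<and> nxt x (w n) = e x" using e by blast
    show "d x (e x) = 1" using N[of N] nxt(1)[of "w N" x] by auto
    show "\<exists>N. \<forall>n\<ge>N. d x (w n) = Suc (d (e x) (w n))" using N nxt(2) by metis
  qed
  define \<xi> where "\<xi> i = (e ^^ i) rt" for i
  have \<xi>: "\<xi> 0 = rt" "\<xi> (Suc i) = e (\<xi> i)" for i by (simp_all add: \<xi>_def)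
  have far: "\<exists>N. \<forall>n\<ge>N. d rt (w n) = i + d (\<xi> i) (w n)" for i
  proof (induction i)
    case 0
    then show ?case using \<xi>(1) by simp
  next
    case (Suc i)
    then obtain N1 where "\<And>n. n \<ge> N1 \<Longrightarrow> d rt (w n) = i + d (\<xi> i) (w n)" by blast
    moreover obtain N2 where "\<And>n. n \<ge> N2 \<Longrightarrow> d (\<xi> i) (w n) = Suc (d (\<xi> (Suc i)) (w n))"
      using e2[of "\<xi> i"] \<xi>(2) by auto
    ultimately have "\<forall>n\<ge>max N1 N2. d rt (w n) = Suc i + d (\<xi> (Suc i)) (w n)" by simp
    then show ?case by blast
  qed
  have le: "d rt (\<xi> i) \<le> i" for i
  proof (induction i)
    case 0
    show ?case using \<xi>(1) by simp
  next
    case (Suc i)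
    then show ?case using dist_triangle[of rt "\<xi> (Suc i)" "\<xi> i"] e1[of "\<xi> i"] \<xi>(2)[of i] by simp
  qed
  have "\<exists>N. \<forall>n\<ge>N. btw rt (\<xi> i) (w n)" for i
  proof -
    obtain N where N: "\<And>n. n \<ge> N \<Longrightarrow> d rt (w n) = i + d (\<xi> i) (w n)" using far by blast
    have "btw rt (\<xi> i) (w n)" if "n \<ge> N" for n
      using N[OF that] le[of i] dist_triangle[of rt "w n" "\<xi> i"] unfolding btw_def by simp
    then show ?thesis by blast
  qed
  moreover have "\<xi> (Suc (Suc i)) \<noteq> \<xi> i" for i
  proof
    assume eq: "\<xi> (Suc (Suc i)) = \<xi> i"
    obtain N1 where N1: "\<And>n. n \<ge> N1 \<Longrightarrow> d (\<xi> i) (w n) = Suc (d (\<xi> (Suc i)) (w n))"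
      using e2[of "\<xi> i"] \<xi>(2) by auto
    obtain N2 where N2: "\<And>n. n \<ge> N2 \<Longrightarrow> d (\<xi> (Suc i)) (w n) = Suc (d (\<xi> (Suc (Suc i))) (w n))"
      using e2[of "\<xi> (Suc i)"] \<xi>(2) by auto
    show False using N1[of "max N1 N2"] N2[of "max N1 N2"] eq by simp
  qed
  ultimately show ?thesis using \<xi> e1 by (intro exI[of _ \<xi>]) simp
qed

end

section \<open>The graph distance of a regular tree\<close>

lemma pcas_zip:
  "xs \<noteq> [] \<Longrightarrow> pcas (hd xs) (zip xs (tl xs @ [y])) y"
proof (induction xs)
  case (Cons x xs)
  then show ?case by (cases xs) auto
qed simp

lemma zip_tl_in:
  assumes "successively (\<lambda>a b. (a, b) \<in> R) xs" "(last xs, y) \<in> R" "xs \<noteq> []"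
  shows "set (zip xs (tl xs @ [y])) \<subseteq> R"
  using assms
proof (induction xs)
  case (Cons x xs)
  then show ?case by (cases xs) (auto simp: successively_Cons)
qed simp

context
  fixes T :: "'v pair_pre_digraph" and K :: nat
  assumes T: "regular_tree (K + 1) T"
begin

lemma bidirected: "pair_bidirected_digraph T" using T by (simp add: regular_tree_def)

lemma pverts_UNIV: "pverts T = UNIV" using T by (simp add: regular_tree_def)

lemma parcs_sym: "(u, v) \<in> parcs T \<Longrightarrow> (v, u) \<in> parcs T"
proof -
  interpret pair_bidirected_digraph T by (rule bidirected)
  assume "(u, v) \<in> parcs T"
  then show "(v, u) \<in> parcs T" using pair_sym_arcs unfolding symmetric_def by (auto dest: symD)
qed

lemma parcs_irrefl: "(u, u) \<notin> parcs T"
proof -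
  interpret pair_bidirected_digraph T by (rule bidirected)
  show ?thesis using pair_no_loops[of "(u, u)"] by auto
qed

lemma awalk_relpow: "(\<exists>p. pre_digraph.awalk (with_proj T) u p v \<and> length p = n) \<longleftrightarrow> (u, v) \<in> parcs T ^^ n"
proof (induction n arbitrary: u)
  case 0
  show ?case by (auto simp: pre_digraph.awalk_def pre_digraph.cas.simps pverts_UNIV)
next
  case (Suc n)
  have "(\<exists>p. pre_digraph.awalk (with_proj T) u p v \<and> length p = Suc n)
      \<longleftrightarrow> (\<exists>x p. (u, x) \<in> parcs T \<and> pre_digraph.awalk (with_proj T) x p v \<and> length p = n)"
  proof (intro iffI; elim exE conjE)
    fix p assume p: "pre_digraph.awalk (with_proj T) u p v" "length p = Suc n"
    then obtain e es where "p = e # es" by (cases p) auto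
    then show "\<exists>x p. (u, x) \<in> parcs T \<and> pre_digraph.awalk (with_proj T) x p v \<and> length p = n"
      using p by (intro exI[of _ "snd e"] exI[of _ es])
        (auto simp: pre_digraph.awalk_def cas_with_proj_eq pverts_UNIV)
  next
    fix x p assume "(u, x) \<in> parcs T" "pre_digraph.awalk (with_proj T) x p v" "length p = n"
    then show "\<exists>p. pre_digraph.awalk (with_proj T) u p v \<and> length p = Suc n"
      by (intro exI[of _ "(u, x) # p"])
        (auto simp: pre_digraph.awalk_def cas_with_proj_eq pverts_UNIV)
  qed
  also have "\<dots> \<longleftrightarrow> (u, v) \<in> parcs T ^^ Suc n"
    using Suc.IH by (metis relpow_Suc_D2 relpow_Suc_I2)
  finally show ?case .
qed

lemma gdist_relpow: "gdist T u v = (LEAST n. (u, v) \<in> parcs T ^^ n)"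
  unfolding gdist_def awalk_relpow ..

lemma ex_relpow: "\<exists>n. (u, v) \<in> parcs T ^^ n"
proof -
  have "Digraph_Component.connected (with_proj T)" using T by (simp add: regular_tree_def)
  then have "u \<rightarrow>\<^sup>*\<^bsub>with_proj (mk_symmetric (with_proj T))\<^esub> v"
    unfolding connected_def strongly_connected_def by (simp add: pverts_UNIV)
  then have "(u, v) \<in> (parcs (mk_symmetric (with_proj T)))\<^sup>*"
    using reachable_rtranclI by fastforce
  also have "parcs (mk_symmetric (with_proj T)) = parcs T"
    using parcs_sym by (auto simp: parcs_mk_symmetric)
  finally show ?thesis by (rule rtrancl_imp_relpow)
qed

lemma relpow_gdist: "(u, v) \<in> parcs T ^^ gdist T u v"
  unfolding gdist_relpow by (rule LeastI_ex[OF ex_relpow])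

lemma gdist_le: "(u, v) \<in> parcs T ^^ n \<Longrightarrow> gdist T u v \<le> n"
  unfolding gdist_relpow by (rule Least_le)

lemma gdist_0: "gdist T u v = 0 \<longleftrightarrow> u = v"
  using relpow_gdist[of u v] gdist_le[of u v 0] by auto

lemma relpow_sym: "(u, v) \<in> parcs T ^^ n \<Longrightarrow> (v, u) \<in> parcs T ^^ n"
proof (induction n arbitrary: v)
  case (Suc n)
  then obtain w where "(u, w) \<in> parcs T ^^ n" "(w, v) \<in> parcs T" by auto
  then show ?case using Suc.IH parcs_sym by (meson relpow_Suc_I2)
qed simp

lemma gdist_sym: "gdist T u v = gdist T v u"
  using gdist_le[OF relpow_sym[OF relpow_gdist]] by (simp add: le_antisym)

lemma gdist_triangle: "gdist T u v \<le> gdist T u w + gdist T w v"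
  using relpow_gdist[of u w] relpow_gdist[of w v] by (intro gdist_le) (auto simp: relpow_add)

lemma gdist_1: "gdist T u v = 1 \<longleftrightarrow> (u, v) \<in> parcs T"
proof
  assume "gdist T u v = 1"
  then show "(u, v) \<in> parcs T" using relpow_gdist[of u v] by simp
next
  assume uv: "(u, v) \<in> parcs T"
  then have "gdist T u v \<le> 1" by (intro gdist_le) simp
  moreover have "u \<noteq> v" using uv parcs_irrefl by auto
  ultimately show "gdist T u v = 1" using gdist_0[of u v] by linarith
qed

lemma ex_closer: "v \<noteq> x \<Longrightarrow> \<exists>n. (x, n) \<in> parcs T \<and> Suc (gdist T n v) = gdist T x v"
proof -
  assume "v \<noteq> x"
  then obtain k where k: "gdist T x v = Suc k" using gdist_0[of x v] by (cases "gdist T x v") auto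
  then have "(x, v) \<in> parcs T ^^ Suc k" using relpow_gdist[of x v] by simp
  then obtain n where n: "(x, n) \<in> parcs T" "(n, v) \<in> parcs T ^^ k" by (meson relpow_Suc_D2)
  then have "gdist T n v \<le> k" using gdist_le by blast
  moreover have "gdist T x n = 1" using n(1) by (simp only: gdist_1)
  then have "gdist T x v \<le> 1 + gdist T n v" using gdist_triangle[of x v n] by simp
  ultimately show ?thesis using n k by (intro exI[of _ n]) simp
qed

lemma no_cycle:
  assumes "successively (\<lambda>a b. (a, b) \<in> parcs T) xs" "(last xs, hd xs) \<in> parcs T" "distinct xs" "3 \<le> length xs"
  shows False
proof -
  let ?p = "zip xs (tl xs @ [hd xs])"
  have ne: "xs \<noteq> []" using assms by auto
  have len: "length ?p = length xs" using ne by simp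
  have cas: "pcas (hd xs) ?p (hd xs)" by (rule pcas_zip[OF ne])
  have "map snd ?p = tl xs @ [hd xs]" using ne by simp
  then have tl: "tl (pawalk_verts (hd xs) ?p) = tl xs @ [hd xs]" using cycle_arcs(3)[OF cas] by simp
  have "distinct (tl xs @ [hd xs])" using assms(3) ne by (cases xs) auto
  moreover have "set ?p \<subseteq> parcs (mk_symmetric (with_proj T))"
    using zip_tl_in[OF assms(1,2) ne] by (fastforce simp: parcs_mk_symmetric)
  ultimately have "pre_digraph.cycle (with_proj (mk_symmetric (with_proj T))) ?p"
    unfolding pre_digraph.cycle_def pre_digraph.awalk_def awalk_verts_with_proj_eq cas_with_proj_eq
    using cas tl len assms(4) by (auto simp: pverts_UNIV intro!: exI[of _ "hd xs"])
  moreover have "no_undirected_cycle (with_proj T)" using T by (simp add: regular_tree_def)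
  ultimately show False unfolding no_undirected_cycle_def using len assms(4) by metis
qed

text \<open>
  Follow the geodesics to v from both vertices until they meet.
\<close>

lemma bridge:
  assumes "gdist T a v = k" "gdist T b v = k" "a \<noteq> b"
  shows "\<exists>L. successively (\<lambda>a b. (a, b) \<in> parcs T) (a # L @ [b]) \<and> distinct (a # L @ [b]) \<and> L \<noteq> []
    \<and> (\<forall>u\<in>set L. gdist T u v < k)"
  using assms
proof (induction k arbitrary: a b)
  case 0
  then show ?case using gdist_0 by auto
next
  case (Suc k)
  have "v \<noteq> a" "v \<noteq> b" using Suc.prems gdist_0[of a v] gdist_0[of b v] by auto
  then obtain a' b' where a': "(a, a') \<in> parcs T" "gdist T a' v = k" and b': "(b, b') \<in> parcs T" "gdist T b' v = k"
    using ex_closer[of v a] ex_closer[of v b] Suc.prems by auto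
  show ?case
  proof (cases "a' = b'")
    case True
    then show ?thesis using Suc.prems a' b' parcs_sym by (intro exI[of _ "[a']"]) auto
  next
    case False
    from Suc.IH[OF a'(2) b'(2) False] obtain L where
      L: "successively (\<lambda>a b. (a, b) \<in> parcs T) (a' # L @ [b'])" "distinct (a' # L @ [b'])"
        "\<forall>u\<in>set L. gdist T u v < k" "L \<noteq> []" by blast
    have "successively (\<lambda>a b. (a, b) \<in> parcs T) (a # (a' # L @ [b']) @ [b])"
      using L(1,4) a'(1) parcs_sym[OF b'(1)] by (simp add: successively_append_iff successively_Cons)
    moreover have "a \<notin> set (a' # L @ [b'])" "b \<notin> set (a' # L @ [b'])"
      using L(3) a'(2) b'(2) Suc.prems by force+
    ultimately show ?thesis
      using L(2,3) a'(2) b'(2) Suc.prems(3) by (intro exI[of _ "a' # L @ [b']"]) auto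
  qed
qed

text \<open>
  A second neighbor of x closer to v, or one at the same distance from v, could be joined to a
  bridge to form a cycle.
\<close>

lemma tree_metric_gdist:
  assumes "2 \<le> K"
  shows "tree_metric (gdist T) K"
proof
  show "2 \<le> K" by fact
  fix x y w v n
  show "gdist T x y = 0 \<longleftrightarrow> x = y" by (rule gdist_0)
  show "gdist T x y = gdist T y x" by (rule gdist_sym)
  show "gdist T x y \<le> gdist T x w + gdist T w y" by (rule gdist_triangle)
  show "card {y. gdist T x y = 1} = Suc K"
  proof -
    have "out_arcs (with_proj T) x = (\<lambda>y. (x, y)) ` {y. gdist T x y = 1}"
      unfolding gdist_1 by (auto simp: out_arcs_def)
    moreover have "card (out_arcs (with_proj T) x) = K + 1"
      using T by (simp add: regular_tree_def out_degree_def)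
    ultimately show ?thesis by (simp add: card_image inj_on_def)
  qed
  show "gdist T n v \<noteq> gdist T x v" if n: "gdist T x n = 1"
  proof
    assume eq: "gdist T n v = gdist T x v"
    have arc: "(x, n) \<in> parcs T" using n gdist_1 by simp
    then have "x \<noteq> n" using parcs_irrefl by auto
    then obtain L where L: "successively (\<lambda>a b. (a, b) \<in> parcs T) (x # L @ [n])" "distinct (x # L @ [n])" "L \<noteq> []"
      using bridge[of x v "gdist T x v" n] eq by blast
    show False using no_cycle[OF L(1)] L(2,3) parcs_sym[OF arc] by (cases L) auto
  qed
  show "\<exists>!n. gdist T x n = 1 \<and> gdist T n v < gdist T x v" if vx: "v \<noteq> x"
  proof -
    obtain a where a: "(x, a) \<in> parcs T" "Suc (gdist T a v) = gdist T x v" using ex_closer[OF vx] by blast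
    have "b = a" if b: "gdist T x b = 1" "gdist T b v < gdist T x v" for b
    proof (rule ccontr)
      assume "b \<noteq> a"
      have arc: "(x, b) \<in> parcs T" using b gdist_1 by simp
      have "gdist T x v \<le> 1 + gdist T b v" using gdist_triangle[of x v b] b by simp
      then have "gdist T b v = gdist T a v" using b a by simp
      then obtain L where L: "successively (\<lambda>a b. (a, b) \<in> parcs T) (a # L @ [b])" "distinct (a # L @ [b])" "L \<noteq> []"
          "\<forall>u\<in>set L. gdist T u v < gdist T a v"
        using bridge[of a v "gdist T a v" b] \<open>b \<noteq> a\<close> by blast
      have "x \<notin> set (a # L @ [b])" using L(4) a b by force
      then have "distinct (x # a # L @ [b])" using L(2) by simp
      moreover have "successively (\<lambda>a b. (a, b) \<in> parcs T) (x # a # L @ [b])" using L(1) a(1) by simp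
      ultimately show False using no_cycle[of "x # a # L @ [b]"] parcs_sym[OF arc] by simp
    qed
    moreover have "gdist T x a = 1 \<and> gdist T a v < gdist T x v"
      using a(2) gdist_1[of x a] a(1) by simp
    ultimately show ?thesis by (intro ex1I[of _ a]) blast+
  qed
qed

lemma subtree_atI:
  assumes "gdist T rt w = gdist T rt x + gdist T x w"
  shows "w \<in> subtree_at T rt x"
proof -
  interpret pair_bidirected_digraph T by (rule bidirected)
  obtain p where p: "awalk rt p x" "length p = gdist T rt x" using relpow_gdist awalk_relpow by blast
  obtain q where q: "awalk x q w" "length q = gdist T x w" using relpow_gdist awalk_relpow by blast
  have pq: "awalk rt (p @ q) w" using p(1) q(1) by (rule awalk_appendI)
  have x: "x \<in> set (pawalk_verts rt (p @ q))"
  proof -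
    have "last (pawalk_verts rt p) = x" using p(1) by (rule awlast_of_awalk) (simp add: NOMATCH_def)
    moreover have "pawalk_verts rt p \<noteq> []" by (cases p) auto
    ultimately have "x \<in> set (pawalk_verts rt p)" using last_in_set by metis
    then show ?thesis using awalk_verts_append[OF pq] by (metis UnCI set_append)
  qed
  then show ?thesis
    unfolding subtree_at_def awalk_verts_with_proj_eq
  proof (intro CollectI exI conjI)
    show "awalk rt (p @ q) w" by (rule pq)
    show "length (p @ q) = gdist T rt w" using p(2) q(2) assms by simp
  qed (rule x)
qed

lemma has_direction_kin:
  assumes K: "2 \<le> K"
    and total: "\<And>v. par v \<noteq> None"
    and short: "\<And>v x. \<exists>N. \<forall>n\<ge>N. \<forall>w y. ancestor par n v = Some w \<longrightarrow> par w = Some y \<longrightarrow> gdist T w y < gdist T w x"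
  shows "\<exists>\<xi>. has_direction T rt par (kin par v) \<xi>"
proof -
  interpret tree_metric "gdist T" K by (rule tree_metric_gdist[OF K])
  have ex: "\<exists>w. ancestor par n u = Some w" for n u
  proof (induction n)
    case (Suc n)
    then obtain w where "ancestor par n u = Some w" by blast
    then show ?case using total[of w] by auto
  qed simp
  define w where "w n = the (ancestor par n v)" for n
  have w: "ancestor par n v = Some (w n)" for n using ex[of n v] by (auto simp: w_def)
  have step: "par (w n) = Some (w (Suc n))" for n using w[of n] w[of "Suc n"] by simp
  have "\<exists>N. \<forall>n\<ge>N. gdist T (w n) (w (Suc n)) < gdist T (w n) x" for x
    using short[of v x] w step by blast
  from ray_of_short_jumps[OF this, of rt] obtain \<xi> where \<xi>: "\<xi> 0 = rt" "\<And>i. gdist T (\<xi> i) (\<xi> (Suc i)) = 1"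
      "\<And>i. \<xi> (Suc (Suc i)) \<noteq> \<xi> i" "\<And>i. \<exists>N. \<forall>n\<ge>N. btw rt (\<xi> i) (w n)"
    by blast
  have "finite (ancestral_path par u - subtree_at T rt (\<xi> i))" if u: "coalesce par u v" for u i
  proof -
    obtain n m x where x: "ancestor par n u = Some x" "ancestor par m v = Some x"
      using u by (auto simp: coalesce_def)
    obtain N where N: "\<And>n. n \<ge> N \<Longrightarrow> btw rt (\<xi> i) (w n)" using \<xi>(4) by blast
    have tail: "ancestor par (n + k) u = Some (w (m + k))" for k
      using w[of "m + k"] x by (simp add: ancestor_add)
    have "ancestral_path par u - subtree_at T rt (\<xi> i) \<subseteq> (\<lambda>j. the (ancestor par j u)) ` {..<n + N}"
    proof
      fix y assume y: "y \<in> ancestral_path par u - subtree_at T rt (\<xi> i)"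
      then obtain j where j: "ancestor par j u = Some y" by (auto simp: ancestral_path_def)
      have "j < n + N"
      proof (rule ccontr)
        assume "\<not> j < n + N"
        then have nj: "N \<le> m + (j - n)" "n + (j - n) = j" by auto
        then have "y = w (m + (j - n))" using tail[of "j - n"] j by simp
        then have "btw rt (\<xi> i) y" using N[OF nj(1)] by simp
        then have "y \<in> subtree_at T rt (\<xi> i)" unfolding btw_def by (rule subtree_atI)
        then show False using y by simp
      qed
      then show "y \<in> (\<lambda>j. the (ancestor par j u)) ` {..<n + N}" using j by (intro image_eqI[of _ _ j]) auto
    qed
    then show ?thesis by (rule finite_subset) simp
  qed
  moreover have "\<xi> \<in> rays T rt" using \<xi> gdist_1 by (simp add: rays_def)
  moreover have "ancestor par n u \<noteq> None" for n u using ex[of n u] by auto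
  ultimately show ?thesis unfolding has_direction_def by (intro exI[of _ \<xi>]) auto
qed

end

section \<open>The distribution function of an atomless law\<close>

lemma real_distribution_unif: "real_distribution unif"
proof -
  interpret prob_space unif by (rule prob_space_unif)
  show ?thesis by unfold_locales simp_all
qed

lemma cdf_unif: "cdf unif y = max 0 (min 1 y)"
proof -
  have "emeasure unif {..y} = ennreal (max 0 (min 1 y))"
  proof (cases "y < 0")
    case True
    then have "{0..1} \<inter> {..y} = {}" by auto
    then show ?thesis using True
      unfolding unif_def by (subst emeasure_uniform_measure) (auto simp: divide_ennreal_def)
  next
    case False
    then have "{0..1} \<inter> {..y} = {0..min 1 y}" by auto
    then show ?thesis using False
      unfolding unif_def by (subst emeasure_uniform_measure) (auto simp: divide_ennreal_def min_def)
  qed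
  then show ?thesis unfolding cdf_def measure_def by (metis enn2real_ennreal max.cobounded1)
qed

text \<open>
  By continuity the distribution function attains every y in (0, 1), and then it is at most y with
  probability y.
\<close>

lemma distr_cdf_uniform:
  assumes \<nu>: "prob_space \<nu>" "sets \<nu> = sets borel" and atomless: "\<And>x. emeasure \<nu> {x} = 0"
  shows "distr \<nu> borel (cdf \<nu>) = unif"
proof -
  interpret real_distribution \<nu>
    using \<nu> by (simp add: real_distribution_def real_distribution_axioms_def)
  have cont: "isCont (cdf \<nu>) x" for x
    using atomless[of x] isCont_cdf[of x] by (simp add: measure_def)
  have mono: "mono (cdf \<nu>)" using cdf_nondecreasing by (auto simp: mono_def)
  have meas [measurable]: "cdf \<nu> \<in> borel_measurable borel" by (rule borel_measurable_mono[OF mono])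
  have meas': "cdf \<nu> \<in> borel_measurable \<nu>" using meas by simp
  have ivt: "\<exists>x. cdf \<nu> x = y" if y: "0 < y" "y < 1" for y
  proof -
    have "eventually (\<lambda>x. cdf \<nu> x < y) at_bot" using order_tendstoD(2)[OF cdf_lim_at_bot y(1)] .
    then obtain a where a: "cdf \<nu> a < y" by (metis eventually_happens trivial_limit_at_bot_linorder)
    have "eventually (\<lambda>x. y < cdf \<nu> x) at_top" using order_tendstoD(1)[OF cdf_lim_at_top_prob y(2)] .
    then obtain b where b: "y < cdf \<nu> b" by (metis eventually_happens trivial_limit_at_top_linorder)
    have "a \<le> b" using a b cdf_nondecreasing[of b a] by linarith
    then show ?thesis using IVT[of "cdf \<nu>" a y b] a b cont by force
  qed
  have D: "real_distribution (distr \<nu> borel (cdf \<nu>))" by (rule real_distribution_distr) simp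
  have eq: "cdf (distr \<nu> borel (cdf \<nu>)) y = measure \<nu> {x. cdf \<nu> x \<le> y}" for y
    unfolding cdf_def[of "distr \<nu> borel (cdf \<nu>)"] by (subst measure_distr[OF meas']) (auto simp: vimage_def)
  have "cdf (distr \<nu> borel (cdf \<nu>)) y = max 0 (min 1 y)" for y
  proof -
    have set: "{x. cdf \<nu> x \<le> y} \<in> sets \<nu>" by simp
    consider "y < 0" | "1 \<le> y" | "0 \<le> y" "y < 1" by linarith
    then show ?thesis
    proof cases
      case 1
      then have "{x. cdf \<nu> x \<le> y} = {}" using cdf_nonneg by (auto simp: not_le intro: less_le_trans)
      then show ?thesis using 1 by (simp add: eq)
    next
      case 2
      then have "{x. cdf \<nu> x \<le> y} = UNIV" using cdf_bounded_prob order_trans by blast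
      then show ?thesis using 2 prob_space by (simp add: eq)
    next
      case 3
      have "measure \<nu> {x. cdf \<nu> x \<le> y} \<le> y"
      proof (rule dense_ge_bounded[OF 3(2)])
        fix y' assume y': "y < y'" "y' < 1"
        then obtain x1 where x1: "cdf \<nu> x1 = y'" using ivt[of y'] 3 by auto
        have "{x. cdf \<nu> x \<le> y} \<subseteq> {..x1}"
        proof
          fix x assume "x \<in> {x. cdf \<nu> x \<le> y}"
          then show "x \<in> {..x1}" using cdf_nondecreasing[of x1 x] x1 y' by force
        qed
        then have "measure \<nu> {x. cdf \<nu> x \<le> y} \<le> measure \<nu> {..x1}"
          by (intro finite_measure_mono) auto
        then show "measure \<nu> {x. cdf \<nu> x \<le> y} \<le> y'" using x1 by (simp add: cdf_def)
      qed
      moreover have "y \<le> measure \<nu> {x. cdf \<nu> x \<le> y}"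
      proof (cases "y = 0")
        case False
        then obtain x0 where x0: "cdf \<nu> x0 = y" using ivt[of y] 3 by auto
        have "{..x0} \<subseteq> {x. cdf \<nu> x \<le> y}" using cdf_nondecreasing x0 by auto
        then have "measure \<nu> {..x0} \<le> measure \<nu> {x. cdf \<nu> x \<le> y}"
          by (intro finite_measure_mono set)
        then show ?thesis using x0 by (simp add: cdf_def)
      qed simp
      ultimately show ?thesis using 3 by (simp add: eq)
    qed
  qed
  then have "cdf (distr \<nu> borel (cdf \<nu>)) = cdf unif" by (simp add: fun_eq_iff cdf_unif)
  then show ?thesis by (rule cdf_unique[OF D real_distribution_unif])
qed

section \<open>The parent map with seeds\<close>

lemma (in tree_metric) sets_Collect_ex_vertex:
  "(\<And>u :: 'v. {\<omega> \<in> space P. Q u \<omega>} \<in> sets P) \<Longrightarrow> {\<omega> \<in> space P. \<exists>u. Q u \<omega>} \<in> sets P"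
  using sets.sets_Collect_countable_Ex'[of UNIV P Q] countable_UNIV by simp

lemma parent_Some_iff:
  "parent t \<zeta> v = Some w \<longleftrightarrow> (\<exists>j. t (\<zeta> v j) < t v \<and> (\<forall>i<j. \<not> t (\<zeta> v i) < t v) \<and> \<zeta> v j = w)"
proof
  assume "parent t \<zeta> v = Some w"
  then have ex: "\<exists>j. t (\<zeta> v j) < t v" and w: "w = \<zeta> v (LEAST j. t (\<zeta> v j) < t v)"
    by (auto simp: parent_def split: if_splits)
  show "\<exists>j. t (\<zeta> v j) < t v \<and> (\<forall>i<j. \<not> t (\<zeta> v i) < t v) \<and> \<zeta> v j = w"
    using LeastI_ex[OF ex] not_less_Least w by blast
next
  assume "\<exists>j. t (\<zeta> v j) < t v \<and> (\<forall>i<j. \<not> t (\<zeta> v i) < t v) \<and> \<zeta> v j = w"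
  then obtain j where j: "t (\<zeta> v j) < t v" "\<And>i. i < j \<Longrightarrow> \<not> t (\<zeta> v i) < t v" "\<zeta> v j = w" by blast
  have "(LEAST j. t (\<zeta> v j) < t v) = j"
    using j by (intro Least_equality) (auto simp: not_less[symmetric])
  then show "parent t \<zeta> v = Some w" using j by (auto simp: parent_def)
qed

text \<open>
  Here S is the set of seeds, and F stands for the distribution function of the arrival times.
\<close>

locale measurable_coloring = coloring d K P \<tau> z X
  for d :: "'v \<Rightarrow> 'v \<Rightarrow> nat" and K :: nat and P :: "'a measure"
    and \<tau> :: "'v \<Rightarrow> 'a \<Rightarrow> real" and z :: "'v \<Rightarrow> 'a \<Rightarrow> nat \<Rightarrow> 'v" and X :: "'a \<Rightarrow> 'v \<Rightarrow> real" +
  fixes S :: "'v set" and F :: "real \<Rightarrow> real"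
  assumes X_eq: "X \<omega> v = F (\<tau> v \<omega>)"
    and measurable_F: "F \<in> borel_measurable borel"
    and AE_pos: "AE \<omega> in P. 0 < \<tau> v \<omega>"
    and finite_S: "finite S"
    and measurable_arrival: "\<tau> v \<in> borel_measurable P"
    and measurable_index: "z v \<in> measurable P (PiM UNIV (\<lambda>_. count_space UNIV))"
begin

definition par' :: "'a \<Rightarrow> 'v \<Rightarrow> 'v option" where
  "par' \<omega> = seeded_parent S (\<lambda>v. \<tau> v \<omega>) (\<lambda>v. z v \<omega>)"

lemma sets_index: "{\<omega> \<in> space P. z v \<omega> j = u} \<in> sets P"
proof -
  have "(\<lambda>\<omega>. z v \<omega> j) \<in> measurable P (count_space UNIV)"
    using measurable_compose[OF measurable_index measurable_component_singleton[of j UNIV]] by simp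
  from measurable_sets[OF this, of "{u}"] show ?thesis by (simp add: vimage_def Int_def conj_commute)
qed

lemma sets_par': "{\<omega> \<in> space P. par' \<omega> v = Some w} \<in> sets P"
proof (cases "v \<in> S")
  case True
  then show ?thesis by (simp add: par'_def seeded_parent_def)
next
  case False
  define t' where "t' u \<omega> = (if u \<in> S then 0 else \<tau> u \<omega>)" for u \<omega>
  have [measurable]: "t' u \<in> borel_measurable P" for u
    unfolding t'_def using measurable_arrival by (cases "u \<in> S") auto
  have lt: "{\<omega> \<in> space P. t' (z v \<omega> j) \<omega> < t' v \<omega>} \<in> sets P" for j
  proof -
    have "{\<omega> \<in> space P. z v \<omega> j = u} \<inter> {\<omega> \<in> space P. t' u \<omega> < t' v \<omega>} \<in> sets P" for u
      by (intro sets.Int sets_index) measurable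
    moreover have "{\<omega> \<in> space P. z v \<omega> j = u} \<inter> {\<omega> \<in> space P. t' u \<omega> < t' v \<omega>}
        = {\<omega> \<in> space P. z v \<omega> j = u \<and> t' u \<omega> < t' v \<omega>}" for u by auto
    ultimately have "{\<omega> \<in> space P. \<exists>u. z v \<omega> j = u \<and> t' u \<omega> < t' v \<omega>} \<in> sets P"
      by (intro sets_Collect_ex_vertex) simp
    then show ?thesis by simp
  qed
  have "{\<omega> \<in> space P. \<exists>j. t' (z v \<omega> j) \<omega> < t' v \<omega> \<and> (\<forall>i. i < j \<longrightarrow> \<not> t' (z v \<omega> i) \<omega> < t' v \<omega>) \<and> z v \<omega> j = w} \<in> sets P"
    by (intro sets.sets_Collect_countable_Ex sets.sets_Collect_conj sets.sets_Collect_countable_All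
        sets.sets_Collect_imp sets.sets_Collect_neg lt sets_index sets.sets_Collect_const)
  moreover have "par' \<omega> v = Some w \<longleftrightarrow>
      (\<exists>j. t' (z v \<omega> j) \<omega> < t' v \<omega> \<and> (\<forall>i. i < j \<longrightarrow> \<not> t' (z v \<omega> i) \<omega> < t' v \<omega>) \<and> z v \<omega> j = w)" for \<omega>
    using False unfolding par'_def seeded_parent_def by (simp add: parent_Some_iff t'_def)
  ultimately show ?thesis by simp
qed

lemma sets_ancestor_par': "{\<omega> \<in> space P. ancestor (par' \<omega>) n v = Some w} \<in> sets P"
proof (induction n arbitrary: w)
  case 0
  show ?case by (cases "v = w") auto
next
  case (Suc n)
  have "{\<omega> \<in> space P. \<exists>a. ancestor (par' \<omega>) n v = Some a \<and> par' \<omega> a = Some w} \<in> sets P"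
    by (intro sets_Collect_ex_vertex sets.sets_Collect_conj Suc.IH sets_par')
  then show ?case by (simp add: bind_eq_Some_conv)
qed

lemma measurable_card_set:
  assumes "\<And>w :: 'v. {\<omega> \<in> space P. w \<in> A \<omega>} \<in> sets P"
  shows "(\<lambda>\<omega>. emeasure (count_space UNIV) (A \<omega>)) \<in> borel_measurable P"
proof -
  have "(\<lambda>\<omega>. indicator (A \<omega>) w :: ennreal) \<in> borel_measurable P" for w
  proof -
    have "(\<lambda>\<omega>. indicator {\<omega> \<in> space P. w \<in> A \<omega>} \<omega> :: ennreal) \<in> borel_measurable P"
      using assms by (intro borel_measurable_indicator)
    then show ?thesis by (rule measurable_cong[THEN iffD1, rotated]) (auto simp: indicator_def)
  qed
  then have "(\<lambda>\<omega>. \<integral>\<^sup>+w. indicator (A \<omega>) w \<partial>count_space UNIV) \<in> borel_measurable P"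
    by (rule measurable_nn_integral_count)
  then show ?thesis by simp
qed

lemma measurable_card_descendants:
  "(\<lambda>\<omega>. emeasure (count_space UNIV) (descendants (par' \<omega>) v)) \<in> borel_measurable P"
proof (rule measurable_card_set)
  fix w
  have "{\<omega> \<in> space P. \<exists>n. ancestor (par' \<omega>) n w = Some v} \<in> sets P"
    by (intro sets.sets_Collect_countable_Ex sets_ancestor_par')
  then show "{\<omega> \<in> space P. w \<in> descendants (par' \<omega>) v} \<in> sets P"
    by (simp add: descendants_def ancestral_path_def)
qed

lemma sets_infinite_children: "{\<omega> \<in> space P. infinite {c. par' \<omega> c = Some r}} \<in> sets P"
proof -
  have [measurable]: "(\<lambda>\<omega>. emeasure (count_space UNIV) {c. par' \<omega> c = Some r}) \<in> borel_measurable P"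
    by (rule measurable_card_set) (simp add: sets_par')
  have "{\<omega> \<in> space P. emeasure (count_space UNIV) {c. par' \<omega> c = Some r} = \<infinity>} \<in> sets P"
    by measurable
  moreover have "emeasure (count_space UNIV) A = \<infinity> \<longleftrightarrow> infinite A" for A :: "'v set"
    using of_nat_less_top[of "card A"] by (cases "finite A") (auto simp: emeasure_count_space less_top)
  ultimately show ?thesis by (simp only:)
qed

lemma AE_X_pos: "AE \<omega> in P. 0 < X \<omega> v"
proof -
  have "AE y in distr P unif_field X. 0 < y v"
    unfolding distr_X using AE_field_unit[of v] by (auto elim!: eventually_mono)
  then show ?thesis by (rule AE_distrD[OF measurable_X])
qed

definition reset :: "'a \<Rightarrow> 'v \<Rightarrow> real" where
  "reset \<omega> u = (if u \<in> S then 0 else \<tau> u \<omega>)"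

lemma par'_eq: "v \<notin> S \<Longrightarrow> par' \<omega> v = parent (reset \<omega>) (\<lambda>v. z v \<omega>) v"
  by (simp add: par'_def seeded_parent_def reset_def[abs_def])

lemma AE_all_vertices: "(\<And>v :: 'v. AE \<omega> in P. Q v \<omega>) \<Longrightarrow> AE \<omega> in P. \<forall>v. Q v \<omega>"
  using AE_ball_countable[OF countable_UNIV, where P="\<lambda>\<omega> v. Q v \<omega>" and M=P] by simp

definition short_jumps :: "'a \<Rightarrow> bool" where
  "short_jumps \<omega> \<longleftrightarrow> (\<forall>v x. \<exists>N. \<forall>n\<ge>N. \<forall>w y. ancestor (par \<omega>) n v = Some w \<longrightarrow> par \<omega> w = Some y \<longrightarrow> d w y < d w x)"

lemma AE_short_jumps: "AE \<omega> in P. short_jumps \<omega>"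
proof -
  have "AE \<omega> in P. \<forall>v x. \<exists>N. \<forall>n\<ge>N. \<forall>w. ancestor (par \<omega>) n v = Some w \<longrightarrow> (\<exists>u. d w u < d w x \<and> \<tau> u \<omega> < \<tau> w \<omega>)"
    by (intro AE_all_vertices AE_eventually_short_jumps)
  then show ?thesis
  proof (rule AE_mp, intro AE_I2 impI)
    fix \<omega> assume \<omega>: "\<omega> \<in> space P"
      and A: "\<forall>v x. \<exists>N. \<forall>n\<ge>N. \<forall>w. ancestor (par \<omega>) n v = Some w \<longrightarrow> (\<exists>u. d w u < d w x \<and> \<tau> u \<omega> < \<tau> w \<omega>)"
    show "short_jumps \<omega>" unfolding short_jumps_def
    proof (intro allI)
      fix v x
      obtain N where N: "\<And>n w. n \<ge> N \<Longrightarrow> ancestor (par \<omega>) n v = Some w \<Longrightarrow> \<exists>u. d w u < d w x \<and> \<tau> u \<omega> < \<tau> w \<omega>"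
        using A by blast
      have "d w y < d w x" if n: "n \<ge> N" and w: "ancestor (par \<omega>) n v = Some w" and y: "par \<omega> w = Some y" for n w y
      proof -
        obtain u where u: "d w u < d w x" "\<tau> u \<omega> < \<tau> w \<omega>" using N[OF n w] by blast
        have "\<not> d w u < d w y"
          using parent_SomeD(2)[OF increasing_z[OF \<omega>] y[unfolded par_def], of u] u(2) by auto
        then show ?thesis using u(1) by simp
      qed
      then show "\<exists>N. \<forall>n\<ge>N. \<forall>w y. ancestor (par \<omega>) n v = Some w \<longrightarrow> par \<omega> w = Some y \<longrightarrow> d w y < d w x" by blast
    qed
  qed
qed

text \<open>
  A vertex w is rerouted only if some seed is at most as far from w as the parent of w. By
  AE_short_jumps this happens finitely often along an ancestral path, as there are finitely many
  seeds.
\<close>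

lemma AE_rerouting: "AE \<omega> in P. rerouting (par \<omega>) (par' \<omega>) S (\<lambda>v. \<tau> v \<omega>) (reset \<omega>)"
proof -
  have "AE \<omega> in P. \<forall>v. \<exists>u. \<tau> u \<omega> < \<tau> v \<omega>" by (intro AE_all_vertices AE_ex_earlier)
  moreover have "AE \<omega> in P. \<forall>v. 0 < \<tau> v \<omega>" by (intro AE_all_vertices AE_pos)
  ultimately show ?thesis using AE_short_jumps AE_space
  proof eventually_elim
    case (elim \<omega>)
    then have earlier: "\<And>v. \<exists>u. \<tau> u \<omega> < \<tau> v \<omega>" and pos: "\<And>v. 0 < \<tau> v \<omega>" and \<omega>: "\<omega> \<in> space P"
      and short: "\<And>v x. \<exists>N. \<forall>n\<ge>N. \<forall>w y. ancestor (par \<omega>) n v = Some w \<longrightarrow> par \<omega> w = Some y \<longrightarrow> d w y < d w x"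
      by (auto simp: short_jumps_def)
    note inc = increasing_z[OF \<omega>]
    have reset_lt: "reset \<omega> u < reset \<omega> v \<longleftrightarrow> u \<in> S \<or> \<tau> u \<omega> < \<tau> v \<omega>" if "v \<notin> S" for u v
      using that pos[of v] by (simp add: reset_def)
    have total: "par \<omega> v \<noteq> None" for v
    proof -
      obtain u where "\<tau> u \<omega> < \<tau> v \<omega>" using earlier by blast
      then show ?thesis unfolding par_def by (rule parent_not_None[OF inc])
    qed
    show ?case
    proof
      show "par \<omega> v \<noteq> None" for v by (rule total)
      show "par' \<omega> v = None \<longleftrightarrow> v \<in> S" for v
      proof (cases "v \<in> S")
        case False
        obtain u where "\<tau> u \<omega> < \<tau> v \<omega>" using earlier by blast
        then have "reset \<omega> u < reset \<omega> v" using reset_lt[OF False] by simp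
        then have "par' \<omega> v \<noteq> None" unfolding par'_eq[OF False] by (rule parent_not_None[OF inc])
        then show ?thesis using False by simp
      qed (simp add: par'_def seeded_parent_def)
      show "w \<in> S \<or> par \<omega> v = Some w" if vw: "par' \<omega> v = Some w" for v w
      proof (cases "w \<in> S")
        case False
        have v: "v \<notin> S" using vw by (auto simp: par'_def seeded_parent_def)
        obtain j where j: "reset \<omega> (z v \<omega> j) < reset \<omega> v"
            "\<And>i. i < j \<Longrightarrow> \<not> reset \<omega> (z v \<omega> i) < reset \<omega> v" "z v \<omega> j = w"
          using vw unfolding par'_eq[OF v] parent_Some_iff by blast
        then have "\<tau> (z v \<omega> j) \<omega> < \<tau> v \<omega> \<and> (\<forall>i<j. \<not> \<tau> (z v \<omega> i) \<omega> < \<tau> v \<omega>)"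
          using False unfolding reset_lt[OF v] by blast
        then have "par \<omega> v = Some w" unfolding par_def parent_Some_iff using j(3) by blast
        then show ?thesis by simp
      qed simp
      show "\<exists>N. \<forall>n\<ge>N. \<forall>w. ancestor (par \<omega>) n v = Some w \<longrightarrow> par' \<omega> w = par \<omega> w" for v
      proof -
        obtain N where N: "\<And>x n w y. n \<ge> N x \<Longrightarrow> ancestor (par \<omega>) n v = Some w \<Longrightarrow> par \<omega> w = Some y \<Longrightarrow> d w y < d w x"
          using short[of v] by metis
        have "par' \<omega> w = par \<omega> w" if n: "n \<ge> (\<Sum>x\<in>S. N x)" and w: "ancestor (par \<omega>) n v = Some w" for n w
        proof -
          obtain y where y: "par \<omega> w = Some y" using total[of w] by blast
          have far: "d w y < d w x" if "x \<in> S" for x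
          proof -
            have "N x \<le> (\<Sum>x\<in>S. N x)" using that finite_S by (intro member_le_sum) auto
            then show ?thesis using N[of x n w y] n w y by simp
          qed
          have wS: "w \<notin> S" using far[of w] by auto
          obtain j where j: "\<tau> (z w \<omega> j) \<omega> < \<tau> w \<omega>"
              "\<And>i. i < j \<Longrightarrow> \<not> \<tau> (z w \<omega> i) \<omega> < \<tau> w \<omega>" "z w \<omega> j = y"
            using y unfolding par_def parent_Some_iff by blast
          have "z w \<omega> i \<notin> S" if "i < j" for i
          proof -
            have "d w (z w \<omega> i) \<le> d w y" using inc that j(3) unfolding increasing_def by blast
            then show ?thesis using far[of "z w \<omega> i"] by auto
          qed
          then have "reset \<omega> (z w \<omega> j) < reset \<omega> w \<and> (\<forall>i<j. \<not> reset \<omega> (z w \<omega> i) < reset \<omega> w)"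
            using j unfolding reset_lt[OF wS] by blast
          then have "par' \<omega> w = Some y" unfolding par'_eq[OF wS] parent_Some_iff using j(3) by blast
          then show ?thesis using y by simp
        qed
        then show ?thesis by blast
      qed
      show "\<tau> b \<omega> < \<tau> a \<omega>" if "par \<omega> a = Some b" for a b
        using parent_SomeD(1)[OF inc] that unfolding par_def by blast
      show "reset \<omega> b < reset \<omega> a" if ab: "par' \<omega> a = Some b" for a b
      proof -
        have "a \<notin> S" using ab by (auto simp: par'_def seeded_parent_def)
        then show ?thesis using parent_SomeD(1)[OF inc] ab par'_eq by metis
      qed
    qed
  qed
qed

lemma card_descendants_late_finite:
  assumes v: "v \<notin> S" and t: "0 < t"
  shows "(\<integral>\<^sup>+\<omega>. indicator {\<omega>. t < X \<omega> v} \<omega> * emeasure (count_space UNIV) (descendants (par' \<omega>) v) \<partial>P) < \<infinity>"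
proof -
  have "AE \<omega> in P. indicator {\<omega>. t < X \<omega> v} \<omega> * emeasure (count_space UNIV) (descendants (par' \<omega>) v)
      \<le> emeasure (count_space UNIV) (descendants (par \<omega>) v) * indicator {\<omega>. t < X \<omega> v} \<omega>"
    using AE_rerouting
  proof eventually_elim
    case (elim \<omega>)
    have "emeasure (count_space UNIV) (descendants (par' \<omega>) v) \<le> emeasure (count_space UNIV) (descendants (par \<omega>) v)"
      using rerouting.descendants_le[OF elim v] by (intro emeasure_mono) auto
    then show ?case by (simp add: indicator_def)
  qed
  then have "(\<integral>\<^sup>+\<omega>. indicator {\<omega>. t < X \<omega> v} \<omega> * emeasure (count_space UNIV) (descendants (par' \<omega>) v) \<partial>P)
      \<le> (\<integral>\<^sup>+\<omega>. emeasure (count_space UNIV) (descendants (par \<omega>) v) * indicator {\<omega>. t < X \<omega> v} \<omega> \<partial>P)"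
    by (rule nn_integral_mono_AE)
  then show ?thesis using nn_integral_card_descendants_late[OF t] by (rule le_less_trans)
qed

text \<open>
  The marks are almost surely positive, so the events 1/n < X v exhaust the space.
\<close>

lemma AE_lt_top_of_late:
  assumes f [measurable]: "f \<in> borel_measurable P"
    and fin: "\<And>t. 0 < t \<Longrightarrow> (\<integral>\<^sup>+\<omega>. indicator {\<omega>. t < X \<omega> v} \<omega> * f \<omega> \<partial>P) < \<infinity>"
  shows "AE \<omega> in P. f \<omega> < \<infinity>"
proof -
  have Xv [measurable]: "(\<lambda>\<omega>. X \<omega> v) \<in> borel_measurable P"
    by (rule measurable_compose[OF measurable_X measurable_field_component])
  have "AE \<omega> in P. \<forall>n. indicator {\<omega>. 1 / real (Suc n) < X \<omega> v} \<omega> * f \<omega> \<noteq> \<infinity>"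
  proof (subst AE_all_countable, intro allI)
    fix n
    have "(\<lambda>\<omega>. indicator {\<omega> \<in> space P. 1 / real (Suc n) < X \<omega> v} \<omega> * f \<omega>) \<in> borel_measurable P"
      by measurable
    then have "(\<lambda>\<omega>. indicator {\<omega>. 1 / real (Suc n) < X \<omega> v} \<omega> * f \<omega>) \<in> borel_measurable P"
      by (rule measurable_cong[THEN iffD1, rotated]) (auto simp: indicator_def)
    then show "AE \<omega> in P. indicator {\<omega>. 1 / real (Suc n) < X \<omega> v} \<omega> * f \<omega> \<noteq> \<infinity>"
      using fin[of "1 / real (Suc n)"] by (intro nn_integral_PInf_AE) auto
  qed
  with AE_X_pos[of v] show ?thesis
  proof eventually_elim
    case (elim \<omega>)
    obtain n where "inverse (of_nat (Suc n)) < X \<omega> v" using reals_Archimedean[OF elim(1)] by blast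
    then have n: "1 / real (Suc n) < X \<omega> v" by (simp add: inverse_eq_divide)
    have "indicator {\<omega>. 1 / real (Suc n) < X \<omega> v} \<omega> * f \<omega> \<noteq> \<infinity>" using elim(2) by blast
    then show ?case using n by (simp add: less_top)
  qed
qed

lemma AE_finite_descendants:
  assumes "v \<notin> S"
  shows "AE \<omega> in P. finite (descendants (par' \<omega>) v)"
proof -
  have "AE \<omega> in P. emeasure (count_space UNIV) (descendants (par' \<omega>) v) < \<infinity>"
    by (intro AE_lt_top_of_late[of _ v] measurable_card_descendants card_descendants_late_finite assms)
  then show ?thesis
    by eventually_elim (auto simp: emeasure_count_space split: if_splits)
qed

text \<open>
  The conditional expectation has the same integral over the event t < X v, which is determined by
  the arrival time, as the number of descendants.
\<close>

lemma AE_cond_exp_descendants: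
  assumes "v \<notin> S"
  shows "AE \<omega> in P. cond_exp_card P (\<tau> v) (\<lambda>\<omega>. descendants (par' \<omega>) v) \<omega> < \<infinity>"
proof -
  let ?V = "vimage_algebra (space P) (\<tau> v) borel"
  let ?f = "\<lambda>\<omega>. emeasure (count_space UNIV) (descendants (par' \<omega>) v)"
  have sub: "subalgebra P ?V"
    unfolding subalgebra_def
    using measurable_arrival[of v] by (auto simp: sets_vimage_algebra2 measurable_sets)
  interpret finite_measure_subalgebra P ?V
    by (simp add: finite_measure_subalgebra_def finite_measure_subalgebra_axioms_def sub finite_measure_axioms)
  have Vmeas: "\<tau> v \<in> measurable ?V borel" by (rule measurable_vimage_algebra1) simp
  have "(\<integral>\<^sup>+\<omega>. indicator {\<omega>. t < X \<omega> v} \<omega> * nn_cond_exp P ?V ?f \<omega> \<partial>P) < \<infinity>" if t: "0 < t" for t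
  proof -
    have "{x. t < F x} \<in> sets borel" using measurable_F by measurable
    then have "(\<lambda>\<omega>. indicator {x. t < F x} (\<tau> v \<omega>) :: ennreal) \<in> borel_measurable ?V"
      by (intro measurable_compose[OF Vmeas] borel_measurable_indicator)
    then have ind: "(\<lambda>\<omega>. indicator {\<omega>. t < X \<omega> v} \<omega> :: ennreal) \<in> borel_measurable ?V"
      by (simp add: indicator_def X_eq)
    have "(\<integral>\<^sup>+\<omega>. indicator {\<omega>. t < X \<omega> v} \<omega> * nn_cond_exp P ?V ?f \<omega> \<partial>P)
        = (\<integral>\<^sup>+\<omega>. indicator {\<omega>. t < X \<omega> v} \<omega> * ?f \<omega> \<partial>P)"
      by (rule nn_cond_exp_intg[OF ind measurable_card_descendants])
    then show ?thesis using card_descendants_late_finite[OF assms t] by simp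
  qed
  then have "AE \<omega> in P. nn_cond_exp P ?V ?f \<omega> < \<infinity>"
    by (intro AE_lt_top_of_late[of _ v]) auto
  then show ?thesis by (simp add: cond_exp_card_def)
qed

end

section \<open>Local minima of the marks\<close>

text \<open>
  Chebyshev's inequality for the number of events that occur; the sum of covariances is its
  variance.
\<close>

lemma (in prob_space) prob_few_le:
  fixes B :: "'i \<Rightarrow> 'a set"
  assumes A: "finite A" and B: "\<And>v. v \<in> A \<Longrightarrow> B v \<in> events"
    and \<mu>: "\<mu> = (\<Sum>v\<in>A. prob (B v))" "0 < \<mu>"
    and V: "(\<Sum>v\<in>A. \<Sum>w\<in>A. prob (B v \<inter> B w) - prob (B v) * prob (B w)) \<le> V"
  shows "prob {\<omega> \<in> space M. (\<Sum>v\<in>A. indicat_real (B v) \<omega>) \<le> \<mu> / 2} \<le> 4 * V / \<mu>\<^sup>2"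
proof -
  define f where "f \<omega> = (\<Sum>v\<in>A. indicat_real (B v) \<omega>)" for \<omega>
  have fm [measurable]: "f \<in> borel_measurable M" unfolding f_def using B by (intro borel_measurable_sum) auto
  have int_ind: "integrable M (indicat_real C)" if "C \<in> events" for C
    using that by (intro integrable_const_bound[where B=1]) (auto simp: indicator_def)
  have f2: "(f \<omega>)\<^sup>2 = (\<Sum>v\<in>A. \<Sum>w\<in>A. indicat_real (B v \<inter> B w) \<omega>)" for \<omega>
    unfolding f_def power2_eq_square sum_product by (simp add: indicator_inter_arith)
  have fi: "integrable M f" unfolding f_def[abs_def] using B by (intro Bochner_Integration.integrable_sum int_ind)
  have f2i: "integrable M (\<lambda>\<omega>. (f \<omega>)\<^sup>2)"
    unfolding f2 using B by (intro Bochner_Integration.integrable_sum int_ind sets.Int)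
  have Ef: "expectation f = \<mu>"
    unfolding f_def[abs_def] \<mu> using B int_ind by (subst Bochner_Integration.integral_sum) auto
  have Ef2: "expectation (\<lambda>\<omega>. (f \<omega>)\<^sup>2) = (\<Sum>v\<in>A. \<Sum>w\<in>A. prob (B v \<inter> B w))"
  proof -
    have "expectation (\<lambda>\<omega>. (f \<omega>)\<^sup>2) = (\<Sum>v\<in>A. expectation (\<lambda>\<omega>. \<Sum>w\<in>A. indicat_real (B v \<inter> B w) \<omega>))"
      unfolding f2 using B by (intro Bochner_Integration.integral_sum Bochner_Integration.integrable_sum int_ind sets.Int)
    also have "\<dots> = (\<Sum>v\<in>A. \<Sum>w\<in>A. expectation (indicat_real (B v \<inter> B w)))"
      using B by (intro sum.cong Bochner_Integration.integral_sum int_ind sets.Int refl)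
    also have "\<dots> = (\<Sum>v\<in>A. \<Sum>w\<in>A. prob (B v \<inter> B w))"
    proof (intro sum.cong refl)
      fix v w assume "v \<in> A" "w \<in> A"
      then have "B v \<inter> B w \<in> events" using B by auto
      then show "expectation (indicat_real (B v \<inter> B w)) = prob (B v \<inter> B w)" by simp
    qed
    finally show ?thesis .
  qed
  have "variance f = (\<Sum>v\<in>A. \<Sum>w\<in>A. prob (B v \<inter> B w)) - \<mu>\<^sup>2"
    using variance_eq[OF fi f2i] Ef Ef2 by simp
  also have "\<dots> = (\<Sum>v\<in>A. \<Sum>w\<in>A. prob (B v \<inter> B w) - prob (B v) * prob (B w))"
    unfolding \<mu>(1) power2_eq_square sum_product by (simp add: sum_subtractf)
  finally have var: "variance f \<le> V" using V by simp
  have "prob {\<omega> \<in> space M. f \<omega> \<le> \<mu> / 2} \<le> prob {\<omega> \<in> space M. \<mu> / 2 \<le> \<bar>f \<omega> - expectation f\<bar>}"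
    unfolding Ef using \<mu>(2) by (intro finite_measure_mono) auto
  also have "\<dots> \<le> variance f / (\<mu> / 2)\<^sup>2"
    using \<mu>(2) by (intro Chebyshev_inequality fm f2i) simp
  also have "\<dots> \<le> V / (\<mu> / 2)\<^sup>2" using var by (intro divide_right_mono) auto
  also have "\<dots> = 4 * V / \<mu>\<^sup>2" by (simp add: power2_eq_square)
  finally show ?thesis unfolding f_def .
qed

text \<open>
  The number of events that occur among those in A n has mean at least c n and variance at most C
  n, so it exceeds any given bound with probability 1 - O(1/n).
\<close>

lemma (in prob_space) AE_infinite_occurrences:
  fixes B :: "'i \<Rightarrow> 'a set" and A :: "nat \<Rightarrow> 'i set"
  assumes A: "\<And>n. finite (A n)" and B: "\<And>v. B v \<in> events"
    and c: "0 < c" "\<And>n. c * real n \<le> (\<Sum>v\<in>A n. prob (B v))"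
    and C: "\<And>n. (\<Sum>v\<in>A n. \<Sum>w\<in>A n. prob (B v \<inter> B w) - prob (B v) * prob (B w)) \<le> C * real n"
  shows "AE \<omega> in M. infinite {v. \<omega> \<in> B v}"
proof -
  define H where "H m = {\<omega> \<in> space M. \<forall>n. (\<Sum>v\<in>A n. indicat_real (B v) \<omega>) \<le> real m}" for m
  have fm [measurable]: "(\<lambda>\<omega>. \<Sum>v\<in>A n. indicat_real (B v) \<omega>) \<in> borel_measurable M" for n
    using B by (intro borel_measurable_sum) auto
  have Hm [measurable]: "H m \<in> events" for m unfolding H_def by measurable
  have "prob (H m) \<le> 0" for m
  proof (rule LIMSEQ_le_const)
    show "(\<lambda>n. (4 * C / c\<^sup>2) * inverse (real n)) \<longlonglongrightarrow> 0"
      using tendsto_mult_left[OF lim_inverse_n, of "4 * C / c\<^sup>2"] by simp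
    obtain N :: nat where N: "2 * real m / c < real N" using reals_Archimedean2 by blast
    show "\<exists>N. \<forall>n\<ge>N. prob (H m) \<le> (4 * C / c\<^sup>2) * inverse (real n)"
    proof (intro exI[of _ "Suc N"] allI impI)
      fix n assume n: "Suc N \<le> n"
      define \<mu> where "\<mu> = (\<Sum>v\<in>A n. prob (B v))"
      have cn: "0 < c * real n" using c n by simp
      have \<mu>: "c * real n \<le> \<mu>" using c(2) by (simp add: \<mu>_def)
      have "2 * real m < c * real N" using N c(1) by (simp add: field_simps)
      also have "\<dots> \<le> c * real n" using n c(1) by simp
      finally have m: "real m \<le> \<mu> / 2" using \<mu> by simp
      have Cn: "0 \<le> C * real n"
      proof -
        have "0 \<le> 4 * (C * real n) / \<mu>\<^sup>2"
          using prob_few_le[OF A[of n] B \<mu>_def _ C] \<mu> cn measure_nonneg order_trans by (smt (verit))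
        then show ?thesis using \<mu> cn by (simp add: zero_le_divide_iff)
      qed
      have "prob (H m) \<le> prob {\<omega> \<in> space M. (\<Sum>v\<in>A n. indicat_real (B v) \<omega>) \<le> \<mu> / 2}"
      proof (intro finite_measure_mono subsetI CollectI conjI)
        fix \<omega> assume "\<omega> \<in> H m"
        then have "\<omega> \<in> space M" and le: "(\<Sum>v\<in>A n. indicat_real (B v) \<omega>) \<le> real m"
          by (auto simp: H_def)
        show "\<omega> \<in> space M" by fact
        show "(\<Sum>v\<in>A n. indicat_real (B v) \<omega>) \<le> \<mu> / 2" using le m by linarith
      qed measurable
      also have "\<dots> \<le> 4 * (C * real n) / \<mu>\<^sup>2"
        using \<mu> cn by (intro prob_few_le[OF A B \<mu>_def _ C]) auto
      also have "\<dots> \<le> 4 * (C * real n) / (c * real n)\<^sup>2"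
      proof -
        have pos: "0 < \<mu>" using \<mu> cn by linarith
        show ?thesis
        proof (rule divide_left_mono)
          show "(c * real n)\<^sup>2 \<le> \<mu>\<^sup>2" by (rule power_mono[OF \<mu>]) (use cn in simp)
          show "0 \<le> 4 * (C * real n)" using Cn by simp
          show "0 < \<mu>\<^sup>2 * (c * real n)\<^sup>2" by (rule mult_pos_pos[OF zero_less_power[OF pos] zero_less_power[OF cn]])
        qed
      qed
      also have "\<dots> = (4 * C / c\<^sup>2) * inverse (real n)"
        using n by (simp add: power2_eq_square field_simps)
      finally show "prob (H m) \<le> (4 * C / c\<^sup>2) * inverse (real n)" .
    qed
  qed
  then have "prob (H m) = 0" for m using measure_nonneg[of M "H m"] by (simp add: order_antisym)
  then have "AE \<omega> in M. \<forall>m. \<omega> \<notin> H m"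
    by (subst AE_all_countable) (auto intro!: AE_not_in simp: null_sets_def emeasure_eq_measure)
  then show ?thesis
  proof (rule AE_mp, intro AE_I2 impI notI)
    fix \<omega> assume \<omega>: "\<omega> \<in> space M" "\<forall>m. \<omega> \<notin> H m" and fin: "finite {v. \<omega> \<in> B v}"
    have "(\<Sum>v\<in>A n. indicat_real (B v) \<omega>) \<le> real (card {v. \<omega> \<in> B v})" for n
    proof -
      have "(\<Sum>v\<in>A n. indicat_real (B v) \<omega>) = real (card (A n \<inter> {v. \<omega> \<in> B v}))"
        using A[of n] by (simp add: indicator_def sum.If_cases)
      also have "\<dots> \<le> real (card {v. \<omega> \<in> B v})" using fin by (intro of_nat_mono card_mono) auto
      finally show ?thesis .
    qed
    then have "\<omega> \<in> H (card {v. \<omega> \<in> B v})" using \<omega>(1) by (simp add: H_def)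
    then show False using \<omega>(2) by simp
  qed
qed

lemma nn_integral_tail_power:
  assumes "0 \<le> t" "t \<le> 1"
  shows "(\<integral>\<^sup>+s. emeasure unif {s..} ^ q * indicator {t..} s \<partial>unif) = ennreal ((1 - t) ^ Suc q / real (Suc q))"
proof -
  have deriv: "((\<lambda>s. - ((1 - s) ^ Suc q / real (Suc q))) has_vector_derivative (1 - s) ^ q) (at s within {t..1})" for s :: real
  proof -
    have "((\<lambda>s. - ((1 - s) ^ Suc q / real (Suc q))) has_field_derivative (1 - s) ^ q) (at s within {t..1})"
      by (rule derivative_eq_intros refl | simp)+ 
    then show ?thesis by (simp add: has_real_derivative_iff_has_vector_derivative)
  qed
  have int: "((\<lambda>s. (1 - s) ^ q) has_integral ((1 - t) ^ Suc q / real (Suc q))) {t..1}"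
    using fundamental_theorem_of_calculus[OF assms(2) deriv] by simp
  have "(\<integral>\<^sup>+s. emeasure unif {s..} ^ q * indicator {t..} s \<partial>unif)
      = (\<integral>\<^sup>+s. ennreal ((1 - s) ^ q) * indicator {t..1} s \<partial>lborel)"
    using assms by (subst nn_integral_unif)
      (auto intro!: nn_integral_cong simp: indicator_def emeasure_unif_atLeast ennreal_power)
  also have "\<dots> = ennreal ((1 - t) ^ Suc q / real (Suc q))"
    by (rule nn_integral_has_integral_lebesgue'[OF _ int]) auto
  finally show ?thesis .
qed

lemma nn_integral_full_tail_power:
  "(\<integral>\<^sup>+s. emeasure unif {s..} ^ q \<partial>unif) = ennreal (1 / real (Suc q))"
proof -
  have "(\<integral>\<^sup>+s. emeasure unif {s..} ^ q \<partial>unif) = (\<integral>\<^sup>+s. emeasure unif {s..} ^ q * indicator {0..} s \<partial>unif)"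
    by (simp add: nn_integral_unif, intro nn_integral_cong) (auto simp: indicator_def)
  then show ?thesis using nn_integral_tail_power[of 0 q] by simp
qed

context tree_metric begin

lemma sets_ge_all [measurable]:
  "finite F \<Longrightarrow> {x. \<forall>u\<in>F. x a \<le> x u} \<in> sets (unif_field :: ('v \<Rightarrow> real) measure)"
proof -
  assume F: "finite F"
  have le: "{y \<in> space unif_field. y a \<le> (y u :: real)} \<in> sets unif_field" for u :: 'v by measurable
  have "{y \<in> space unif_field. \<forall>u\<in>F. y a \<le> (y u :: real)} \<in> sets unif_field"
    using le F by (intro sets.sets_Collect_finite_All) auto
  then show ?thesis by simp
qed

lemma emeasure_minimum:
  assumes F: "finite F" "v \<notin> F"
  shows "emeasure (unif_field :: ('v \<Rightarrow> real) measure) {x. \<forall>u\<in>F. x v \<le> x u} = ennreal (1 / real (Suc (card F)))"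
proof -
  have "emeasure (unif_field :: ('v \<Rightarrow> real) measure) {x. \<forall>u\<in>F. x v \<le> x u}
      = (\<integral>\<^sup>+(x :: 'v \<Rightarrow> real). 1 * indicator {x. \<forall>u\<in>F. x v \<le> x u} x \<partial>unif_field)"
    using sets_ge_all[OF F(1)] by simp
  also have "\<dots> = (\<integral>\<^sup>+(x :: 'v \<Rightarrow> real). 1 * emeasure unif {x v..} ^ card F \<partial>unif_field)"
    by (rule nn_integral_resample_block[OF F]) auto
  also have "\<dots> = weight [v] (\<lambda>s. emeasure unif {s..} ^ card F)" by (simp add: weight_def)
  also have "\<dots> = (\<integral>\<^sup>+s. emeasure unif {s..} ^ card F \<partial>unif)" by (rule weight_singleton) measurable
  finally show ?thesis using nn_integral_full_tail_power by simp
qed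

text \<open>
  First integrate out the marks on Fw, then the mark of w above the mark of v, and finally the
  marks on Fv and the mark of v.
\<close>

lemma emeasure_two_minima:
  assumes F: "finite Fv" "finite Fw" "Fv \<inter> Fw = {}" "v \<notin> Fv \<union> Fw" "w \<notin> Fv \<union> Fw" "v \<noteq> w"
  shows "emeasure (unif_field :: ('v \<Rightarrow> real) measure)
      {x. x v \<le> x w \<and> (\<forall>u\<in>Fw. x w \<le> x u) \<and> (\<forall>u\<in>Fv. x v \<le> x u)}
    = ennreal (1 / (real (Suc (card Fw)) * real (Suc (Suc (card Fw + card Fv)))))"
proof -
  let ?f = "unif_field :: ('v \<Rightarrow> real) measure"
  let ?Iv = "\<lambda>x :: 'v \<Rightarrow> real. indicator {x. \<forall>u\<in>Fv. x v \<le> x u} x :: ennreal"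
  let ?le = "\<lambda>s y. indicator {p :: real \<times> real. fst p \<le> snd p} (s, y) :: ennreal"
  have [measurable]: "{x. \<forall>u\<in>Fv. x v \<le> x u} \<in> sets ?f" "{x. \<forall>u\<in>Fw. x w \<le> x u} \<in> sets ?f"
    using sets_ge_all F by auto
  have [measurable]: "{x. x v \<le> x w} \<in> sets ?f"
  proof -
    have "{x \<in> space ?f. x v \<le> x w} \<in> sets ?f" by measurable
    then show ?thesis by simp
  qed
  define h where "h s = (\<integral>\<^sup>+y. ?le s y * emeasure unif {y..} ^ card Fw \<partial>unif)" for s
  interpret u: prob_space unif by (rule prob_space_unif)
  have [measurable]: "h \<in> borel_measurable borel" unfolding h_def by measurable
  have h: "h s = ennreal ((1 - s) ^ Suc (card Fw) / real (Suc (card Fw)))" if "0 \<le> s" "s \<le> 1" for s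
  proof -
    have "h s = (\<integral>\<^sup>+y. emeasure unif {y..} ^ card Fw * indicator {s..} y \<partial>unif)"
      unfolding h_def by (intro nn_integral_cong) (auto simp: indicator_def)
    then show ?thesis using nn_integral_tail_power[OF that] by simp
  qed
  have S: "{x. x v \<le> x w} \<inter> ({x. \<forall>u\<in>Fw. x w \<le> x u} \<inter> {x. \<forall>u\<in>Fv. x v \<le> x u}) \<in> sets ?f"
    by measurable
  have eq: "{x. x v \<le> x w \<and> (\<forall>u\<in>Fw. x w \<le> x u) \<and> (\<forall>u\<in>Fv. x v \<le> x u)}
      = {x :: 'v \<Rightarrow> real. x v \<le> x w} \<inter> ({x. \<forall>u\<in>Fw. x w \<le> x u} \<inter> {x. \<forall>u\<in>Fv. x v \<le> x u})" by auto
  have "emeasure ?f {x. x v \<le> x w \<and> (\<forall>u\<in>Fw. x w \<le> x u) \<and> (\<forall>u\<in>Fv. x v \<le> x u)}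
      = (\<integral>\<^sup>+x. (?Iv x * indicator {x. x v \<le> x w} x) * indicator {x. \<forall>u\<in>Fw. x w \<le> x u} x \<partial>?f)"
    unfolding eq nn_integral_indicator[OF S, symmetric]
    by (intro nn_integral_cong) (auto simp: indicator_def)
  also have "\<dots> = (\<integral>\<^sup>+x. (?Iv x * indicator {x. x v \<le> x w} x) * emeasure unif {x w..} ^ card Fw \<partial>?f)"
  proof (rule nn_integral_resample_block)
    show "finite Fw" "w \<notin> Fw" using F by auto
    show "(\<lambda>x. ?Iv x * indicator {x. x v \<le> x w} x) \<in> borel_measurable unif_field" by measurable
    fix u and x :: "'v \<Rightarrow> real" and y :: real assume u: "u \<in> Fw"
    have "(\<forall>a\<in>Fv. (x(u := y)) v \<le> (x(u := y)) a) = (\<forall>a\<in>Fv. x v \<le> x a)" "u \<noteq> v" "u \<noteq> w"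
      using u F by auto
    then show "?Iv (x(u := y)) * indicator {x. x v \<le> x w} (x(u := y)) = ?Iv x * indicator {x. x v \<le> x w} x"
      by (simp add: indicator_def)
  qed
  also have "\<dots> = (\<integral>\<^sup>+x. ?Iv x * (?le (x v) (x w) * emeasure unif {x w..} ^ card Fw) \<partial>?f)"
    by (intro nn_integral_cong) (auto simp: indicator_def)
  also have "\<dots> = (\<integral>\<^sup>+x. ?Iv x * (\<integral>\<^sup>+y. ?le (x v) y * emeasure unif {y..} ^ card Fw \<partial>unif) \<partial>?f)"
  proof (rule nn_integral_resample_point[where g="\<lambda>s y. ?le s y * emeasure unif {y..} ^ card Fw"])
    show "?Iv \<in> borel_measurable unif_field" by measurable
    show "(\<lambda>(s, y). ?le s y * emeasure unif {y..} ^ card Fw) \<in> borel_measurable (borel \<Otimes>\<^sub>M borel)" by measurable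
    fix x :: "'v \<Rightarrow> real" and y :: real
    have "(\<forall>a\<in>Fv. (x(w := y)) v \<le> (x(w := y)) a) = (\<forall>a\<in>Fv. x v \<le> x a)" using F by auto
    then show "?Iv (x(w := y)) = ?Iv x" by (simp add: indicator_def)
  qed (use F in auto)
  also have "\<dots> = (\<integral>\<^sup>+x. h (x v) * ?Iv x \<partial>?f)" by (simp add: h_def mult.commute)
  also have "\<dots> = (\<integral>\<^sup>+x. h (x v) * emeasure unif {x v..} ^ card Fv \<partial>?f)"
  proof (rule nn_integral_resample_block)
    show "finite Fv" "v \<notin> Fv" using F by auto
    show "(\<lambda>x. h (x v)) \<in> borel_measurable unif_field" by measurable
    show "h ((x(u := y)) v) = h (x v)" if "u \<in> Fv" for u and x :: "'v \<Rightarrow> real" and y using that F by auto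
  qed
  also have "\<dots> = weight [v] (\<lambda>s. h s * emeasure unif {s..} ^ card Fv)" by (simp add: weight_def)
  also have "\<dots> = weight [v] (\<lambda>s. ennreal (1 / real (Suc (card Fw))) * emeasure unif {s..} ^ (Suc (card Fw) + card Fv))"
  proof -
    have "h s * emeasure unif {s..} ^ card Fv
      = ennreal (1 / real (Suc (card Fw))) * emeasure unif {s..} ^ (Suc (card Fw) + card Fv)"
      if s: "0 < s" "s \<le> 1" for s
    proof -
      have "h s = ennreal (1 / real (Suc (card Fw))) * ennreal ((1 - s) ^ Suc (card Fw))"
        using h[of s] s by (simp add: ennreal_mult[symmetric])
      also have "ennreal ((1 - s) ^ Suc (card Fw)) = emeasure unif {s..} ^ Suc (card Fw)"
        using s by (subst ennreal_power[symmetric]) (auto simp: emeasure_unif_atLeast)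
      finally show ?thesis by (simp only: power_add mult.assoc)
    qed
    then show ?thesis by (intro antisym weight_mono) auto
  qed
  also have "\<dots> = ennreal (1 / real (Suc (card Fw))) * weight [v] (\<lambda>s. emeasure unif {s..} ^ (Suc (card Fw) + card Fv))"
    by (rule weight_cmult) measurable
  also have "weight [v] (\<lambda>s. emeasure unif {s..} ^ (Suc (card Fw) + card Fv))
      = (\<integral>\<^sup>+s. emeasure unif {s..} ^ (Suc (card Fw) + card Fv) \<partial>unif)" by (rule weight_singleton) measurable
  also have "ennreal (1 / real (Suc (card Fw))) * \<dots>
      = ennreal (1 / (real (Suc (card Fw)) * real (Suc (Suc (card Fw + card Fv)))))"
    unfolding nn_integral_full_tail_power by (subst ennreal_mult[symmetric]) (auto simp del: of_nat_Suc)
  finally show ?thesis .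
qed

definition punctured :: "'v \<Rightarrow> nat \<Rightarrow> 'v set" where "punctured v r = {u. u \<noteq> v \<and> d v u \<le> r}"

definition ball_size :: "nat \<Rightarrow> nat" where "ball_size r = 1 + (\<Sum>k<r. Suc K * K ^ k)"

definition local_min :: "'v \<Rightarrow> nat \<Rightarrow> ('v \<Rightarrow> real) set" where
  "local_min v r = {x. \<forall>u\<in>punctured v r. x v \<le> x u}"

lemma finite_punctured [simp]: "finite (punctured v r)"
  by (rule finite_subset[OF _ finite_dist_less[of v "Suc r"]]) (auto simp: punctured_def)

lemma sets_local_min [measurable]: "local_min v r \<in> sets unif_field"
  unfolding local_min_def by (rule sets_ge_all) simp

lemma card_punctured: "Suc (card (punctured v r)) = ball_size r"
proof -
  have "punctured v r = (\<Union>k\<in>{..<r}. sphere v (Suc k))"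
  proof (intro equalityI subsetI)
    fix u assume u: "u \<in> punctured v r"
    then obtain k where k: "d v u = Suc k" by (cases "d v u") (auto simp: punctured_def)
    then have "u \<in> sphere v (Suc k)" "k \<in> {..<r}" using u by (auto simp: sphere_def punctured_def)
    then show "u \<in> (\<Union>k\<in>{..<r}. sphere v (Suc k))" by blast
  qed (auto simp: punctured_def sphere_def)
  also have "card \<dots> = (\<Sum>k\<in>{..<r}. card (sphere v (Suc k)))"
    by (rule card_UN_disjoint) (simp, simp, auto simp: sphere_def)
  finally show ?thesis by (simp add: card_sphere_Suc ball_size_def)
qed

lemma ball_size_ge: "1 \<le> r \<Longrightarrow> K ^ r + 1 \<le> ball_size r"
proof -
  assume "1 \<le> r"
  then obtain k where r: "r = Suc k" by (cases r) auto
  have "K ^ r \<le> Suc K * K ^ k" by (simp add: r)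
  also have "\<dots> \<le> (\<Sum>k<r. Suc K * K ^ k)" using r by (intro member_le_sum) auto
  finally show ?thesis by (simp add: ball_size_def)
qed

lemma ball_size_le: "ball_size r \<le> 3 * K ^ r"
proof (induction r)
  case (Suc r)
  have "ball_size (Suc r) = ball_size r + Suc K * K ^ r" by (simp add: ball_size_def)
  also have "\<dots> \<le> 3 * K ^ r + Suc K * K ^ r" using Suc by simp
  also have "\<dots> = (4 + K) * K ^ r" by (simp add: algebra_simps)
  also have "\<dots> \<le> (3 * K) * K ^ r" using K_ge2 by (intro mult_right_mono) auto
  finally show ?case by simp
qed (simp add: ball_size_def)

lemma measure_local_min: "measure unif_field (local_min v r) = 1 / real (ball_size r)"
proof -
  have "v \<notin> punctured v r" by (simp add: punctured_def)
  from emeasure_minimum[OF finite_punctured this] show ?thesis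
    by (simp add: card_punctured local_min_def measure_def del: of_nat_Suc)
qed

text \<open>
  If the mark of v is the smaller one, it is minimal in the union of both balls, and the mark of w
  is minimal in the ball of w without v. Leaving out v costs the subtracted 1.
\<close>

lemma measure_local_min_ordered_le:
  assumes vw: "v \<noteq> w" and r: "1 \<le> r" "1 \<le> r'"
  shows "measure (unif_field :: ('v \<Rightarrow> real) measure) (local_min v r \<inter> local_min w r' \<inter> {x. x v \<le> x w})
    \<le> 1 / ((real (ball_size r') - 1) * real (ball_size (max r r')))"
proof -
  interpret f: prob_space "unif_field :: ('v \<Rightarrow> real) measure" by (rule prob_space_field)
  define Fw where "Fw = punctured w r' - {v}"
  define Fv where "Fv = punctured v r - punctured w r' - {w}"
  let ?S = "{x :: 'v \<Rightarrow> real. x v \<le> x w \<and> (\<forall>u\<in>Fw. x w \<le> x u) \<and> (\<forall>u\<in>Fv. x v \<le> x u)}"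
  have "finite Fv" "finite Fw" unfolding Fv_def Fw_def by simp_all
  moreover have "Fv \<inter> Fw = {}" "v \<notin> Fv \<union> Fw" "w \<notin> Fv \<union> Fw"
    unfolding Fv_def Fw_def by (auto simp: punctured_def)
  ultimately have props: "finite Fv" "finite Fw" "Fv \<inter> Fw = {}" "v \<notin> Fv \<union> Fw" "w \<notin> Fv \<union> Fw" by auto
  have cw: "real (ball_size r') - 1 \<le> real (Suc (card Fw))"
  proof -
    have "card (punctured w r') \<le> Suc (card Fw)" 
      using diff_card_le_card_Diff[of "{v}" "punctured w r'"] unfolding Fw_def by simp
    then show ?thesis using card_punctured[of w r'] by simp
  qed
  have ca: "ball_size (max r r') \<le> Suc (Suc (card Fw + card Fv))"
  proof -
    have "Suc (Suc (card Fw + card Fv)) = card (insert v (insert w (Fw \<union> Fv)))"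
      using props vw by (simp add: card_Un_disjoint Int_commute)
    moreover have "insert v (punctured v r) \<subseteq> insert v (insert w (Fw \<union> Fv))"
      "insert w (punctured w r') \<subseteq> insert v (insert w (Fw \<union> Fv))"
      unfolding Fv_def Fw_def by auto
    then have "card (insert v (punctured v r)) \<le> card (insert v (insert w (Fw \<union> Fv)))"
      "card (insert w (punctured w r')) \<le> card (insert v (insert w (Fw \<union> Fv)))"
      using props by (auto intro!: card_mono simp del: card_insert_disjoint)
    moreover have "card (insert v (punctured v r)) = ball_size r" "card (insert w (punctured w r')) = ball_size r'"
    proof -
      have "v \<notin> punctured v r" "w \<notin> punctured w r'" by (simp_all add: punctured_def)
      then show "card (insert v (punctured v r)) = ball_size r" "card (insert w (punctured w r')) = ball_size r'"
        using card_punctured by simp_all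
    qed
    ultimately show ?thesis by (auto simp: max_def)
  qed
  have b: "1 < real (ball_size r')" "0 < real (ball_size (max r r'))"
  proof -
    have "1 \<le> K ^ r'" using K_ge2 by (intro one_le_power) simp
    then have "1 < ball_size r'" using ball_size_ge[OF r(2)] by linarith
    then show "1 < real (ball_size r')" by simp
    have "0 < ball_size (max r r')" by (simp add: ball_size_def)
    then show "0 < real (ball_size (max r r'))" by simp
  qed
  have "?S \<in> sets unif_field"
  proof -
    have "{x \<in> space unif_field. x v \<le> (x w :: real)} \<in> sets (unif_field :: ('v \<Rightarrow> real) measure)" by measurable
    then have "{x. x v \<le> x w} \<inter> ({x. \<forall>u\<in>Fw. x w \<le> x u} \<inter> {x. \<forall>u\<in>Fv. x v \<le> x u}) \<in> sets (unif_field :: ('v \<Rightarrow> real) measure)"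
      using props sets_ge_all by (intro sets.Int) auto
    then show ?thesis by (simp add: Int_def)
  qed
  then have "measure unif_field (local_min v r \<inter> local_min w r' \<inter> {x. x v \<le> x w}) \<le> measure unif_field ?S"
    by (intro f.finite_measure_mono) (auto simp: local_min_def Fv_def Fw_def)
  also have "\<dots> = 1 / (real (Suc (card Fw)) * real (Suc (Suc (card Fw + card Fv))))"
    using emeasure_two_minima[OF props vw] by (simp add: measure_def del: of_nat_Suc)
  also have "\<dots> \<le> 1 / ((real (ball_size r') - 1) * real (ball_size (max r r')))"
    using cw ca b by (intro divide_left_mono mult_mono mult_pos_pos) (auto simp del: of_nat_Suc)
  finally show ?thesis .
qed

lemma measure_two_local_min_le:
  assumes vw: "v \<noteq> w" and r: "1 \<le> r" "1 \<le> r'"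
  shows "measure (unif_field :: ('v \<Rightarrow> real) measure) (local_min v r \<inter> local_min w r')
    \<le> (1 / (real (ball_size r) - 1) + 1 / (real (ball_size r') - 1)) / real (ball_size (max r r'))"
proof -
  interpret f: prob_space "unif_field :: ('v \<Rightarrow> real) measure" by (rule prob_space_field)
  have le: "{x. x a \<le> x b} \<in> sets (unif_field :: ('v \<Rightarrow> real) measure)" for a b
  proof -
    have "{x \<in> space unif_field. x a \<le> (x b :: real)} \<in> sets (unif_field :: ('v \<Rightarrow> real) measure)" by measurable
    then show ?thesis by simp
  qed
  have "measure unif_field (local_min v r \<inter> local_min w r')
      \<le> measure unif_field ((local_min v r \<inter> local_min w r' \<inter> {x. x v \<le> x w}) \<union> (local_min w r' \<inter> local_min v r \<inter> {x. x w \<le> x v}))"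
    using le by (intro f.finite_measure_mono) (auto intro!: sets.Un sets.Int)
  also have "\<dots> \<le> measure unif_field (local_min v r \<inter> local_min w r' \<inter> {x. x v \<le> x w})
      + measure unif_field (local_min w r' \<inter> local_min v r \<inter> {x. x w \<le> x v})"
    using le by (intro measure_Un_le sets.Int) auto
  also have "\<dots> \<le> 1 / ((real (ball_size r') - 1) * real (ball_size (max r r')))
      + 1 / ((real (ball_size r) - 1) * real (ball_size (max r' r)))"
    by (intro add_mono measure_local_min_ordered_le vw r not_sym[OF vw])
  also have "\<dots> = (1 / (real (ball_size r) - 1) + 1 / (real (ball_size r') - 1)) / real (ball_size (max r r'))"
    by (simp add: add_divide_distrib max.commute add.commute)
  finally show ?thesis .
qed

end

section \<open>Infinitely many local minima\<close>

lemma sum_half_powers_le: "(\<Sum>k<n. (1 / 2 :: real) ^ k) \<le> 2"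
proof -
  have "(\<Sum>k<n. (1 / 2 :: real) ^ k) = 2 - 2 * (1 / 2) ^ n"
    by (induction n) (simp_all add: field_simps)
  then show ?thesis by simp
qed

lemma sum_half_dist_le: "(\<Sum>l<n. (1 / 2 :: real) ^ ((k - l) + (l - k))) \<le> 4"
proof -
  have "(\<Sum>l<n. (1 / 2 :: real) ^ ((k - l) + (l - k)))
      \<le> (\<Sum>l<n. (if l \<le> k then (1 / 2) ^ (k - l) else 0) + (if k \<le> l then (1 / 2) ^ (l - k) else 0))"
    by (intro sum_mono) auto
  also have "\<dots> = (\<Sum>l<n. (if l \<le> k then (1 / 2 :: real) ^ (k - l) else 0)) + (\<Sum>l<n. (if k \<le> l then (1 / 2) ^ (l - k) else 0))"
    by (rule sum.distrib)
  also have "(\<Sum>l<n. (if l \<le> k then (1 / 2 :: real) ^ (k - l) else 0)) \<le> 2"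
  proof -
    have "(\<Sum>l<n. (if l \<le> k then (1 / 2 :: real) ^ (k - l) else 0)) \<le> (\<Sum>l<Suc k. (1 / 2) ^ (k - l))"
    proof -
      have "(\<Sum>l<n. (if l \<le> k then (1 / 2 :: real) ^ (k - l) else 0)) = (\<Sum>l\<in>{l. l < n \<and> l \<le> k}. (1 / 2) ^ (k - l))"
        by (rule sum.mono_neutral_cong_right) auto
      also have "\<dots> \<le> (\<Sum>l<Suc k. (1 / 2) ^ (k - l))" by (intro sum_mono2) auto
      finally show ?thesis .
    qed
    also have "\<dots> = (\<Sum>l<Suc k. (1 / 2) ^ l)" using sum.nat_diff_reindex[of "\<lambda>l. (1 / 2 :: real) ^ l" "Suc k"] by simp
    finally show ?thesis using sum_half_powers_le[of "Suc k"] by linarith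
  qed
  also have "(\<Sum>l<n. (if k \<le> l then (1 / 2 :: real) ^ (l - k) else 0)) \<le> 2"
  proof -
    have "(\<Sum>l<n. (if k \<le> l then (1 / 2 :: real) ^ (l - k) else 0)) = (\<Sum>l\<in>{k..<n}. (1 / 2) ^ (l - k))"
      by (rule sum.mono_neutral_cong_right) auto
    also have "\<dots> = (\<Sum>l<n - k. (1 / 2) ^ l)"
      by (rule sum.reindex_bij_witness[of _ "\<lambda>l. l + k" "\<lambda>l. l - k"]) auto
    finally show ?thesis using sum_half_powers_le[of "n - k"] by linarith
  qed
  finally show ?thesis by simp
qed

text \<open>
  For balls of sizes b and b' this bounds the covariance of the two minima, with the probability
  of both replaced by its bound in measure_two_local_min_le.
\<close>

lemma minima_covariance_le:
  fixes b b' x y :: real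
  assumes b: "x + 1 \<le> b" "y + 1 \<le> b'" and xy: "0 < x" "0 < y" "x \<le> y"
  shows "(1 / (b - 1) + 1 / (b' - 1)) / b' - 1 / (b * b') \<le> 1 / (y * y) + 1 / (x * x * y)"
proof -
  have "(1 / (b - 1) + 1 / (b' - 1)) / b' - 1 / (b * b') = 1 / ((b' - 1) * b') + 1 / ((b - 1) * b * b')"
  proof -
    have nz: "b \<noteq> 0" "b - 1 \<noteq> 0" using b xy by auto
    have "1 / (b - 1) - 1 / b = 1 / ((b - 1) * b)" using nz by (simp add: diff_frac_eq)
    then have "(1 / (b - 1) - 1 / b) / b' = 1 / ((b - 1) * b * b')" by simp
    moreover have "(1 / (b - 1) + 1 / (b' - 1)) / b' - 1 / (b * b') = 1 / (b' - 1) / b' + (1 / (b - 1) - 1 / b) / b'"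
      by (simp add: add_divide_distrib diff_divide_distrib)
    ultimately show ?thesis by simp
  qed
  also have "1 / ((b' - 1) * b') \<le> 1 / (y * y)"
    using b xy by (intro divide_left_mono mult_mono mult_pos_pos) auto
  also have "1 / ((b - 1) * b * b') \<le> 1 / (x * x * y)"
    using b xy by (intro divide_left_mono mult_mono mult_pos_pos) auto
  finally show ?thesis by simp
qed

context tree_metric begin

lemma level_covariance_le:
  assumes kl: "k \<le> l" and L: "1 \<le> L"
  shows "(1 / (real (ball_size (L + k)) - 1) + 1 / (real (ball_size (L + l)) - 1)) / real (ball_size (L + l))
      - 1 / (real (ball_size (L + k)) * real (ball_size (L + l)))
    \<le> 1 / (real K ^ k * real K ^ l) * ((1 / 2) ^ (l - k) + (1 / 2) ^ k)"
proof -
  have K: "2 \<le> real K" using K_ge2 by simp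
  have b: "real K ^ j + 1 \<le> real (ball_size (L + j))" for j
  proof -
    have "K ^ j + 1 \<le> K ^ (L + j) + 1" using K_ge2 by (simp add: power_increasing)
    also have "\<dots> \<le> ball_size (L + j)" using L by (intro ball_size_ge) simp
    finally have "real (K ^ j + 1) \<le> real (ball_size (L + j))" by (rule of_nat_mono)
    then show ?thesis by simp
  qed
  have "real K ^ k \<le> real K ^ l" using kl K by (intro power_increasing) auto
  then have "(1 / (real (ball_size (L + k)) - 1) + 1 / (real (ball_size (L + l)) - 1)) / real (ball_size (L + l))
      - 1 / (real (ball_size (L + k)) * real (ball_size (L + l)))
    \<le> 1 / (real K ^ l * real K ^ l) + 1 / (real K ^ k * real K ^ k * real K ^ l)"
    using K by (intro minima_covariance_le b) auto
  also have "1 / (real K ^ l * real K ^ l) \<le> 1 / (real K ^ k * real K ^ l) * (1 / 2) ^ (l - k)"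
  proof -
    have "real K ^ l = real K ^ k * real K ^ (l - k)" using kl by (simp add: power_add[symmetric])
    then have "1 / (real K ^ l * real K ^ l) = 1 / (real K ^ k * real K ^ l) * (1 / real K) ^ (l - k)"
      by (simp add: power_one_over)
    also have "\<dots> \<le> 1 / (real K ^ k * real K ^ l) * (1 / 2) ^ (l - k)"
      using K by (intro mult_left_mono power_mono) (auto simp: field_simps)
    finally show ?thesis .
  qed
  also have "1 / (real K ^ k * real K ^ k * real K ^ l) \<le> 1 / (real K ^ k * real K ^ l) * (1 / 2) ^ k"
  proof -
    have "1 / (real K ^ k * real K ^ k * real K ^ l) = 1 / (real K ^ k * real K ^ l) * (1 / real K) ^ k"
      by (simp add: power_one_over)
    also have "\<dots> \<le> 1 / (real K ^ k * real K ^ l) * (1 / 2) ^ k"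
      using K by (intro mult_left_mono power_mono) (auto simp: field_simps)
    finally show ?thesis .
  qed
  finally show ?thesis by (simp add: algebra_simps)
qed

lemma level_covariance_sym_le:
  assumes L: "1 \<le> L"
  shows "(1 / (real (ball_size (L + k)) - 1) + 1 / (real (ball_size (L + l)) - 1)) / real (ball_size (max (L + k) (L + l)))
      - 1 / (real (ball_size (L + k)) * real (ball_size (L + l)))
    \<le> 1 / (real K ^ k * real K ^ l) * ((1 / 2) ^ ((k - l) + (l - k)) + (1 / 2) ^ k + (1 / 2) ^ l)"
    (is "?A \<le> ?c * (?d + ?x + ?y)")
proof -
  have c: "0 \<le> ?c" by simp
  show ?thesis
  proof (cases "k \<le> l")
    case True
    then have "?A \<le> ?c * (?d + ?x)"
      using level_covariance_le[OF True L] by (simp add: max_def)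
    also have "\<dots> \<le> ?c * (?d + ?x + ?y)" using c by (intro mult_left_mono) auto
    finally show ?thesis .
  next
    case False
    then have lk: "l \<le> k" by simp
    have m: "max (L + k) (L + l) = L + k" using lk by simp
    have e: "(k - l) + (l - k) = k - l" using lk by simp
    have "?A \<le> ?c * (?d + ?y)"
      using level_covariance_le[OF lk L] unfolding m e
      by (simp only: add.commute[of "1 / (real (ball_size (L + k)) - 1)"] mult.commute[of "real (ball_size (L + k))"]
          mult.commute[of "real K ^ k"])
    also have "\<dots> \<le> ?c * (?d + ?x + ?y)" using c by (intro mult_left_mono) auto
    finally show ?thesis .
  qed
qed

text \<open>
  There are K^k vertices v behind y at distance k from y, and each is a minimum with probability
  of order K^(-k). So each level contributes at least a constant to the mean. The covariances
  between the levels k and l add up to at most (1/2)^|k-l| + (1/2)^k + (1/2)^l, so the variance is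
  at most linear in the number of levels. The marks Z thin out the minima by independent factors
  in [c, 1].
\<close>

lemma AE_infinite_marked_minima:
  fixes P :: "'a measure" and X :: "'a \<Rightarrow> 'v \<Rightarrow> real" and Z :: "'v \<Rightarrow> 'a set"
  assumes P: "prob_space P" and X [measurable]: "X \<in> measurable P unif_field" and distr: "distr P unif_field X = unif_field"
    and L: "1 \<le> d s y"
    and Z: "\<And>v. Z v \<in> sets P" and c: "0 < c" "\<And>v. btw s y v \<Longrightarrow> c \<le> measure P (Z v)"
    and indep1: "\<And>A v. A \<in> sets unif_field \<Longrightarrow>
      measure P ((X -` A \<inter> space P) \<inter> Z v) = measure P (X -` A \<inter> space P) * measure P (Z v)"
    and indep2: "\<And>A v w. A \<in> sets unif_field \<Longrightarrow> v \<noteq> w \<Longrightarrow>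
      measure P ((X -` A \<inter> space P) \<inter> Z v \<inter> Z w) = measure P (X -` A \<inter> space P) * measure P (Z v) * measure P (Z w)"
  shows "AE \<omega> in P. infinite {v. btw s y v \<and> X \<omega> \<in> local_min v (d s v) \<and> \<omega> \<in> Z v}"
proof -
  interpret prob_space P by (rule P)
  define D where "D = d s y"
  define lev where "lev k = {v. d y v = k \<and> btw s y v}" for k
  define A where "A n = (\<Union>k\<in>{..<n}. lev k)" for n
  define B where "B v = (if btw s y v then (X -` local_min v (d s v) \<inter> space P) \<inter> Z v else {})" for v
  define b where "b k = real (ball_size (D + k))" for k
  have sy: "s \<noteq> y" using L by auto
  have K: "2 \<le> real K" using K_ge2 by simp
  have fin_lev: "finite (lev k)" for k
    unfolding lev_def by (rule finite_subset[OF _ finite_sphere[of y k]]) (auto simp: sphere_def)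
  have card_lev: "card (lev k) = K ^ k" for k unfolding lev_def by (rule card_forward_sphere[OF sy])
  have sum_A: "(\<Sum>v\<in>A n. g (d y v)) = (\<Sum>k<n. real K ^ k * g k)" for g :: "nat \<Rightarrow> real" and n
  proof -
    have "(\<Sum>v\<in>A n. g (d y v)) = (\<Sum>k<n. \<Sum>v\<in>lev k. g (d y v))"
      unfolding A_def using fin_lev by (intro sum.UNION_disjoint) (auto simp: lev_def)
    also have "\<dots> = (\<Sum>k<n. \<Sum>v\<in>lev k. g k)" by (intro sum.cong) (auto simp: lev_def)
    finally show ?thesis by (simp add: card_lev)
  qed
  have A_mem: "btw s y v" "d s v = D + d y v" if "v \<in> A n" for v n
    using that by (auto simp: A_def lev_def btw_def D_def)
  have Xm: "measure P (X -` C \<inter> space P) = measure unif_field C" if "C \<in> sets unif_field" for C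
    using measure_distr[OF X that] distr by simp
  have B_ev: "B v \<in> events" for v
    unfolding B_def using Z measurable_sets[OF X sets_local_min] by auto
  have bpos: "real K ^ k + 1 \<le> b k" "b k \<le> 3 * real K ^ (D + k)" for k
  proof -
    have "K ^ k + 1 \<le> K ^ (D + k) + 1" using K_ge2 by (simp add: power_increasing)
    also have "\<dots> \<le> ball_size (D + k)" using L by (intro ball_size_ge) (simp add: D_def)
    finally have "real (K ^ k + 1) \<le> b k" unfolding b_def by (rule of_nat_mono)
    then show "real K ^ k + 1 \<le> b k" by simp
    have "real (ball_size (D + k)) \<le> real (3 * K ^ (D + k))" by (rule of_nat_mono[OF ball_size_le])
    then show "b k \<le> 3 * real K ^ (D + k)" by (simp add: b_def)
  qed
  have Kpos: "0 < real K ^ k" for k using K by simp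
  have b0: "0 < b k" for k using bpos(1)[of k] Kpos[of k] by linarith
  have PB: "prob (B v) = measure P (Z v) / b (d y v)" if "v \<in> A n" for v n
    using A_mem[OF that] indep1[OF sets_local_min, of v "d s v" v] Xm[OF sets_local_min]
    by (simp add: B_def measure_local_min b_def)
  have PB2: "prob (B v \<inter> B w) = measure unif_field (local_min v (d s v) \<inter> local_min w (d s w)) * measure P (Z v) * measure P (Z w)"
    if "v \<in> A n" "w \<in> A n" "v \<noteq> w" for v w n
  proof -
    have m: "local_min v (d s v) \<inter> local_min w (d s w) \<in> sets unif_field" by (intro sets.Int sets_local_min)
    have "B v \<inter> B w = (X -` (local_min v (d s v) \<inter> local_min w (d s w)) \<inter> space P) \<inter> Z v \<inter> Z w"
      using A_mem that by (auto simp: B_def)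
    then show ?thesis using indep2[OF m that(3)] Xm[OF m] by simp
  qed
  define e where "e k l = (1 / 2 :: real) ^ ((k - l) + (l - k)) + (1 / 2) ^ k + (1 / 2) ^ l" for k l :: nat
  have cov: "prob (B v \<inter> B w) - prob (B v) * prob (B w)
      \<le> (if v = w then 1 / real K ^ d y v else 0) + 1 / real K ^ d y v * (1 / real K ^ d y w * e (d y v) (d y w))"
    if vw: "v \<in> A n" "w \<in> A n" for v w n
  proof (cases "v = w")
    case True
    have "prob (B v) \<le> 1 / b (d y v)"
      using b0[of "d y v"] by (simp add: PB[OF vw(1)] divide_right_mono)
    also have "\<dots> \<le> 1 / real K ^ d y v"
      using bpos(1)[of "d y v"] Kpos[of "d y v"] by (intro divide_left_mono mult_pos_pos b0) auto
    finally have 1: "prob (B v) \<le> 1 / real K ^ d y v" .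
    have "0 \<le> 1 / real K ^ d y v * (1 / real K ^ d y w * e (d y v) (d y w))" by (simp add: e_def)
    moreover have "prob (B v \<inter> B w) - prob (B v) * prob (B w) \<le> prob (B v)" using True by simp
    moreover have "(if v = w then 1 / real K ^ d y v else 0) = 1 / real K ^ d y v" using True by simp
    ultimately show ?thesis using 1 by linarith
  next
    case False
    let ?k = "d y v" and ?l = "d y w"
    let ?q = "measure P (Z v) * measure P (Z w)"
    let ?E = "1 / (real K ^ ?k * real K ^ ?l) * e ?k ?l"
    have q: "0 \<le> ?q" "?q \<le> 1" by (auto intro: mult_le_one)
    have E0: "0 \<le> ?E" by (simp add: e_def)
    have D1: "1 \<le> D" using L by (simp add: D_def)
    have "measure unif_field (local_min v (d s v) \<inter> local_min w (d s w))
      \<le> (1 / (b ?k - 1) + 1 / (b ?l - 1)) / real (ball_size (max (D + ?k) (D + ?l)))"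
      using measure_two_local_min_le[OF False, of "D + ?k" "D + ?l"] D1 A_mem(2)[OF vw(1)] A_mem(2)[OF vw(2)]
      by (simp add: b_def)
    also have "\<dots> \<le> 1 / (b ?k * b ?l) + ?E"
      using level_covariance_sym_le[OF D1, of ?k ?l] by (simp add: b_def e_def)
    finally have le: "measure unif_field (local_min v (d s v) \<inter> local_min w (d s w)) \<le> 1 / (b ?k * b ?l) + ?E" .
    have "prob (B v \<inter> B w) - prob (B v) * prob (B w)
        = ?q * (measure unif_field (local_min v (d s v) \<inter> local_min w (d s w)) - 1 / (b ?k * b ?l))"
      using PB2[OF vw False] PB[OF vw(1)] PB[OF vw(2)] by (simp add: algebra_simps)
    also have "\<dots> \<le> ?q * ?E" using le q by (intro mult_left_mono) auto
    also have "\<dots> \<le> 1 * ?E" using q E0 by (intro mult_right_mono) auto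
    finally show ?thesis using False by simp
  qed
  \<comment> \<open>The diagonal contributes n, the three summands of e at most 4 n, 2 n and 2 n.\<close>
  have cov_sum: "(\<Sum>v\<in>A n. \<Sum>w\<in>A n. prob (B v \<inter> B w) - prob (B v) * prob (B w)) \<le> 9 * real n" for n
  proof -
    have finA: "finite (A n)" using fin_lev by (auto simp: A_def)
    have "(\<Sum>v\<in>A n. \<Sum>w\<in>A n. prob (B v \<inter> B w) - prob (B v) * prob (B w))
        \<le> (\<Sum>v\<in>A n. \<Sum>w\<in>A n. (if v = w then 1 / real K ^ d y v else 0)
            + 1 / real K ^ d y v * (1 / real K ^ d y w * e (d y v) (d y w)))"
      by (intro sum_mono cov)
    also have "\<dots> = (\<Sum>v\<in>A n. 1 / real K ^ d y v
        + 1 / real K ^ d y v * (\<Sum>w\<in>A n. 1 / real K ^ d y w * e (d y v) (d y w)))"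
      using finA by (intro sum.cong refl) (simp add: sum.distrib sum_distrib_left)
    also have "\<dots> = (\<Sum>v\<in>A n. 1 / real K ^ d y v + 1 / real K ^ d y v * (\<Sum>l<n. e (d y v) l))"
    proof (intro sum.cong refl arg_cong2[where f="(+)"] arg_cong2[where f="(*)"])
      fix v
      have "(\<Sum>w\<in>A n. 1 / real K ^ d y w * e (d y v) (d y w)) = (\<Sum>l<n. real K ^ l * (1 / real K ^ l * e (d y v) l))"
        by (rule sum_A)
      then show "(\<Sum>w\<in>A n. 1 / real K ^ d y w * e (d y v) (d y w)) = (\<Sum>l<n. e (d y v) l)"
        using K by simp
    qed
    also have "\<dots> = (\<Sum>k<n. real K ^ k * (1 / real K ^ k + 1 / real K ^ k * (\<Sum>l<n. e k l)))"
      by (rule sum_A)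
    also have "\<dots> = (\<Sum>k<n. 1 + (\<Sum>l<n. e k l))"
      using K by (intro sum.cong refl) (simp add: distrib_left)
    also have "\<dots> \<le> (\<Sum>k<n. 1 + (4 + real n * (1 / 2) ^ k + 2))"
    proof (intro sum_mono add_left_mono)
      fix k
      have "(\<Sum>l<n. e k l) = (\<Sum>l<n. (1 / 2) ^ ((k - l) + (l - k))) + real n * (1 / 2) ^ k + (\<Sum>l<n. (1 / 2) ^ l)"
        by (simp add: e_def sum.distrib)
      then show "(\<Sum>l<n. e k l) \<le> 4 + real n * (1 / 2) ^ k + 2"
        using sum_half_dist_le[of k n] sum_half_powers_le[of n] by linarith
    qed
    also have "\<dots> = 7 * real n + real n * (\<Sum>k<n. (1 / 2) ^ k)"
      by (simp add: sum.distrib sum_distrib_left)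
    also have "\<dots> \<le> 7 * real n + real n * 2"
      using sum_half_powers_le[of n] by (intro add_left_mono mult_left_mono) auto
    finally show ?thesis by simp
  qed
  have mean: "c / (3 * real K ^ D) * real n \<le> (\<Sum>v\<in>A n. prob (B v))" for n
  proof -
    have "c / (3 * real K ^ D) * real n = (\<Sum>k<n. real K ^ k * (c / (3 * real K ^ (D + k))))"
      using K by (simp add: power_add)
    also have "\<dots> = (\<Sum>v\<in>A n. c / (3 * real K ^ (D + d y v)))" by (rule sum_A[symmetric])
    also have "\<dots> \<le> (\<Sum>v\<in>A n. prob (B v))"
    proof (intro sum_mono)
      fix v assume v: "v \<in> A n"
      have "c / (3 * real K ^ (D + d y v)) \<le> c / b (d y v)"
        using c(1) K by (intro divide_left_mono bpos mult_pos_pos b0) auto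
      also have "\<dots> \<le> measure P (Z v) / b (d y v)"
        using c(2)[OF A_mem(1)[OF v]] b0[of "d y v"] by (intro divide_right_mono) auto
      finally show "c / (3 * real K ^ (D + d y v)) \<le> prob (B v)" using PB[OF v] by simp
    qed
    finally show ?thesis .
  qed
  have "AE \<omega> in P. infinite {v. \<omega> \<in> B v}"
  proof (rule AE_infinite_occurrences[where A=A])
    show "finite (A n)" for n using fin_lev by (auto simp: A_def)
    show "0 < c / (3 * real K ^ D)" using c K by simp
  qed (use B_ev mean cov_sum in auto)
  then show ?thesis
  proof (rule AE_mp, intro AE_I2 impI)
    fix \<omega> assume "\<omega> \<in> space P" "infinite {v. \<omega> \<in> B v}"
    moreover have "{v. \<omega> \<in> B v} \<subseteq> {v. btw s y v \<and> X \<omega> \<in> local_min v (d s v) \<and> \<omega> \<in> Z v}"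
      by (auto simp: B_def split: if_splits)
    ultimately show "infinite {v. btw s y v \<and> X \<omega> \<in> local_min v (d s v) \<and> \<omega> \<in> Z v}"
      using finite_subset by blast
  qed
qed

end

section \<open>Uniform tie-breaking\<close>

lemma linear_order_on_image:
  assumes f: "bij_betw f S S" and R: "linear_order_on S R"
  shows "linear_order_on S (map_prod f f ` R)"
proof -
  have inj: "inj_on f S" and im: "f ` S = S" using f by (auto simp: bij_betw_def)
  have RS: "R \<subseteq> S \<times> S" and refl: "refl_on S R" and tr: "trans R" and anti: "antisym R" and tot: "total_on S R"
    using R by (auto simp: linear_order_on_def partial_order_on_def preorder_on_def)
  have mem: "(f a, f b) \<in> map_prod f f ` R \<longleftrightarrow> (a, b) \<in> R" if ab: "a \<in> S" "b \<in> S" for a b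
  proof
    assume "(f a, f b) \<in> map_prod f f ` R"
    then obtain a' b' where "(a', b') \<in> R" "f a = f a'" "f b = f b'" by auto
    moreover from this have "a' \<in> S" "b' \<in> S" using RS by auto
    ultimately show "(a, b) \<in> R" using inj_onD[OF inj] ab by metis
  next
    assume "(a, b) \<in> R"
    then show "(f a, f b) \<in> map_prod f f ` R" by (intro image_eqI[of _ _ "(a, b)"]) auto
  qed
  have RS': "map_prod f f ` R \<subseteq> S \<times> S" using RS im by auto
  show ?thesis
    unfolding linear_order_on_def partial_order_on_def preorder_on_def
  proof (intro conjI)
    show "map_prod f f ` R \<subseteq> S \<times> S" by (rule RS')
    show "refl_on S (map_prod f f ` R)"
    proof (rule refl_onI)
      fix x assume "x \<in> S"
      then obtain a where "a \<in> S" "x = f a" using im by blast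
      then show "(x, x) \<in> map_prod f f ` R" using mem refl_onD[OF refl] by simp
    qed
    show "trans (map_prod f f ` R)"
    proof (rule transI)
      fix x y z assume "(x, y) \<in> map_prod f f ` R" "(y, z) \<in> map_prod f f ` R"
      then obtain a b b' c where abc: "(a, b) \<in> R" "(b', c) \<in> R" "x = f a" "y = f b" "y = f b'" "z = f c"
        by auto
      then have "b \<in> S" "b' \<in> S" using RS by auto
      then have "b = b'" using inj_onD[OF inj] abc(4,5) by simp
      then have "(a, c) \<in> R" using transD[OF tr abc(1)] abc(2) by simp
      then show "(x, z) \<in> map_prod f f ` R" using abc(3,6) by (intro image_eqI[of _ _ "(a, c)"]) auto
    qed
    show "antisym (map_prod f f ` R)"
    proof (rule antisymI)
      fix x y assume "(x, y) \<in> map_prod f f ` R" "(y, x) \<in> map_prod f f ` R"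
      then obtain a b b' a' where ab: "(a, b) \<in> R" "(b', a') \<in> R" "x = f a" "y = f b" "y = f b'" "x = f a'"
        by auto
      then have "a \<in> S" "b \<in> S" "b' \<in> S" "a' \<in> S" using RS by auto
      then have "b = b'" "a = a'" using inj_onD[OF inj] ab(3-6) by simp_all
      then have "a = b" using antisymD[OF anti ab(1)] ab(2) by simp
      then show "x = y" using ab by simp
    qed
    show "total_on S (map_prod f f ` R)"
    proof (rule total_onI)
      fix x y assume xy: "x \<in> S" "y \<in> S" "x \<noteq> y"
      from xy(1) im obtain a where a: "a \<in> S" "x = f a" by blast
      from xy(2) im obtain b where b: "b \<in> S" "y = f b" by blast
      have "a \<noteq> b" using xy(3) a(2) b(2) by auto
      then have "(a, b) \<in> R \<or> (b, a) \<in> R" using tot a(1) b(1) unfolding total_on_def by simp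
      then show "(x, y) \<in> map_prod f f ` R \<or> (y, x) \<in> map_prod f f ` R"
        using mem[OF a(1) b(1)] mem[OF b(1) a(1)] a(2) b(2) by simp
    qed
  qed
qed

text \<open>
  In each order some element of I comes first, and exchanging i and s turns orders in which i
  comes first into orders in which s does.
\<close>

lemma card_linear_orders_first:
  assumes S: "finite S" and I: "I \<subseteq> S" "s \<in> I"
  shows "card {R. linear_order_on S R} \<le> card I * card {R. linear_order_on S R \<and> (\<forall>x\<in>I. (s, x) \<in> R)}"
proof -
  define L where "L i = {R. linear_order_on S R \<and> (\<forall>x\<in>I. (i, x) \<in> R)}" for i
  have finL: "finite {R. linear_order_on S R}"
  proof (rule finite_subset)
    show "{R. linear_order_on S R} \<subseteq> Pow (S \<times> S)"
      by (auto simp: linear_order_on_def partial_order_on_def preorder_on_def)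
  qed (use S in simp)
  have fin: "finite (L i)" for i by (rule finite_subset[OF _ finL]) (auto simp: L_def)
  have finI: "finite I" using S I finite_subset by blast
  have "card (L i) \<le> card (L s)" if i: "i \<in> I" for i
  proof -
    define f where "f = (\<lambda>x. if x = i then s else if x = s then i else x)"
    have ff: "f (f x) = x" for x by (auto simp: f_def)
    have fS: "f x \<in> S" if "x \<in> S" for x using that i I by (auto simp: f_def)
    have fI: "f x \<in> I" if "x \<in> I" for x using that i I by (auto simp: f_def)
    have bij: "bij_betw f S S" by (rule bij_betwI[of _ _ _ f]) (use ff fS in auto)
    have "inj f" by (metis ff injI)
    then have "inj (map_prod f f)" by (rule prod.inj_map) (rule \<open>inj f\<close>)
    then have "inj_on ((`) (map_prod f f)) (L i)" by (intro inj_onI) (simp add: inj_image_eq_iff)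
    moreover have "(`) (map_prod f f) ` L i \<subseteq> L s"
    proof (clarsimp simp: L_def)
      fix R assume R: "linear_order_on S R" "\<forall>x\<in>I. (i, x) \<in> R"
      have "(s, x) \<in> map_prod f f ` R" if "x \<in> I" for x
      proof -
        have "(i, f x) \<in> R" using R(2) fI[OF that] by blast
        moreover have "map_prod f f (i, f x) = (s, x)" using ff by (simp add: f_def)
        ultimately show ?thesis by (metis imageI)
      qed
      then show "linear_order_on S (map_prod f f ` R) \<and> (\<forall>x\<in>I. (s, x) \<in> map_prod f f ` R)"
        using linear_order_on_image[OF bij R(1)] by blast
    qed
    ultimately show ?thesis by (rule card_inj_on_le) (rule fin)
  qed
  then have sum: "(\<Sum>i\<in>I. card (L i)) \<le> (\<Sum>i\<in>I. card (L s))" by (intro sum_mono)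
  have "{R. linear_order_on S R} \<subseteq> (\<Union>i\<in>I. L i)"
  proof
    fix R assume "R \<in> {R. linear_order_on S R}"
    then have R: "linear_order_on S R" by simp
    then have refl: "\<And>x. x \<in> S \<Longrightarrow> (x, x) \<in> R" and tr: "trans R" and tot: "total_on S R"
      by (auto simp: linear_order_on_def partial_order_on_def preorder_on_def refl_on_def)
    have "\<exists>i\<in>J. \<forall>x\<in>J. (i, x) \<in> R" if "finite J" "J \<noteq> {}" "J \<subseteq> I" for J
      using that
    proof (induction J rule: finite_ne_induct)
      case (singleton x)
      then show ?case using refl I by auto
    next
      case (insert a J)
      then obtain i where i: "i \<in> J" "\<forall>x\<in>J. (i, x) \<in> R" by auto
      have aS: "a \<in> S" "i \<in> S" using insert.prems i I by auto
      show ?case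
      proof (cases "(i, a) \<in> R")
        case True
        then show ?thesis using i by blast
      next
        case False
        then have "(a, i) \<in> R" using tot aS refl[OF aS(1)] by (cases "a = i") (auto simp: total_on_def)
        then have "\<forall>x\<in>J. (a, x) \<in> R" using i tr by (meson transD)
        then show ?thesis using refl aS by blast
      qed
    qed
    from this[OF finI] I obtain i where "i \<in> I" "\<forall>x\<in>I. (i, x) \<in> R" by blast
    then show "R \<in> (\<Union>i\<in>I. L i)" using R by (auto simp: L_def)
  qed
  then have "card {R. linear_order_on S R} \<le> card (\<Union>i\<in>I. L i)" using fin finI by (intro card_mono) auto
  also have "\<dots> \<le> (\<Sum>i\<in>I. card (L i))" by (rule card_UN_le[OF finI])
  finally show ?thesis using sum by (simp add: L_def)
qed

lemma prob_first_among_ge: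
  assumes P: "prob_space P" and Z: "uniform_increasing_indexing P T w Z"
    and S: "finite (sphere_at T w r)" and I: "I \<subseteq> sphere_at T w r" "s \<in> I"
  shows "1 / real (card I) \<le> measure P {\<omega> \<in> space P. \<forall>x\<in>I. (s, x) \<in> induced_order (sphere_at T w r) (Z \<omega>)}"
proof -
  interpret prob_space P by (rule P)
  let ?S = "sphere_at T w r"
  let ?L = "{R. linear_order_on ?S R}" and ?F = "{R. linear_order_on ?S R \<and> (\<forall>x\<in>I. (s, x) \<in> R)}"
  let ?o = "\<lambda>\<omega>. induced_order ?S (Z \<omega>)"
  have rv: "?o \<in> measurable P (count_space UNIV)"
    using Z unfolding uniform_increasing_indexing_def indep_vars_def by blast
  have ev: "{\<omega> \<in> space P. ?o \<omega> = R} \<in> events" for R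
    using measurable_sets[OF rv, of "{R}"] by (simp add: vimage_def Int_def conj_commute)
  have unifo: "prob {\<omega> \<in> space P. ?o \<omega> = R} = 1 / real (card ?L)" if "R \<in> ?L" for R
    using Z that unfolding uniform_increasing_indexing_def by blast
  have finL: "finite ?L"
  proof (rule finite_subset)
    show "?L \<subseteq> Pow (?S \<times> ?S)"
      by (auto simp: linear_order_on_def partial_order_on_def preorder_on_def)
  qed (use S in simp)
  have finF: "finite ?F" by (rule finite_subset[OF _ finL]) auto
  have neL: "?L \<noteq> {}" using well_order_on[of ?S] by (auto simp: well_order_on_def)
  have cL: "0 < card ?L" using finL neL by (simp add: card_gt_0_iff)
  have "finite I" using S I finite_subset by blast
  then have cI: "0 < card I" using I by (auto simp: card_gt_0_iff)
  have "real (card ?L) \<le> real (card I * card ?F)"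
    by (intro of_nat_mono card_linear_orders_first S I)
  then have "1 / real (card I) \<le> real (card ?F) / real (card ?L)"
    using cL cI by (simp add: field_simps)
  also have "\<dots> = (\<Sum>R\<in>?F. prob {\<omega> \<in> space P. ?o \<omega> = R})"
    using unifo by simp
  also have "\<dots> = prob (\<Union>R\<in>?F. {\<omega> \<in> space P. ?o \<omega> = R})"
    using finF ev by (intro finite_measure_finite_Union[symmetric]) (auto simp: disjoint_family_on_def)
  also have "\<dots> \<le> prob {\<omega> \<in> space P. \<forall>x\<in>I. (s, x) \<in> ?o \<omega>}"
  proof (rule finite_measure_mono)
    have "?o -` {R. \<forall>x\<in>I. (s, x) \<in> R} \<inter> space P \<in> events" by (rule measurable_sets[OF rv]) simp
    then show "{\<omega> \<in> space P. \<forall>x\<in>I. (s, x) \<in> ?o \<omega>} \<in> events"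
      by (simp add: vimage_def Int_def conj_commute)
  qed auto
  finally show ?thesis .
qed

section \<open>Independence of marks and indexings\<close>

lemma (in prob_space) indep_sets_Inl:
  fixes f :: "'i \<Rightarrow> 'a set set" and g :: "'j \<Rightarrow> 'a set set"
  assumes "indep_sets (case_sum f g) UNIV"
  shows "indep_sets f UNIV"
proof (rule indep_setsI)
  show "f i \<subseteq> events" for i
    using assms unfolding indep_sets_def by (metis UNIV_I old.sum.simps(5))
  fix A J assume J: "J \<noteq> {}" "finite J" "\<forall>j\<in>J. A j \<in> f j"
  let ?J = "(Inl :: 'i \<Rightarrow> 'i + 'j) ` J"
  have "prob (\<Inter>j\<in>?J. case_sum A (\<lambda>_. {}) j) = (\<Prod>j\<in>?J. prob (case_sum A (\<lambda>_. {}) j))"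
    using J by (intro indep_setsD[OF assms]) auto
  then show "prob (\<Inter>j\<in>J. A j) = (\<Prod>j\<in>J. prob (A j))" by (simp add: prod.reindex)
qed

lemma distr_field_of_indep:
  fixes \<tau> :: "'v \<Rightarrow> 'a \<Rightarrow> real"
  assumes P: "prob_space P"
    and indep: "prob_space.indep_sets P (\<lambda>v. sets (vimage_algebra (space P) (\<tau> v) borel)) UNIV"
    and \<tau>: "\<And>v. \<tau> v \<in> borel_measurable P" "\<And>v. distr P borel (\<tau> v) = \<nu>"
    and F: "F \<in> borel_measurable borel" "distr \<nu> borel F = unif"
  shows "(\<lambda>\<omega> v. F (\<tau> v \<omega>)) \<in> measurable P unif_field"
    and "distr P unif_field (\<lambda>\<omega> v. F (\<tau> v \<omega>)) = unif_field"
proof -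
  interpret prob_space P by (rule P)
  let ?X = "\<lambda>\<omega> v. F (\<tau> v \<omega>)"
  have Xv: "(\<lambda>\<omega>. F (\<tau> v \<omega>)) \<in> borel_measurable P" for v
    by (rule measurable_compose[OF \<tau>(1) F(1)])
  have XP: "?X \<in> measurable P (\<Pi>\<^sub>M _\<in>UNIV. borel)"
    by (rule measurable_PiM_single') (use Xv in \<open>auto simp: PiE_def\<close>)
  then show "?X \<in> measurable P unif_field" by (simp add: sets_field cong: measurable_cong_sets)
  have "indep_vars (\<lambda>_. borel) \<tau> UNIV"
    unfolding indep_vars_def2 using indep \<tau>(1) by (simp add: sets_vimage_algebra2)
  then have "indep_vars (\<lambda>_. borel) (\<lambda>v \<omega>. F (\<tau> v \<omega>)) UNIV"
    by (rule indep_vars_compose2) (rule F(1))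
  then have "distr P (\<Pi>\<^sub>M _\<in>UNIV. borel) (\<lambda>\<omega>. \<lambda>v\<in>UNIV. F (\<tau> v \<omega>))
      = (\<Pi>\<^sub>M v\<in>UNIV. distr P borel (\<lambda>\<omega>. F (\<tau> v \<omega>)))"
    by (subst (asm) indep_vars_iff_distr_eq_PiM) (use Xv in auto)
  moreover have "distr P borel (\<lambda>\<omega>. F (\<tau> v \<omega>)) = unif" for v
    using distr_distr[OF F(1) \<tau>(1)[of v]] \<tau>(2)[of v] F(2)
    by (simp add: comp_def cong: measurable_cong_sets)
  ultimately have "distr P (\<Pi>\<^sub>M _\<in>UNIV. borel) ?X = unif_field" by (simp add: unif_field_def restrict_def)
  moreover have "distr P unif_field ?X = distr P (\<Pi>\<^sub>M _\<in>UNIV. borel) ?X"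
    by (rule distr_cong) (simp_all add: sets_field)
  ultimately show "distr P unif_field ?X = unif_field" by simp
qed

text \<open>
  The arrival times are grouped together, each E v forms a group of its own.
\<close>

lemma indep_field_marks:
  fixes \<tau> :: "'v \<Rightarrow> 'a \<Rightarrow> real" and E :: "'v \<Rightarrow> 'a set set"
  assumes P: "prob_space P"
    and indep: "prob_space.indep_sets P (case_sum (\<lambda>v. sets (vimage_algebra (space P) (\<tau> v) borel)) E) UNIV"
    and E: "\<And>v. sigma_algebra (space P) (E v)"
    and F: "F \<in> borel_measurable borel"
    and A: "A \<in> sets (unif_field :: ('v \<Rightarrow> real) measure)"
  defines "B \<equiv> (\<lambda>\<omega> v. F (\<tau> v \<omega>)) -` A \<inter> space P"
  shows "C \<in> E v \<Longrightarrow> measure P (B \<inter> C) = measure P B * measure P C"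
    and "C \<in> E v \<Longrightarrow> C' \<in> E w \<Longrightarrow> v \<noteq> w \<Longrightarrow>
      measure P (B \<inter> C \<inter> C') = measure P B * measure P C * measure P C'"
proof -
  interpret prob_space P by (rule P)
  let ?G = "case_sum (\<lambda>v. sets (vimage_algebra (space P) (\<tau> v) borel)) E"
  define I :: "'v option \<Rightarrow> ('v + 'v) set" where "I = case_option (range Inl) (\<lambda>v. {Inr v})"
  define H where "H j = sigma_sets (space P) (\<Union>i\<in>I j. ?G i)" for j
  have "indep_sets H UNIV"
    unfolding H_def
  proof (rule indep_sets_collect_sigma)
    have "(\<Union>j. I j) = UNIV"
    proof (intro equalityI subsetI UNIV_I)
      fix x :: "'v + 'v" show "x \<in> (\<Union>j. I j)"
      proof (cases x)
        case (Inl a)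
        then have "x \<in> I None" by (simp add: I_def)
        then show ?thesis by blast
      next
        case (Inr a)
        then have "x \<in> I (Some a)" by (simp add: I_def)
        then show ?thesis by blast
      qed
    qed
    then show "indep_sets ?G (\<Union>j\<in>UNIV. I j)" using indep by simp
    show "Int_stable (?G i)" for i
    proof (cases i)
      case (Inl a)
      then show ?thesis by (simp add: sets.Int_stable)
    next
      case (Inr a)
      interpret Ea: sigma_algebra "space P" "E a" by (rule E)
      show ?thesis using Inr Ea.Int by (simp add: Int_stable_def)
    qed
    show "disjoint_family_on I UNIV"
      by (auto simp: disjoint_family_on_def I_def split: option.splits)
  qed
  have B: "B \<in> H None"
  proof -
    define N where "N = sigma (space P) (\<Union>v. sets (vimage_algebra (space P) (\<tau> v) borel))"
    have sub: "(\<Union>v. sets (vimage_algebra (space P) (\<tau> v) borel)) \<subseteq> Pow (space P)"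
      using sets.sets_into_space[where M="vimage_algebra (space P) (\<tau> _) borel"] by fastforce
    have sN: "sets N = sigma_sets (space P) (\<Union>v. sets (vimage_algebra (space P) (\<tau> v) borel))"
      and spN: "space N = space P"
      unfolding N_def using sub by (simp_all add: sets_measure_of space_measure_of)
    have \<tau>N: "\<tau> v \<in> borel_measurable N" for v
    proof (rule measurableI)
      fix C :: "real set" assume "C \<in> sets borel"
      then have "\<tau> v -` C \<inter> space P \<in> sets (vimage_algebra (space P) (\<tau> v) borel)"
        by (auto simp: sets_vimage_algebra2)
      then show "\<tau> v -` C \<inter> space N \<in> sets N" unfolding sN spN by (intro sigma_sets.Basic) blast
    qed simp
    have "(\<lambda>\<omega> v. F (\<tau> v \<omega>)) \<in> measurable N (\<Pi>\<^sub>M _\<in>UNIV. borel)"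
      by (rule measurable_PiM_single') (use measurable_compose[OF \<tau>N F] in \<open>auto simp: PiE_def\<close>)
    then have "(\<lambda>\<omega> v. F (\<tau> v \<omega>)) \<in> measurable N unif_field" by (simp add: sets_field cong: measurable_cong_sets)
    from measurable_sets[OF this A] have "B \<in> sets N" by (simp add: B_def spN)
    moreover have "H None = sets N" unfolding sN H_def I_def by simp
    ultimately show ?thesis by simp
  qed
  have HE: "C \<in> H (Some v)" if "C \<in> E v" for C v
    unfolding H_def I_def using that by (auto intro: sigma_sets.Basic)
  show "measure P (B \<inter> C) = measure P B * measure P C" if C: "C \<in> E v"
  proof -
    have "prob (\<Inter>j\<in>{None, Some v}. (case j of None \<Rightarrow> B | Some _ \<Rightarrow> C))
        = (\<Prod>j\<in>{None, Some v}. prob (case j of None \<Rightarrow> B | Some _ \<Rightarrow> C))"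
      using B HE[OF C] by (intro indep_setsD[OF \<open>indep_sets H UNIV\<close>]) auto
    then show ?thesis by simp
  qed
  show "measure P (B \<inter> C \<inter> C') = measure P B * measure P C * measure P C'"
    if C: "C \<in> E v" "C' \<in> E w" "v \<noteq> w"
  proof -
    let ?A = "\<lambda>j. case j of None \<Rightarrow> B | Some x \<Rightarrow> if x = v then C else C'"
    have "prob (\<Inter>j\<in>{None, Some v, Some w}. ?A j) = (\<Prod>j\<in>{None, Some v, Some w}. prob (?A j))"
      using B HE[OF C(1)] HE[OF C(2)] C(3) by (intro indep_setsD[OF \<open>indep_sets H UNIV\<close>]) auto
    then show ?thesis using C(3) by (simp add: Int_assoc mult.assoc not_sym[OF C(3)])
  qed
qed

lemma sets_induced_order:
  "{f. (x, y) \<in> induced_order S f} \<in> sets (PiM (UNIV :: nat set) (\<lambda>_. count_space (UNIV :: 'v set)))"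
proof -
  let ?M = "PiM (UNIV :: nat set) (\<lambda>_. count_space (UNIV :: 'v set))"
  have comp: "{f \<in> space ?M. f i = a} \<in> sets ?M" for i a
    using measurable_sets[OF measurable_component_singleton[of i UNIV "\<lambda>_. count_space UNIV"], of "{a}"]
    by (simp add: vimage_def Int_def conj_commute)
  have "{f \<in> space ?M. \<exists>i j. i \<le> j \<and> f i = x \<and> f j = y} \<in> sets ?M"
    by (intro sets.sets_Collect_countable_Ex sets.sets_Collect_conj sets.sets_Collect_const comp)
  moreover have "{f. (x, y) \<in> induced_order S f}
      = (if x \<in> S \<and> y \<in> S then {f \<in> space ?M. \<exists>i j. i \<le> j \<and> f i = x \<and> f j = y} else {})"
    by (auto simp: induced_order_def space_PiM PiE_def)
  ultimately show ?thesis by simp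
qed

lemma (in tree_metric) AE_field_distinct:
  assumes "u \<noteq> v"
  shows "AE x in (unif_field :: ('v \<Rightarrow> real) measure). x u \<noteq> x v"
proof -
  have eq: "{x :: 'v \<Rightarrow> real. x u = x v} \<in> sets (unif_field :: ('v \<Rightarrow> real) measure)"
  proof -
    have "{x \<in> space unif_field. x u = (x v :: real)} \<in> sets (unif_field :: ('v \<Rightarrow> real) measure)" by measurable
    then show ?thesis by simp
  qed
  have zero: "(\<integral>\<^sup>+y. indicator {p. fst p = snd p} (s, y) \<partial>unif) = 0" for s :: real
  proof -
    have "(\<integral>\<^sup>+y. indicator {p. fst p = snd p} (s, y) \<partial>unif) = (\<integral>\<^sup>+y. indicator {s} y \<partial>unif)"
      by (intro nn_integral_cong) (auto simp: indicator_def)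
    also have "\<dots> = emeasure unif {s}" by simp
    also have "\<dots> = 0"
    proof -
      have "emeasure lborel ({0..1} \<inter> {s}) \<le> emeasure lborel {s}" by (intro emeasure_mono) auto
      then have "emeasure lborel ({0..1} \<inter> {s}) = 0" by simp
      then show ?thesis unfolding unif_def by (subst emeasure_uniform_measure) auto
    qed
    finally show ?thesis .
  qed
  have "emeasure unif_field {x. x u = (x v :: real)}
      = (\<integral>\<^sup>+(x :: 'v \<Rightarrow> real). 1 * indicator {p. fst p = snd p} (x u, x v) \<partial>unif_field)"
    unfolding nn_integral_indicator[OF eq, symmetric] by (intro nn_integral_cong) (auto simp: indicator_def)
  also have "\<dots> = (\<integral>\<^sup>+(x :: 'v \<Rightarrow> real). 1 * (\<integral>\<^sup>+y. indicator {p. fst p = snd p} (x u, y) \<partial>unif) \<partial>unif_field)"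
    by (rule nn_integral_resample_point[where g="\<lambda>s y. indicator {p. fst p = snd p} (s, y)"])
      (use assms in \<open>simp_all\<close>)
  also have "\<dots> = 0" by (simp only: zero mult_zero_right nn_integral_0_iff_AE nn_integral_const) simp
  finally have "{x. x u = x v} \<in> null_sets (unif_field :: ('v \<Rightarrow> real) measure)" using eq by (auto simp: null_sets_def)
  from AE_not_in[OF this] show ?thesis by simp
qed

section \<open>The children of a seed\<close>

text \<open>
  Choose y in the cell farther from r than all seeds. Then y separates the vertices behind it from
  every seed, so that r is as close to them as any other seed because it is so for y.
\<close>

lemma (in tree_metric) cell_contains_cone:
  assumes S: "finite S" "r \<in> S" and inf: "infinite {v. \<forall>x\<in>S. d v r \<le> d v x}"
  shows "\<exists>y. 1 \<le> d r y \<and> (\<forall>v. btw r y v \<longrightarrow> v \<notin> S \<and> (\<forall>x\<in>S. d v r \<le> d v x))"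
proof -
  \<comment> \<open>A bound for the distances from r to the seeds.\<close>
  define R where "R = (\<Sum>x\<in>S. d r x)"
  have R: "d r x \<le> R" if "x \<in> S" for x unfolding R_def using that S by (intro member_le_sum) auto
  have "\<not> {v. \<forall>x\<in>S. d v r \<le> d v x} \<subseteq> {v. d r v < Suc R}"
    using inf finite_subset[OF _ finite_dist_less] by blast
  then obtain y where "y \<in> {v. \<forall>x\<in>S. d v r \<le> d v x}" "y \<notin> {v. d r v < Suc R}" by blast
  then have y: "\<forall>x\<in>S. d y r \<le> d y x" "R < d r y" by simp_all
  have "v \<notin> S \<and> (\<forall>x\<in>S. d v r \<le> d v x)" if v: "btw r y v" for v
  proof (intro conjI ballI)
    show "v \<notin> S" using R[of v] v y(2) unfolding btw_def by auto
    fix x assume x: "x \<in> S"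
    have "\<not> btw r y x" using R[OF x] y(2) unfolding btw_def by simp
    then have "btw x y v" using tripod[OF v, of x] by simp
    then show "d v r \<le> d v x" using v bspec[OF y(1) x]
        dist_sym[of v r] dist_sym[of v x] dist_sym[of y r] dist_sym[of y x] unfolding btw_def by linarith
  qed
  then show ?thesis using y(2) by (intro exI[of _ y]) auto
qed

context measurable_coloring
begin

text \<open>
  The indexing at v meets r before any other seed, and the vertices that it meets before r are at
  most as far from v as r, hence arrive no earlier than v.
\<close>

lemma marked_minimum_is_child:
  assumes \<omega>: "\<omega> \<in> space P" and pos: "\<And>v. 0 < \<tau> v \<omega>" and dist: "\<And>u v. u \<noteq> v \<Longrightarrow> X \<omega> u \<noteq> X \<omega> v"
    and r: "r \<in> S" "v \<notin> S" "\<And>x. x \<in> S \<Longrightarrow> d v r \<le> d v x"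
    and min: "X \<omega> \<in> local_min v (d r v)"
    and first: "\<And>x. x \<in> S \<Longrightarrow> d v x = d v r \<Longrightarrow> \<exists>i k. i \<le> k \<and> z v \<omega> i = r \<and> z v \<omega> k = x"
  shows "par' \<omega> v = Some r"
proof -
  note inc = increasing_z[OF \<omega>]
  have bij: "bij (z v \<omega>)" using inc by (simp add: increasing_def)
  obtain j where j: "z v \<omega> j = r" using bij by (metis bij_pointE)
  have "\<not> reset \<omega> (z v \<omega> i) < reset \<omega> v" if i: "i < j" for i
  proof
    assume lt: "reset \<omega> (z v \<omega> i) < reset \<omega> v"
    let ?u = "z v \<omega> i"
    have du: "d v ?u \<le> d v r" using inc i j unfolding increasing_def by blast
    show False
    proof (cases "?u \<in> S")
      case True
      then have "d v ?u = d v r" using du r(3) by (simp add: le_antisym)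
      then obtain i' k where ik: "i' \<le> k" "z v \<omega> i' = r" "z v \<omega> k = ?u" using first[OF True] by blast
      then have "i' = j" "k = i" using bij j by (auto simp: bij_def inj_def)
      then show False using ik i by simp
    next
      case False
      then have t: "\<tau> ?u \<omega> < \<tau> v \<omega>" using lt r(2) by (simp add: reset_def)
      then have uv: "?u \<noteq> v" by auto
      then have "?u \<in> punctured v (d r v)" using du dist_sym[of r v] by (simp add: punctured_def)
      then have "X \<omega> v \<le> X \<omega> ?u" using min by (simp add: local_min_def)
      moreover have "X \<omega> ?u \<le> X \<omega> v" using X_mono[OF \<omega>] t by simp
      ultimately show False using dist[OF uv] by simp
    qed
  qed
  moreover have "reset \<omega> (z v \<omega> j) < reset \<omega> v" using r(1,2) pos[of v] j by (simp add: reset_def)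
  ultimately show ?thesis unfolding par'_eq[OF r(2)] parent_Some_iff using j by blast
qed

text \<open>
  A seed closer to v than r would be met before r.
\<close>

lemma child_in_cell:
  assumes \<omega>: "\<omega> \<in> space P" and pos: "\<And>v. 0 < \<tau> v \<omega>" and c: "par' \<omega> v = Some r" and x: "x \<in> S"
  shows "d v r \<le> d v x"
proof (rule ccontr)
  assume "\<not> d v r \<le> d v x"
  then have lt: "d v x < d v r" by simp
  have v: "v \<notin> S" using c by (auto simp: par'_def seeded_parent_def)
  have "reset \<omega> v \<le> reset \<omega> x"
    using parent_SomeD(2)[OF increasing_z[OF \<omega>], of "reset \<omega>" v r x] c lt unfolding par'_eq[OF v] by simp
  then show False using v x pos[of v] by (simp add: reset_def)
qed

lemma AE_finite_children:
  assumes "finite {v. \<forall>x\<in>S. d v r \<le> d v x}"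
  shows "AE \<omega> in P. finite {c. par' \<omega> c = Some r}"
proof -
  have "AE \<omega> in P. \<forall>v. 0 < \<tau> v \<omega>" by (intro AE_all_vertices AE_pos)
  then show ?thesis using AE_space
  proof eventually_elim
    case (elim \<omega>)
    then have "{c. par' \<omega> c = Some r} \<subseteq> {v. \<forall>x\<in>S. d v r \<le> d v x}" using child_in_cell by blast
    then show ?case using assms by (rule finite_subset)
  qed
qed

lemma AE_infinite_children:
  assumes r: "r \<in> S" and inf: "infinite {v. \<forall>x\<in>S. d v r \<le> d v x}"
    and c: "0 < c" "\<And>v. c \<le> measure P (Z v)" and Zsets: "\<And>v. Z v \<in> sets P"
    and first: "\<And>v x \<omega>. \<omega> \<in> Z v \<Longrightarrow> x \<in> S \<Longrightarrow> d v x = d v r \<Longrightarrow> \<exists>i k. i \<le> k \<and> z v \<omega> i = r \<and> z v \<omega> k = x"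
    and indep1: "\<And>A v. A \<in> sets unif_field \<Longrightarrow>
      measure P ((X -` A \<inter> space P) \<inter> Z v) = measure P (X -` A \<inter> space P) * measure P (Z v)"
    and indep2: "\<And>A v w. A \<in> sets unif_field \<Longrightarrow> v \<noteq> w \<Longrightarrow>
      measure P ((X -` A \<inter> space P) \<inter> Z v \<inter> Z w) = measure P (X -` A \<inter> space P) * measure P (Z v) * measure P (Z w)"
  shows "AE \<omega> in P. infinite {c. par' \<omega> c = Some r}"
proof -
  obtain y where y: "1 \<le> d r y" "\<And>v. btw r y v \<Longrightarrow> v \<notin> S" "\<And>v x. btw r y v \<Longrightarrow> x \<in> S \<Longrightarrow> d v r \<le> d v x"
    using cell_contains_cone[OF finite_S r inf] by blast
  have "AE \<omega> in P. infinite {v. btw r y v \<and> X \<omega> \<in> local_min v (d r v) \<and> \<omega> \<in> Z v}"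
    by (rule AE_infinite_marked_minima[where c=c])
      (use prob_space_axioms measurable_X distr_X y(1) Zsets c indep1 indep2 in auto)
  moreover have "AE \<omega> in P. \<forall>v. 0 < \<tau> v \<omega>" by (intro AE_all_vertices AE_pos)
  moreover have "AE \<omega> in P. \<forall>u v. u \<noteq> v \<longrightarrow> X \<omega> u \<noteq> X \<omega> v"
  proof (intro AE_all_vertices)
    fix u v :: 'v
    show "AE \<omega> in P. u \<noteq> v \<longrightarrow> X \<omega> u \<noteq> X \<omega> v"
    proof (cases "u = v")
      case False
      have "AE x in distr P unif_field X. x u \<noteq> x v" unfolding distr_X by (rule AE_field_distinct[OF False])
      then have "AE \<omega> in P. X \<omega> u \<noteq> X \<omega> v" by (rule AE_distrD[OF measurable_X])
      then show ?thesis by eventually_elim simp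
    qed simp
  qed
  ultimately show ?thesis using AE_space
  proof eventually_elim
    case (elim \<omega>)
    have "{v. btw r y v \<and> X \<omega> \<in> local_min v (d r v) \<and> \<omega> \<in> Z v} \<subseteq> {c. par' \<omega> c = Some r}"
    proof (intro subsetI CollectI)
      fix v assume "v \<in> {v. btw r y v \<and> X \<omega> \<in> local_min v (d r v) \<and> \<omega> \<in> Z v}"
      then have v: "btw r y v" "X \<omega> \<in> local_min v (d r v)" "\<omega> \<in> Z v" by auto
      show "par' \<omega> v = Some r"
        by (rule marked_minimum_is_child[OF elim(4)])
          (use elim(2,3) r y(2)[OF v(1)] y(3)[OF v(1)] v(2) first[OF v(3)] in auto)
    qed
    then show ?case using elim(1) finite_subset by blast
  qed
qed

end

section \<open>The decomposition with seeds\<close>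

lemma measurable_coloring_of_randomness:
  assumes K: "2 \<le> K" and T: "regular_tree (K + 1) T" and R: "coloring_randomness P T \<nu> \<tau> z" and S: "finite S"
  shows "measurable_coloring (gdist T) K P \<tau> z (\<lambda>\<omega> v. cdf \<nu> (\<tau> v \<omega>)) S (cdf \<nu>)"
proof -
  interpret prob_space P using R by (simp add: coloring_randomness_def)
  interpret tree_metric "gdist T" K by (rule tree_metric_gdist[OF T K])
  have \<nu>: "prob_space \<nu>" "sets \<nu> = sets borel" "emeasure \<nu> {0<..} = 1" "\<And>x. emeasure \<nu> {x} = 0"
    and \<tau>: "\<And>v. \<tau> v \<in> borel_measurable P" "\<And>v. distr P borel (\<tau> v) = \<nu>"
    and Z: "\<And>w. uniform_increasing_indexing P T w (z w)"
    and indep: "indep_sets (case_sum (\<lambda>v. sets (vimage_algebra (space P) (\<tau> v) borel))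
         (\<lambda>w. sets (vimage_algebra (space P) (z w) (PiM UNIV (\<lambda>_. count_space UNIV))))) UNIV"
    using R by (simp_all add: coloring_randomness_def atomless_on_positive_reals_def)
  interpret \<nu>: real_distribution \<nu>
    using \<nu> by (simp add: real_distribution_def real_distribution_axioms_def)
  have mono: "mono (cdf \<nu>)" using \<nu>.cdf_nondecreasing by (auto simp: mono_def)
  have F: "cdf \<nu> \<in> borel_measurable borel" by (rule borel_measurable_mono[OF mono])
  note X = distr_field_of_indep[OF prob_space_axioms indep_sets_Inl[OF indep] \<tau> F
      distr_cdf_uniform[OF \<nu>(1,2,4)]]
  show ?thesis
  proof
    show "(\<lambda>\<omega> v. cdf \<nu> (\<tau> v \<omega>)) \<in> measurable P unif_field" by (rule X(1))
    show "distr P unif_field (\<lambda>\<omega> v. cdf \<nu> (\<tau> v \<omega>)) = unif_field" by (rule X(2))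
    show "cdf \<nu> (\<tau> u \<omega>) \<le> cdf \<nu> (\<tau> v \<omega>)" if "\<tau> u \<omega> \<le> \<tau> v \<omega>" for u v \<omega>
      using that by (rule \<nu>.cdf_nondecreasing)
    show "increasing (\<lambda>v. z v \<omega>)" if "\<omega> \<in> space P" for \<omega>
      using Z that unfolding increasing_def uniform_increasing_indexing_def by blast
    show "cdf \<nu> \<in> borel_measurable borel" by (rule F)
    show "finite S" by (rule S)
    show "\<tau> v \<in> borel_measurable P" for v by (rule \<tau>(1))
    show "z v \<in> measurable P (PiM UNIV (\<lambda>_. count_space UNIV))" for v
      using Z[of v] by (simp add: uniform_increasing_indexing_def)
    show "AE \<omega> in P. 0 < \<tau> v \<omega>" for v
    proof -
      have "AE x in \<nu>. x \<in> {0<..}"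
      proof (rule \<nu>.AE_prob_1)
        show "\<nu>.prob {0<..} = 1" using \<nu>(3) by (simp add: measure_def)
      qed
      then have "AE x in distr P borel (\<tau> v). 0 < x" unfolding \<tau>(2) by simp
      then show ?thesis by (rule AE_distrD[OF \<tau>(1)])
    qed
  qed simp
qed

theorem theorem3:
  fixes K M :: nat
    and T :: "'v pair_pre_digraph" and rt :: 'v
    and P :: "'a measure" and \<nu> :: "real measure"
    and \<tau> :: "'v \<Rightarrow> 'a \<Rightarrow> real" and z :: "'v \<Rightarrow> 'a \<Rightarrow> nat \<Rightarrow> 'v"
    and s :: "nat \<Rightarrow> 'v"
  assumes "2 \<le> K"
    and "regular_tree (K + 1) T"
    and "coloring_randomness P T \<nu> \<tau> z"
    and "1 \<le> M"
    and "inj_on s {1..M}"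
  defines "p \<equiv> \<lambda>\<omega>. parent (\<lambda>v. \<tau> v \<omega>) (\<lambda>v. z v \<omega>)"
    and "p' \<equiv> \<lambda>\<omega>. seeded_parent (s ` {1..M}) (\<lambda>v. \<tau> v \<omega>) (\<lambda>v. z v \<omega>)"
  defines "G \<equiv> \<lambda>\<omega>. genealogical_graph (p \<omega>)"
    and "G' \<equiv> \<lambda>\<omega>. genealogical_graph (p' \<omega>)"
  defines "U \<equiv> \<lambda>\<omega> j. component_of (G' \<omega>) (s j)"
    and "D \<equiv> \<lambda>v \<omega>. descendants (p' \<omega>) v"
  shows "(AE \<omega> in P. \<exists>C' :: 'v graph \<Rightarrow> 'v graph.
            bij_betw (case_sum C' (U \<omega>)) (components (G \<omega>) <+> {1..M}) (components (G' \<omega>)) \<and>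
            (\<forall>C \<in> components (G \<omega>).
               subgraph (C' C) C \<and> oriented_tree (C' C) \<and> infinite (verts (C' C)) \<and>
               (\<exists>\<xi>. has_direction T rt (p \<omega>) C \<xi> \<and> has_direction T rt (p' \<omega>) (C' C) \<xi>)))
       \<and> (\<forall>j \<in> {1..M}.
            (AE \<omega> in P.
               oriented_tree_rooted_at (U \<omega> j) (s j) \<and>
               (\<forall>v \<in> verts (U \<omega> j) - {s j}. finite (D v \<omega>) \<and> cond_exp_card P (\<tau> v) (D v) \<omega> < \<infinity>) \<and>
               (infinite (verts (U \<omega> j)) \<longleftrightarrow> infinite_degree (U \<omega> j) (s j))) \<and>
            {\<omega> \<in> space P. infinite_degree (U \<omega> j) (s j)} \<in> sets P \<and>
            measure P {\<omega> \<in> space P. infinite_degree (U \<omega> j) (s j)} =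
              (if infinite {v. gdist T v (s j) = (MIN i\<in>{1..M}. gdist T v (s i))} then 1 else 0))
       \<and> (\<forall>v. (\<lambda>\<omega>. emeasure (count_space UNIV) (D v \<omega>)) \<in> borel_measurable P)"
proof -
  define S where "S = s ` {1..M}"
  define X where "X = (\<lambda>\<omega> v. cdf \<nu> (\<tau> v \<omega>))"
  have S: "finite S" by (simp add: S_def)
  interpret measurable_coloring "gdist T" K P \<tau> z X S "cdf \<nu>"
    unfolding X_def by (rule measurable_coloring_of_randomness[OF assms(1-3) S])
  have p: "p = par" unfolding p_def par_def[abs_def] ..
  have p': "p' = par'"
  proof
    fix \<omega> show "p' \<omega> = par' \<omega>" unfolding p'_def par'_def by (simp only: S_def)
  qed
  have Z: "\<And>w. uniform_increasing_indexing P T w (z w)"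
    and indep: "indep_sets (case_sum (\<lambda>v. sets (vimage_algebra (space P) (\<tau> v) borel))
         (\<lambda>w. sets (vimage_algebra (space P) (z w) (PiM UNIV (\<lambda>_. count_space UNIV))))) UNIV"
    using assms(3) by (simp_all add: coloring_randomness_def)
  have U: "U \<omega> j = kin (par' \<omega>) (s j)" for \<omega> j
    unfolding U_def G'_def p' by (rule component_of_genealogical)
  have root: "par' \<omega> (s j) = None" if "j \<in> {1..M}" for \<omega> j
  proof -
    have "s j \<in> S" using that by (simp add: S_def)
    then show ?thesis by (simp add: par'_def seeded_parent_def)
  qed
  have deg: "infinite_degree (U \<omega> j) (s j) \<longleftrightarrow> infinite {c. par' \<omega> c = Some (s j)}" if "j \<in> {1..M}" for \<omega> j
    unfolding U by (rule infinite_degree_kin_root[of "par' \<omega>" "s j", OF root[OF that]])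

  have 1: "AE \<omega> in P. \<exists>C' :: 'v graph \<Rightarrow> 'v graph.
            bij_betw (case_sum C' (U \<omega>)) (components (G \<omega>) <+> {1..M}) (components (G' \<omega>)) \<and>
            (\<forall>C \<in> components (G \<omega>).
               subgraph (C' C) C \<and> oriented_tree (C' C) \<and> infinite (verts (C' C)) \<and>
               (\<exists>\<xi>. has_direction T rt (p \<omega>) C \<xi> \<and> has_direction T rt (p' \<omega>) (C' C) \<xi>))"
    using AE_rerouting AE_short_jumps
  proof eventually_elim
    case (elim \<omega>)
    interpret rerouting "par \<omega>" "par' \<omega>" S "\<lambda>v. \<tau> v \<omega>" "reset \<omega>" by (rule elim(1))
    show ?case
    proof (intro exI[of _ trunk] conjI ballI)
      show "bij_betw (case_sum trunk (U \<omega>)) (components (G \<omega>) <+> {1..M}) (components (G' \<omega>))"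
        using bij_betw_components[OF assms(5) S_def[symmetric]]
        unfolding U_def G_def G'_def p p' .
      fix C assume "C \<in> components (G \<omega>)"
      then obtain v where C: "C = kin (par \<omega>) v" unfolding G_def p components_genealogical by auto
      show "subgraph (trunk C) C" "oriented_tree (trunk C)" "infinite (verts (trunk C))"
        unfolding C by (rule subgraph_trunk oriented_tree_trunk infinite_trunk)+
      have "\<exists>\<xi>. has_direction T rt (par \<omega>) (kin (par \<omega>) v) \<xi>"
        using elim(2) unfolding short_jumps_def
        by (intro has_direction_kin[OF assms(2,1)] p_total) blast
      then show "\<exists>\<xi>. has_direction T rt (p \<omega>) C \<xi> \<and> has_direction T rt (p' \<omega>) (trunk C) \<xi>"
        unfolding C p p' using has_direction_trunk by blast
    qed
  qed

  have 2: "AE \<omega> in P. oriented_tree_rooted_at (U \<omega> j) (s j) \<and>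
      (\<forall>v \<in> verts (U \<omega> j) - {s j}. finite (D v \<omega>) \<and> cond_exp_card P (\<tau> v) (D v) \<omega> < \<infinity>) \<and>
      (infinite (verts (U \<omega> j)) \<longleftrightarrow> infinite_degree (U \<omega> j) (s j))" if j: "j \<in> {1..M}" for j
  proof -
    have "AE \<omega> in P. \<forall>v. v \<notin> S \<longrightarrow> finite (descendants (par' \<omega>) v)"
      using AE_finite_descendants by (intro AE_all_vertices) (auto intro: AE_I2)
    moreover have "AE \<omega> in P. \<forall>v. v \<notin> S \<longrightarrow> cond_exp_card P (\<tau> v) (\<lambda>\<omega>. descendants (par' \<omega>) v) \<omega> < \<infinity>"
      using AE_cond_exp_descendants by (intro AE_all_vertices) (auto intro: AE_I2)
    ultimately show ?thesis using AE_rerouting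
    proof eventually_elim
      case (elim \<omega>)
      interpret rerouting "par \<omega>" "par' \<omega>" S "\<lambda>v. \<tau> v \<omega>" "reset \<omega>" by (rule elim(3))
      have notS: "v \<notin> S" if v: "v \<in> verts (U \<omega> j) - {s j}" for v
      proof
        assume "v \<in> S"
        then have vr: "par' \<omega> v = None" using p'_None_iff by simp
        obtain n where "ancestor (par' \<omega>) n v = Some (s j)"
          using v coalesce_root_iff[of "par' \<omega>" "s j" v, OF root[OF j]] unfolding U by auto
        then have "s j = v" by (rule ancestor_of_root[of "par' \<omega>" v n "s j", OF vr])
        then show False using v by simp
      qed
      have "infinite (verts (U \<omega> j)) \<longleftrightarrow> infinite_degree (U \<omega> j) (s j)"
        unfolding deg[OF j] unfolding U
      proof (rule infinite_verts_kin_root_iff[of "par' \<omega>" "s j", OF root[OF j]])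
        fix c assume "par' \<omega> c = Some (s j)"
        then have "c \<notin> S" using p'_None_iff[of c] by auto
        then show "finite (descendants (par' \<omega>) c)" using elim(1) by blast
      qed
      moreover have "oriented_tree_rooted_at (U \<omega> j) (s j)"
        unfolding U by (rule oriented_tree_rooted_kin[of "par' \<omega>" "reset \<omega>" "s j", OF p'_descends root[OF j]])
      ultimately show ?case using elim(1,2) notS unfolding D_def p' by blast
    qed
  qed

  have 3: "{\<omega> \<in> space P. infinite_degree (U \<omega> j) (s j)} \<in> sets P" if j: "j \<in> {1..M}" for j
    unfolding deg[OF j] by (rule sets_infinite_children)

  have 4: "measure P {\<omega> \<in> space P. infinite_degree (U \<omega> j) (s j)} =
      (if infinite {v. gdist T v (s j) = (MIN i\<in>{1..M}. gdist T v (s i))} then 1 else 0)"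
    if j: "j \<in> {1..M}" for j
  proof -
    have jS: "s j \<in> S" using j by (simp add: S_def)
    have cell: "{v. gdist T v (s j) = (MIN i\<in>{1..M}. gdist T v (s i))} = {v. \<forall>x\<in>S. gdist T v (s j) \<le> gdist T v x}"
    proof (intro Collect_cong)
      fix v
      have "gdist T v (s j) = (MIN i\<in>{1..M}. gdist T v (s i))
          \<longleftrightarrow> (\<forall>a\<in>(\<lambda>i. gdist T v (s i)) ` {1..M}. gdist T v (s j) \<le> a)"
        using j by (subst eq_commute, subst Min_eq_iff) auto
      then show "gdist T v (s j) = (MIN i\<in>{1..M}. gdist T v (s i)) \<longleftrightarrow> (\<forall>x\<in>S. gdist T v (s j) \<le> gdist T v x)"
        by (simp add: S_def)
    qed
    show ?thesis
    proof (cases "infinite {v. \<forall>x\<in>S. gdist T v (s j) \<le> gdist T v x}")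
      case True
      \<comment> \<open>Zm v is the event that s j comes first in the indexing at v among the seeds at the same distance.\<close>
      define I where "I v = {x \<in> S. gdist T v x = gdist T v (s j)}" for v
      define C where "C v = {f. \<forall>x\<in>I v. (s j, x) \<in> induced_order (sphere_at T v (gdist T v (s j))) f}" for v
      define Zm where "Zm v = z v -` C v \<inter> space P" for v
      have finI: "finite (I v)" for v unfolding I_def using S by simp
      have jI: "s j \<in> I v" for v using jS by (simp add: I_def)
      have Isub: "I v \<subseteq> sphere_at T v (gdist T v (s j))" for v by (auto simp: I_def sphere_at_def)
      have Cs: "C v \<in> sets (PiM UNIV (\<lambda>_. count_space UNIV))" for v
      proof -
        have "C v = (\<Inter>x\<in>I v. {f. (s j, x) \<in> induced_order (sphere_at T v (gdist T v (s j))) f})"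
          by (auto simp: C_def)
        also have "\<dots> \<in> sets (PiM UNIV (\<lambda>_. count_space UNIV))"
          using finI jI by (intro sets.finite_INT sets_induced_order) auto
        finally show ?thesis .
      qed
      have ZE: "Zm v \<in> sets (vimage_algebra (space P) (z v) (PiM UNIV (\<lambda>_. count_space UNIV)))" for v
        unfolding Zm_def using Cs by (rule in_vimage_algebra)
      have alg: "sigma_algebra (space P) (sets (vimage_algebra (space P) (z v) (PiM UNIV (\<lambda>_. count_space UNIV))))" for v
        using sets.sigma_algebra_axioms[of "vimage_algebra (space P) (z v) (PiM UNIV (\<lambda>_. count_space UNIV))"] by simp
      have "AE \<omega> in P. infinite {c. par' \<omega> c = Some (s j)}"
      proof (rule AE_infinite_children[where Z=Zm and c="1 / real M"])
        show "s j \<in> S" by (rule jS)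
        show "infinite {v. \<forall>x\<in>S. gdist T v (s j) \<le> gdist T v x}" by (rule True)
        show "0 < 1 / real M" using assms(4) by simp
        show "Zm v \<in> sets P" for v unfolding Zm_def by (rule measurable_sets[OF measurable_index Cs])
        show "1 / real M \<le> measure P (Zm v)" for v
        proof -
          have "card (I v) \<le> card S" using S by (intro card_mono) (auto simp: I_def)
          also have "\<dots> \<le> M" unfolding S_def using card_image_le[of "{1..M}" s] by simp
          finally have "card (I v) \<le> M" .
          moreover have "0 < card (I v)" using finI jI by (auto simp: card_gt_0_iff)
          ultimately have "1 / real M \<le> 1 / real (card (I v))" by (intro divide_left_mono) auto
          also have "\<dots> \<le> measure P {\<omega> \<in> space P. \<forall>x\<in>I v. (s j, x) \<in> induced_order (sphere_at T v (gdist T v (s j))) (z v \<omega>)}"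
          proof (rule prob_first_among_ge[OF prob_space_axioms Z _ Isub jI])
            show "finite (sphere_at T v (gdist T v (s j)))"
              using finite_sphere[of v "gdist T v (s j)"] by (simp add: sphere_at_def sphere_def)
          qed
          also have "{\<omega> \<in> space P. \<forall>x\<in>I v. (s j, x) \<in> induced_order (sphere_at T v (gdist T v (s j))) (z v \<omega>)} = Zm v"
            by (auto simp: Zm_def C_def)
          finally show ?thesis .
        qed
        show "\<exists>i k. i \<le> k \<and> z v \<omega> i = s j \<and> z v \<omega> k = x"
          if "\<omega> \<in> Zm v" "x \<in> S" "gdist T v x = gdist T v (s j)" for v x \<omega>
          using that by (auto simp: Zm_def C_def I_def induced_order_def)
        fix A :: "('v \<Rightarrow> real) set" assume A: "A \<in> sets unif_field"
        note marks = indep_field_marks[OF prob_space_axioms indep alg measurable_F A, folded X_def]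
        show "measure P ((X -` A \<inter> space P) \<inter> Zm v) = measure P (X -` A \<inter> space P) * measure P (Zm v)" for v
          by (rule marks(1)[OF ZE])
        show "measure P ((X -` A \<inter> space P) \<inter> Zm v \<inter> Zm w)
            = measure P (X -` A \<inter> space P) * measure P (Zm v) * measure P (Zm w)" if "v \<noteq> w" for v w
          by (rule marks(2)[OF ZE ZE that])
      qed
      then have "measure P {\<omega> \<in> space P. infinite {c. par' \<omega> c = Some (s j)}} = 1"
        by (subst prob_Collect_eq_1[OF sets_infinite_children])
      then show ?thesis unfolding deg[OF j] cell using True by simp
    next
      case False
      then have "AE \<omega> in P. finite {c. par' \<omega> c = Some (s j)}" by (intro AE_finite_children) simp
      then have "measure P {\<omega> \<in> space P. infinite {c. par' \<omega> c = Some (s j)}} = 0"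
        by (subst prob_Collect_eq_0[OF sets_infinite_children]) simp
      then show ?thesis unfolding deg[OF j] cell using False by simp
    qed
  qed

  have 5: "(\<lambda>\<omega>. emeasure (count_space UNIV) (D v \<omega>)) \<in> borel_measurable P" for v
    unfolding D_def p' by (rule measurable_card_descendants)

  show ?thesis using 1 2 3 4 5 by blast
qed

end
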